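(* Let $p$ be a prime with $p\equiv 3\pmod 4$. (i) We have $$(-1)^{\left|\left\{(j,k):\ 1\le j<k\le (p-1)/2,\ \{j(j+1)\}_p>\{k(k+1)\}_p\right\}\right|}=(-1)^{\lfloor (p+1)/8\rfloor}.$$ (ii) Suppose $p>3$ and write $T_m=m(m+1)/2$ for $m\in\mathbb{N}$. Then $$(-1)^{\left|\left\{(j,k):\ 1\le j<k\le (p-1)/2,\ \{T_j\}_p>\{T_k\}_p\right\}\right|}=(-1)^{\frac{h(-p)+1}{2}+\left|\left\{1\le k\le \lfloor\frac{p+1}8\rfloor:\ \left(\frac kp\right)=1\right\}\right|}.$$
   Context: For an integer $x$, $\{x\}_p$ denotes the least nonnegative residue of $x$ modulo $p$. $\left(\frac{\cdot}{p}\right)$ is the Legendre symbol, and $h(-p)$ denotes the class number of the imaginary quadratic field $\mathbb{Q}(\sqrt{-p})$. The pairs $(j,k)$ are ordered pairs of integers. *)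

theory Defs
  imports
    Complex_Main
    "HOL-Library.Nat_Bijection"
    "HOL-Computational_Algebra.Polynomial"
    "HOL-Algebra.Ideal"
    "HOL-Number_Theory.Number_Theory"
begin

definition quadratic_field :: "int \<Rightarrow> complex set" where
  "quadratic_field d = {a + b * csqrt (of_int d) | a b. a \<in> \<rat> \<and> b \<in> \<rat>}"

definition ring_of_integers :: "complex set \<Rightarrow> complex ring" where
  "ring_of_integers K =
     \<lparr>carrier = {z \<in> K. algebraic_int z}, mult = (*), one = 1, zero = 0, add = (+)\<rparr>"

definition nonzero_ideals :: "('a, 'b) ring_scheme \<Rightarrow> 'a set set" where
  "nonzero_ideals R = {I. ideal I R \<and> I \<noteq> {\<zero>\<^bsub>R\<^esub>}}"

(* I and J lie in the same ideal class iff (a) I = (b) J for some nonzero a, b.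
   Every fractional ideal class contains an integral ideal, so the classes of
   nonzero integral ideals are the elements of the ideal class group. *)
definition ideal_class_rel :: "('a, 'b) ring_scheme \<Rightarrow> ('a set \<times> 'a set) set" where
  "ideal_class_rel R =
     {(I, J). I \<in> nonzero_ideals R \<and> J \<in> nonzero_ideals R \<and>
        (\<exists>a \<in> carrier R - {\<zero>\<^bsub>R\<^esub>}. \<exists>b \<in> carrier R - {\<zero>\<^bsub>R\<^esub>}.
           a <#\<^bsub>R\<^esub> I = b <#\<^bsub>R\<^esub> J)}"

definition class_number :: "complex set \<Rightarrow> nat" where
  "class_number K =
     card (nonzero_ideals (ring_of_integers K) // ideal_class_rel (ring_of_integers K))"

end

theory Submission
  imports Defs "HOL-Probability.Distributions" "HOL-Computational_Algebra.Formal_Power_Series"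
begin

text \<open>
  Let \<open>b\<^sub>j\<close> be the least residues in question. The parity of the number of inversions is the Legendre
  symbol of \<open>\<Prod>\<^sub>j\<^sub><\<^sub>k (b\<^sub>k - b\<^sub>j)\<close>, which factorises, divided by that of the same product over the increasing
  enumeration of the set \<open>{b\<^sub>j}\<close>. This set is a translate modulo \<open>p\<close> of the set of quadratic residues or
  nonresidues, for \<open>4 j (j + 1) = (2 j + 1)\<^sup>2 - 1\<close>; the sign of the sorted product of a set of odd size is
  invariant under cyclic translation, and for the residues and nonresidues it is found by counting
  \<open>a + b + c = p\<close> with prescribed characters. This settles (i), and in (ii) leaves the parity of the number
  \<open>\<nu>\<close> of nonresidues below \<open>p/2\<close>.

  It remains to see that \<open>(h(-p) + 1)/2\<close> and \<open>\<nu>\<close> have the same parity. Splitting \<open>\<Sum> a \<chi>(a)\<close> at \<open>p/2\<close> and by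
  parity of \<open>a\<close> reduces this to the class number formula \<open>p h(-p) = - \<Sum> a \<chi>(a)\<close>, which comes from computing
  \<open>lim t \<Sum> exp (- t N(I))\<close> as \<open>t\<close> decreases to 0, the sum being over the nonzero ideals \<open>I\<close>, in two ways.
  Every ideal class contributes \<open>\<pi>/\<surd>p\<close>, by comparing the sum over the values of its quadratic form with a
  Gaussian integral. On the other hand there are \<open>\<Sum> \<chi>(d)\<close>, \<open>d\<close> dividing \<open>n\<close>, ideals of norm \<open>n\<close>, and the Gauss
  sum, whose sign is needed, turns \<open>\<chi>(d)\<close> into \<open>\<Sum> \<chi>(a) sin (2\<pi>ad/p)\<close>, after which the sum over \<open>d\<close> is
  geometric.\<close>

section \<open>The quadratic character modulo a prime congruent to 3 modulo 4\<close>

text \<open>The symbol detects inversions because \<open>chi (-1) = -1\<close>: the character of a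
  difference determines its sign once the character of its absolute value is known. The number
  \<open>m = (p - 1) / 2\<close> of residues is odd, and this oddness is what makes cyclic
  translation harmless. The sign of the Gauss sum matters although \<open>h\<close> is positive: the
  formula up to sign would leave the sign of the character sum below p/2 open, and for odd
  \<open>h\<close> replacing \<open>h\<close> by \<open>-h\<close> changes the parity of
  \<open>(h + 1) / 2\<close>. Exponential sums in place of Dirichlet series keep every rearrangement
  inside an absolutely summable family at a fixed t > 0; the limit is taken at the very end, from
  explicit error bounds. Finiteness of the class group comes out of the same limit, since the total
  is finite and all classes contribute the same positive amount. The bound p > 3 leaves 1 and -1 as
  the only units, so that each ideal of a class belongs to exactly two pairs of coordinates.\<close>

text \<open>The HOL-Number-Theory fact: other theories shadow its short name.\<close>
lemmas cong_iff_mod_eq = unique_euclidean_semiring_class.cong_def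

locale prime_3_mod_4 =
  fixes p :: nat
  assumes prime_p: "prime p" and p_mod_4: "p mod 4 = 3"
begin

abbreviation P :: int where "P \<equiv> int p"
definition m :: nat where "m = (p - 1) div 2"
definition chi :: "int \<Rightarrow> int" where "chi a = Legendre a P"

lemma p_gt_2: "p > 2" and odd_p: "odd p"
  using p_mod_4 by (presburger)+

lemma prime_P: "prime P" using prime_p by simp

lemma p_eq: "p = 2 * m + 1" "P = 2 * int m + 1" and odd_m: "odd m" and m_pos: "m > 0"
proof -
  show "p = 2 * m + 1" unfolding m_def using p_mod_4 by presburger
  then show "P = 2 * int m + 1" by simp
  show "odd m" unfolding m_def using p_mod_4 by presburger
  then show "m > 0" by (rule odd_pos)
qed

lemma chi_values: "chi a = 1 \<or> chi a = -1 \<or> chi a = 0"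
  by (simp add: chi_def Legendre_def)

lemma chi_eq_0_iff: "chi a = 0 \<longleftrightarrow> P dvd a"
  by (simp add: chi_def Legendre_def cong_0_iff)

lemma chi_cong: "[a = b] (mod P) \<Longrightarrow> chi a = chi b"
  unfolding chi_def Legendre_def QuadRes_def
  by (simp add: cong_0_iff cong_dvd_iff) (metis cong_sym cong_trans)

lemma chi_mod [simp]: "chi (a mod P) = chi a"
  by (rule chi_cong) simp

lemma chi_euler: "[chi a = a ^ m] (mod P)"
  unfolding chi_def m_def using euler_criterion[OF prime_p p_gt_2] by simp

text \<open>Character identities are proved modulo \<open>P\<close> from Euler's criterion and
  become equalities here: -1, 0 and 1 are pairwise incongruent since \<open>P > 2\<close>.\<close>

lemma chi_unique:
  assumes "[x = y] (mod P)" "x \<in> {-1, 0, 1}" "y \<in> {-1, 0, 1}"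
  shows "x = y"
proof -
  have "P dvd x - y" using assms(1) by (simp add: cong_iff_dvd_diff)
  moreover have "\<bar>x - y\<bar> < P" using assms(2,3) p_gt_2 by auto
  ultimately show ?thesis using dvd_imp_le_int[of "x - y" P] by fastforce
qed

lemma chi_mult: "chi (a * b) = chi a * chi b"
proof (rule chi_unique)
  have "[chi (a * b) = (a * b) ^ m] (mod P)" by (rule chi_euler)
  also have "(a * b) ^ m = a ^ m * b ^ m" by (rule power_mult_distrib)
  also have "[a ^ m * b ^ m = chi a * chi b] (mod P)"
    by (intro cong_mult cong_sym[OF chi_euler])
  finally show "[chi (a * b) = chi a * chi b] (mod P)" .
  show "chi (a * b) \<in> {-1, 0, 1}" "chi a * chi b \<in> {-1, 0, 1}"
    using chi_values[of "a * b"] chi_values[of a] chi_values[of b] by auto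
qed

lemma chi_1 [simp]: "chi 1 = 1"
proof (rule chi_unique)
  show "[chi 1 = 1] (mod P)" using chi_euler[of 1] by simp
qed (use chi_values[of 1] in auto)

lemma chi_0 [simp]: "chi 0 = 0" by (simp add: chi_eq_0_iff)

lemma chi_m1: "chi (-1) = -1"
proof (rule chi_unique)
  show "[chi (-1) = -1] (mod P)" using chi_euler[of "-1"] odd_m by simp
qed (use chi_values[of "-1"] in auto)

lemma chi_minus [simp]: "chi (- a) = - chi a"
  using chi_mult[of "-1" a] chi_m1 by simp

lemma chi_minus_commute: "chi (a - b) = - chi (b - a)"
  using chi_minus[of "b - a"] by simp

lemma chi_P_minus [simp]: "chi (P - a) = - chi a"
  using chi_cong[of "P - a" "- a"] by (simp add: cong_iff_dvd_diff)

lemma chi_prod: "chi (prod f A) = (\<Prod>x\<in>A. chi (f x))"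
  by (induction A rule: infinite_finite_induct) (auto simp: chi_mult)

lemma chi_power: "chi (a ^ k) = chi a ^ k"
  by (induction k) (auto simp: chi_mult)

lemma chi_square: "\<not> P dvd a \<Longrightarrow> chi a * chi a = 1"
  using chi_values[of a] chi_eq_0_iff[of a] by auto

lemma chi_nonzero_range: "0 < a \<Longrightarrow> a < P \<Longrightarrow> chi a = 1 \<or> chi a = -1"
  using chi_values[of a] chi_eq_0_iff[of a] zdvd_not_zless by blast

lemma not_P_dvd_2: "\<not> P dvd 2"
  using p_gt_2 zdvd_not_zless[of 2 P] by simp

lemma mod_mult_cancel:
  assumes "\<not> P dvd c" "(a * c) mod P = (b * c) mod P" shows "a mod P = b mod P"
proof -
  have "coprime c P" using prime_imp_coprime[OF prime_P assms(1)] by (simp add: coprime_commute)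
  then show ?thesis using assms(2) cong_mult_rcancel[of c P a b] by (simp add: cong_iff_mod_eq)
qed

lemma bij_mult:
  assumes "\<not> P dvd c"
  shows "bij_betw (\<lambda>a. (a * c) mod P) {0..<P} {0..<P}" "bij_betw (\<lambda>a. (a * c) mod P) {1..<P} {1..<P}"
proof -
  have inj: "inj_on (\<lambda>a. (a * c) mod P) {0..<P}"
    by (auto simp: inj_on_def dest!: mod_mult_cancel[OF assms])
  have P0: "P > 0" using p_gt_2 by simp
  have "(\<lambda>a. (a * c) mod P) ` {0..<P} \<subseteq> {0..<P}" using P0 by auto
  with inj show b: "bij_betw (\<lambda>a. (a * c) mod P) {0..<P} {0..<P}"
    by (simp add: bij_betw_def endo_inj_surj)
  have "bij_betw (\<lambda>a. (a * c) mod P) ({0..<P} - {0}) ({0..<P} - {(0 * c) mod P})"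
    by (rule bij_betw_DiffI[OF b]) (use P0 in \<open>auto simp: bij_betw_def\<close>)
  moreover have "{0..<P} - {0} = {1..<P}" by auto
  ultimately show "bij_betw (\<lambda>a. (a * c) mod P) {1..<P} {1..<P}" by simp
qed

lemma bij_shift: "bij_betw (\<lambda>a. (a + c) mod P) {0..<P} {0..<P}"
proof -
  have P0: "P > 0" using p_gt_2 by simp
  have inj: "inj_on (\<lambda>a. (a + c) mod P) {0..<P}"
  proof (rule inj_onI)
    fix a b assume ab: "a \<in> {0..<P}" "b \<in> {0..<P}" and eq: "(a + c) mod P = (b + c) mod P"
    then have "[a = b] (mod P)" using cong_add_rcancel[of a c b P] by (simp add: cong_iff_mod_eq)
    then show "a = b" using ab by (simp add: cong_iff_mod_eq)
  qed
  moreover have "(\<lambda>a. (a + c) mod P) ` {0..<P} \<subseteq> {0..<P}" using P0 by auto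
  ultimately show ?thesis by (simp add: bij_betw_def endo_inj_surj)
qed

lemma sum_chi: "(\<Sum>a\<in>{1..<P}. chi a) = 0" "(\<Sum>a\<in>{0..<P}. chi a) = 0"
proof -
  have "(\<Sum>a\<in>{1..<P}. chi a) = (\<Sum>a\<in>{1..<P}. chi (P - a))"
    by (rule sum.reindex_bij_witness[of _ "\<lambda>a. P - a" "\<lambda>a. P - a"]) auto
  then show *: "(\<Sum>a\<in>{1..<P}. chi a) = 0" by (simp add: sum_negf)
  have "{0..<P} = insert 0 {1..<P}" using p_gt_2 by auto
  then show "(\<Sum>a\<in>{0..<P}. chi a) = 0" using * by simp
qed

lemma sum_chi_count:
  assumes "finite A" "\<And>a. a \<in> A \<Longrightarrow> \<not> P dvd a"
  shows "(\<Sum>a\<in>A. chi a) = int (card {a \<in> A. chi a = 1}) - int (card {a \<in> A. chi a = -1})"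
    and "card A = card {a \<in> A. chi a = 1} + card {a \<in> A. chi a = -1}"
proof -
  have A: "A = {a \<in> A. chi a = 1} \<union> {a \<in> A. chi a = -1}"
    using assms(2) chi_values chi_eq_0_iff by blast
  have fin: "finite {a \<in> A. chi a = 1}" "finite {a \<in> A. chi a = -1}" using assms(1) by auto
  have disj: "{a \<in> A. chi a = 1} \<inter> {a \<in> A. chi a = -1} = {}" by auto
  show "card A = card {a \<in> A. chi a = 1} + card {a \<in> A. chi a = -1}"
    using card_Un_disjoint[OF fin disj] A by simp
  have "(\<Sum>a\<in>A. chi a) = (\<Sum>a\<in>{a \<in> A. chi a = 1}. chi a) + (\<Sum>a\<in>{a \<in> A. chi a = -1}. chi a)"
    using sum.union_disjoint[OF fin disj, of chi] A by simp
  then show "(\<Sum>a\<in>A. chi a) = int (card {a \<in> A. chi a = 1}) - int (card {a \<in> A. chi a = -1})"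
    by simp
qed

lemma not_P_dvd_range: "0 < a \<Longrightarrow> a < P \<Longrightarrow> \<not> P dvd a"
  by (simp add: zdvd_not_zless)

definition quad_res :: "int set" where "quad_res = {a. 0 < a \<and> a < P \<and> chi a = 1}"
definition quad_nonres :: "int set" where "quad_nonres = {a. 0 < a \<and> a < P \<and> chi a = -1}"
definition nu :: nat where "nu = card {a. 0 < a \<and> a \<le> int m \<and> chi a = -1}"

lemma finite_quad_res [simp]: "finite quad_res" and finite_quad_nonres [simp]: "finite quad_nonres"
  unfolding quad_res_def quad_nonres_def by (rule finite_subset[of _ "{0..P}"]; auto)+

lemma card_quad_res: "card quad_res = m" and card_quad_nonres: "card quad_nonres = m"
proof -
  have *: "\<And>a. a \<in> {1..<P} \<Longrightarrow> \<not> P dvd a" using not_P_dvd_range by auto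
  have "quad_res = {a \<in> {1..<P}. chi a = 1}" "quad_nonres = {a \<in> {1..<P}. chi a = -1}"
    by (auto simp: quad_res_def quad_nonres_def)
  with sum_chi_count[of "{1..<P}", OF _ *] sum_chi(1) have "card quad_res = card quad_nonres" "p - 1 = card quad_res + card quad_nonres"
    by auto
  then show "card quad_res = m" "card quad_nonres = m" using p_eq by auto
qed

text \<open>By Gauss's lemma: the doubles 2, 4, ..., 2m are their own least residues, and those
  above \<open>m\<close> come from the \<open>(m + 1) / 2 = (p + 1) / 4\<close> integers k with m/2
  < k \<le> m.\<close>

lemma chi_2: "chi 2 = (-1) ^ ((p + 1) div 4)"
proof -
  interpret GAUSS p 2
    by standard (use prime_p p_gt_2 not_P_dvd_2 in \<open>auto simp: cong_0_iff\<close>)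
  have mm: "(P - 1) div 2 = int m" using p_eq by simp
  have P0: "2 * a < P" if "a \<le> int m" for a using that p_eq by simp
  have B': "B = {b. even b \<and> 0 < b \<and> b \<le> 2 * int m}"
    unfolding B_def A_def mm by (auto elim!: evenE)
  have C': "C = B"
    unfolding C_def using P0 by (force simp: B' p_eq(2) elim!: evenE)
  have "E = (\<lambda>k. 2 * k) ` {int m div 2 + 1 .. int m}"
    unfolding E_def C' mm B' by (auto elim!: evenE)
  then have "card E = card {int m div 2 + 1 .. int m}"
    by (simp add: card_image inj_on_def)
  also have "\<dots> = (p + 1) div 4" using p_eq(1) odd_m by (auto elim!: oddE simp: nat_add_distrib)
  finally show ?thesis unfolding chi_def using gauss_lemma by simp
qed

lemma chi_2_cases:
  "p mod 8 = 7 \<and> chi 2 = 1 \<or> p mod 8 = 3 \<and> chi 2 = -1"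
proof -
  have "p mod 8 = 7 \<or> p mod 8 = 3" using p_mod_4 by presburger
  moreover have "even ((p + 1) div 4)" if "p mod 8 = 7" using that by presburger
  moreover have "odd ((p + 1) div 4)" if "p mod 8 = 3" using that by presburger
  ultimately show ?thesis by (auto simp: chi_2)
qed

end

section \<open>Inversions and products of differences\<close>

lemma even_card_involution:
  assumes "finite A" "\<And>x. x \<in> A \<Longrightarrow> f x \<in> A \<and> f (f x) = x \<and> f x \<noteq> x"
  shows "even (card A)"
  using assms
proof (induction A rule: finite_psubset_induct)
  case (psubset A)
  show ?case
  proof (cases "A = {}")
    case False
    then obtain x where x: "x \<in> A" by blast
    note fx = psubset.prems[OF x]
    define B where "B = A - {x, f x}"
    have "even (card B)"
    proof (rule psubset.IH)
      show "B \<subset> A" using x by (auto simp: B_def)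
      fix y assume "y \<in> B"
      then show "f y \<in> B \<and> f (f y) = y \<and> f y \<noteq> y"
        using psubset.prems[of y] fx unfolding B_def by (metis Diff_iff empty_iff insert_iff)
    qed
    moreover have "A = insert x (insert (f x) B)" using x fx by (auto simp: B_def)
    then have "card A = card B + 2"
      using psubset.hyps fx by (metis B_def Diff_iff add_2_eq_Suc' card_insert_disjoint finite_Diff
          finite_insert insert_iff)
    ultimately show ?thesis by simp
  qed auto
qed

lemma even_card_iff_fixed_points:
  assumes "finite A" "\<And>x. x \<in> A \<Longrightarrow> f x \<in> A \<and> f (f x) = x"
  shows "even (card A) \<longleftrightarrow> even (card {x \<in> A. f x = x})"
proof -
  have "even (card {x \<in> A. f x \<noteq> x})"
    by (rule even_card_involution[of _ f]) (use assms in auto)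
  moreover have "A = {x \<in> A. f x = x} \<union> {x \<in> A. f x \<noteq> x}" by auto
  then have "card A = card {x \<in> A. f x = x} + card {x \<in> A. f x \<noteq> x}"
    using card_Un_disjoint[of "{x \<in> A. f x = x}" "{x \<in> A. f x \<noteq> x}"] assms(1) by auto
  ultimately show ?thesis by simp
qed

lemma prod_if_neg_one:
  assumes "finite A"
  shows "(\<Prod>x\<in>A. if Q x then - 1 else 1 :: int) = (-1) ^ card {x \<in> A. Q x}"
  using assms by (simp add: prod.If_cases Int_def)

context prime_3_mod_4
begin

text \<open>This is the Legendre symbol of the Vandermonde product of the increasing enumeration of
  \<open>X\<close>. The dummy factor 1 makes it a function of the set, without any sorting.\<close>

definition pair_sign :: "int set \<Rightarrow> int" where
  "pair_sign X = (\<Prod>s\<in>X. \<Prod>t\<in>X. if s < t then chi (t - s) else 1)"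

lemma pair_sign_insert:
  assumes "finite X" "a \<notin> X"
  shows "pair_sign (insert a X) = pair_sign X * (\<Prod>t\<in>X. chi \<bar>t - a\<bar>)"
proof -
  have "pair_sign (insert a X) = (\<Prod>t\<in>X. if a < t then chi (t - a) else 1) *
      ((\<Prod>s\<in>X. if s < a then chi (a - s) else 1) * pair_sign X)"
    using assms by (simp add: pair_sign_def prod.distrib)
  also have "\<dots> = pair_sign X * (\<Prod>t\<in>X. (if a < t then chi (t - a) else 1) * (if t < a then chi (a - t) else 1))"
    by (simp add: prod.distrib algebra_simps)
  also have "(\<Prod>t\<in>X. (if a < t then chi (t - a) else 1) * (if t < a then chi (a - t) else 1))
      = (\<Prod>t\<in>X. chi \<bar>t - a\<bar>)"
    by (rule prod.cong) (use assms(2) in auto)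
  finally show ?thesis .
qed

lemma pair_sign_translate: "pair_sign ((\<lambda>x. x + c) ` X) = pair_sign X"
  by (simp add: pair_sign_def prod.reindex inj_on_def cong: if_cong)

text \<open>Only \<open>P - 1\<close> can wrap round. The distance \<open>t + 1\<close> of the
  shifted t from the new element 0 and the distance \<open>P - 1 - t\<close> of t from the old top
  element add up to \<open>P\<close>, so \<open>chi\<close> takes opposite values on them; the
  number of such t is even.\<close>

lemma pair_sign_shift1:
  assumes "X \<subseteq> {0..<P}" "odd (card X)"
  shows "pair_sign ((\<lambda>x. (x + 1) mod P) ` X) = pair_sign X"
proof -
  have fin: "finite X" using assms(1) by (rule finite_subset) simp
  have lt: "(x + 1) mod P = x + 1" if "x \<in> X - {P - 1}" for x
    using that assms(1) by (intro mod_pos_pos_trivial) auto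
  show ?thesis
  proof (cases "P - 1 \<in> X")
    case False
    then have "(\<lambda>x. (x + 1) mod P) ` X = (\<lambda>x. x + 1) ` X"
      by (intro image_cong refl lt) auto
    then show ?thesis by (simp only: pair_sign_translate)
  next
    case True
    define Y where "Y = X - {P - 1}"
    have X: "X = insert (P - 1) Y" and nin: "P - 1 \<notin> Y" and Y: "Y \<subseteq> {0..<P-1}"
      using True assms(1) by (auto simp: Y_def)
    have finY: "finite Y" and ev: "even (card Y)"
      using assms(2) nin fin by (auto simp: X)
    have "(\<lambda>x. (x + 1) mod P) ` Y = (\<lambda>x. x + 1) ` Y"
      by (intro image_cong refl lt) (auto simp: Y_def)
    then have "(\<lambda>x. (x + 1) mod P) ` X = insert 0 ((\<lambda>x. x + 1) ` Y)"
      unfolding X by simp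
    then have "pair_sign ((\<lambda>x. (x + 1) mod P) ` X) = pair_sign Y * (\<Prod>t\<in>Y. chi \<bar>t + 1\<bar>)"
      using pair_sign_insert[of "(\<lambda>x. x + 1) ` Y" 0] finY subsetD[OF Y]
      by (force simp: pair_sign_translate prod.reindex inj_on_def)
    also have "(\<Prod>t\<in>Y. chi \<bar>t + 1\<bar>) = (\<Prod>t\<in>Y. - chi \<bar>t - (P - 1)\<bar>)"
    proof (rule prod.cong)
      fix t assume "t \<in> Y"
      then have "\<bar>t + 1\<bar> = t + 1" "\<bar>t - (P - 1)\<bar> = P - (t + 1)" using Y by auto
      then show "chi \<bar>t + 1\<bar> = - chi \<bar>t - (P - 1)\<bar>" by simp
    qed auto
    also have "\<dots> = (\<Prod>t\<in>Y. chi \<bar>t - (P - 1)\<bar>)" using ev by (simp add: prod_uminus)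
    also have "pair_sign Y * \<dots> = pair_sign X"
      using pair_sign_insert[OF finY nin] by (simp add: X)
    finally show ?thesis .
  qed
qed

text \<open>Moving the least element of an odd set past the other ones flips an even number of signs.\<close>

lemma pair_sign_shift:
  assumes "X \<subseteq> {0..<P}" "odd (card X)"
  shows "pair_sign ((\<lambda>x. (x + c) mod P) ` X) = pair_sign X"
proof -
  have P0: "P > 0" using p_gt_2 by simp
  have "pair_sign ((\<lambda>x. (x + int k) mod P) ` X) = pair_sign X" for k
  proof (induction k)
    case 0
    have "(\<lambda>x. (x + int 0) mod P) ` X = X"
      using assms(1) by (force simp: image_iff)
    then show ?case by simp
  next
    case (Suc k)
    let ?Y = "(\<lambda>x. (x + int k) mod P) ` X"
    have "inj_on (\<lambda>x. (x + int k) mod P) X"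
      using bij_shift[of "int k"] assms(1) by (auto simp: bij_betw_def intro: inj_on_subset)
    then have "odd (card ?Y)" using assms(2) by (simp add: card_image)
    moreover have "?Y \<subseteq> {0..<P}" using P0 by auto
    ultimately have "pair_sign ((\<lambda>x. (x + 1) mod P) ` ?Y) = pair_sign ?Y"
      by (intro pair_sign_shift1)
    moreover have "(\<lambda>x. (x + 1) mod P) ` ?Y = (\<lambda>x. (x + int (Suc k)) mod P) ` X"
      by (simp add: image_image mod_simps algebra_simps)
    ultimately show ?case using Suc by simp
  qed
  from this[of "nat (c mod P)"] show ?thesis using P0 by (simp add: mod_simps)
qed

text \<open>For j < k the product of \<open>chi (a k - a j)\<close> and
  \<open>chi |a k - a j|\<close> is -1 exactly at an inversion, because \<open>chi\<close> is
  odd.\<close>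

lemma inversion_sign:
  fixes a :: "nat \<Rightarrow> int"
  assumes "inj_on a {1..n}" "a ` {1..n} \<subseteq> {0..<P}"
  shows "(-1) ^ card {(j, k). 1 \<le> j \<and> j < k \<and> k \<le> n \<and> a j > a k}
     = (\<Prod>k\<in>{1..n}. \<Prod>j\<in>{1..<k}. chi (a k - a j)) * pair_sign (a ` {1..n})"
proof -
  \<comment> \<open>The pairs of values are enumerated by index here and by size in
    \<open>pair_sign\<close>; the absolute value makes the two products agree.\<close>
  have eq: "(\<Prod>k\<in>{1..n}. \<Prod>j\<in>{1..<k}. chi \<bar>a k - a j\<bar>) = pair_sign (a ` {1..n})"
    using assms
  proof (induction n)
    case 0
    then show ?case by (simp add: pair_sign_def)
  next
    case (Suc n)
    have 1: "{1..Suc n} = insert (Suc n) {1..n}" by auto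
    have inj: "inj_on a {1..n}" using Suc.prems(1) by (rule inj_on_subset) auto
    have nin: "a (Suc n) \<notin> a ` {1..n}" using Suc.prems(1) by (force simp: inj_on_def)
    have "pair_sign (a ` {1..Suc n}) = pair_sign (a ` {1..n}) * (\<Prod>t\<in>a ` {1..n}. chi \<bar>t - a (Suc n)\<bar>)"
      unfolding 1 image_insert by (rule pair_sign_insert) (use nin in auto)
    also have "(\<Prod>t\<in>a ` {1..n}. chi \<bar>t - a (Suc n)\<bar>) = (\<Prod>j\<in>{1..n}. chi \<bar>a (Suc n) - a j\<bar>)"
      using inj by (simp add: prod.reindex abs_minus_commute)
    also have "{1..n} = {1..<Suc n}" by auto
    also have "pair_sign (a ` {1..<Suc n}) = pair_sign (a ` {1..n})" by (simp add: atLeastLessThanSuc_atLeastAtMost)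
    finally have "pair_sign (a ` {1..Suc n}) = pair_sign (a ` {1..n}) * (\<Prod>j\<in>{1..<Suc n}. chi \<bar>a (Suc n) - a j\<bar>)" .
    moreover have "a ` {1..n} \<subseteq> {0..<P}" using Suc.prems(2) by (auto simp: image_subset_iff)
    note Suc.IH[OF inj this, symmetric]
    ultimately show ?case by (simp only: prod.cl_ivl_Suc) simp
  qed
  let ?A = "SIGMA k:{1..n}. {1..<k}"
  have "{(j, k). 1 \<le> j \<and> j < k \<and> k \<le> n \<and> a j > a k} = prod.swap ` {x \<in> ?A. a (snd x) > a (fst x)}"
    by force
  then have "card {(j, k). 1 \<le> j \<and> j < k \<and> k \<le> n \<and> a j > a k} = card {x \<in> ?A. a (snd x) > a (fst x)}"
    by (simp add: card_image)
  then have "(-1) ^ card {(j, k). 1 \<le> j \<and> j < k \<and> k \<le> n \<and> a j > a k}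
      = (\<Prod>x\<in>?A. if a (snd x) > a (fst x) then -1 else 1 :: int)"
    by (subst prod_if_neg_one) auto
  also have "\<dots> = (\<Prod>x\<in>?A. chi (a (fst x) - a (snd x)) * chi \<bar>a (fst x) - a (snd x)\<bar>)"
  proof (rule prod.cong)
    fix x assume "x \<in> ?A"
    then obtain j k where x: "x = (k, j)" and jk: "j \<in> {1..n}" "k \<in> {1..n}" "j \<noteq> k" by fastforce
    have "a j \<noteq> a k" using jk inj_onD[OF assms(1)] by blast
    moreover have "a j \<in> {0..<P}" "a k \<in> {0..<P}" using jk assms(2) by (meson image_subset_iff)+
    ultimately have "\<bar>a k - a j\<bar> > 0" "\<bar>a k - a j\<bar> < P" by auto
    then have "chi \<bar>a k - a j\<bar> * chi \<bar>a k - a j\<bar> = 1" by (intro chi_square not_P_dvd_range)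
    moreover have "chi (a k - a j) = (if a j > a k then - chi \<bar>a k - a j\<bar> else chi \<bar>a k - a j\<bar>)"
      using chi_minus[of "a k - a j"] by auto
    ultimately show "(if a (snd x) > a (fst x) then -1 else 1)
        = chi (a (fst x) - a (snd x)) * chi \<bar>a (fst x) - a (snd x)\<bar>"
      unfolding x fst_conv snd_conv by (cases "a j > a k") (simp_all only: if_True if_False mult_minus_left)
  qed simp
  also have "\<dots> = (\<Prod>k\<in>{1..n}. \<Prod>j\<in>{1..<k}. chi (a k - a j) * chi \<bar>a k - a j\<bar>)"
    by (subst prod.Sigma) (auto simp: case_prod_unfold)
  also have "\<dots> = (\<Prod>k\<in>{1..n}. \<Prod>j\<in>{1..<k}. chi (a k - a j)) * pair_sign (a ` {1..n})"
    by (simp only: prod.distrib eq)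
  finally show ?thesis .
qed

lemma pair_sign_count:
  assumes "X \<subseteq> {0..<P}"
  shows "pair_sign X = (-1) ^ card {(s, t). s \<in> X \<and> t \<in> X \<and> s < t \<and> chi (t - s) = -1}"
proof -
  have fin: "finite X" using assms by (rule finite_subset) simp
  have "pair_sign X = (\<Prod>s\<in>X. \<Prod>t\<in>X. if s < t \<and> chi (t - s) = -1 then -1 else 1)"
    unfolding pair_sign_def
  proof (intro prod.cong refl)
    fix s t assume "s \<in> X" "t \<in> X"
    then show "(if s < t then chi (t - s) else 1) = (if s < t \<and> chi (t - s) = -1 then -1 else 1)"
      using chi_nonzero_range[of "t - s"] subsetD[OF assms, of s] subsetD[OF assms, of t] by auto
  qed
  also have "\<dots> = (\<Prod>x\<in>X \<times> X. if fst x < snd x \<and> chi (snd x - fst x) = -1 then -1 else 1)"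
    by (simp add: prod.cartesian_product case_prod_unfold)
  also have "\<dots> = (-1) ^ card {x \<in> X \<times> X. fst x < snd x \<and> chi (snd x - fst x) = -1}"
    by (rule prod_if_neg_one) (use fin in simp)
  also have "{x \<in> X \<times> X. fst x < snd x \<and> chi (snd x - fst x) = -1}
      = {(s, t). s \<in> X \<and> t \<in> X \<and> s < t \<and> chi (t - s) = -1}" by auto
  finally show ?thesis .
qed

text \<open>Writing \<open>a = s\<close>, \<open>b = t - s\<close>, \<open>c = P - t\<close>, the pairs counted by \<open>pair_sign_count\<close> are the
  compositions \<open>a + b + c = P\<close> with prescribed characters; those of \<open>b\<close> and \<open>c\<close> agree for
  \<open>quad_res\<close>, those of \<open>a\<close> and \<open>b\<close> for \<open>quad_nonres\<close>, so only the fixed points of a swap matter.\<close>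

lemma pair_sign_quad_res: "pair_sign quad_res = (if chi 2 = 1 then (-1) ^ nu else 1)"
proof -
  let ?F = "{(s, t). s \<in> quad_res \<and> t \<in> quad_res \<and> s < t \<and> chi (t - s) = -1}"
  let ?f = "\<lambda>(s, t). (s, s + P - t)"
  have fin: "finite ?F" by (rule finite_subset[of _ "quad_res \<times> quad_res"]) auto
  have "even (card ?F) \<longleftrightarrow> even (card {x \<in> ?F. ?f x = x})"
  proof (rule even_card_iff_fixed_points[OF fin])
    fix x assume "x \<in> ?F"
    then obtain s t where x: "x = (s, t)" and h: "s \<in> quad_res" "t \<in> quad_res" "s < t" "chi (t - s) = -1" by auto
    have "chi (s + P - t) = 1" using h chi_P_minus[of "t - s"] by (simp add: algebra_simps)
    moreover have "chi (P - t) = -1" using h by (simp add: quad_res_def)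
    ultimately show "?f x \<in> ?F \<and> ?f (?f x) = x" using h by (simp add: x quad_res_def)
  qed
  \<comment> \<open>With b = P - t, a fixed point has t - s = b, so s = P - 2b and
    \<open>chi s = - chi 2 * chi b = chi 2\<close>, which has to be 1.\<close>
  moreover have "{x \<in> ?F. ?f x = x} = (\<lambda>b. (P - 2 * b, P - b)) ` {b. 0 < b \<and> b \<le> int m \<and> chi b = -1 \<and> chi 2 = 1}"
    (is "?A = ?g ` ?B")
  proof (intro Set.equalityI subsetI)
    fix x assume "x \<in> ?A"
    then obtain s t where x: "x = (s, t)" and h: "s \<in> quad_res" "t \<in> quad_res" "s < t" "chi (t - s) = -1" "2 * t = s + P" by auto
    have 1: "chi (P - t) = -1" using h by (simp add: quad_res_def)
    have "s = P - 2 * (P - t)" using h by simp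
    then have "chi s = - chi (2 * (P - t))" by (metis chi_P_minus)
    then have "1 = - (chi 2 * -1)" using 1 h(1) by (simp only: quad_res_def chi_mult mem_Collect_eq)
    then have "chi 2 = 1" by simp
    moreover have "x = ?g (P - t)" using h by (simp add: x)
    moreover have "0 < P - t" "P - t \<le> int m" using h p_eq(2) by (auto simp: quad_res_def)
    ultimately show "x \<in> ?g ` ?B" using 1 by blast
  next
    fix x assume "x \<in> ?g ` ?B"
    then obtain b where x: "x = (P - 2 * b, P - b)" and b: "0 < b" "b \<le> int m" "chi b = -1" "chi 2 = 1" by auto
    have "chi (P - 2 * b) = 1" "chi (P - b) = 1" using b by (simp_all add: chi_mult)
    then show "x \<in> ?A" using b p_eq(2) by (simp add: x quad_res_def)
  qed
  moreover have "card (?g ` ?B) = card ?B" by (rule card_image) (auto simp: inj_on_def)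
  moreover have "card ?B = (if chi 2 = 1 then nu else 0)" by (simp add: nu_def)
  moreover have "quad_res \<subseteq> {0..<P}" by (auto simp: quad_res_def)
  ultimately show ?thesis
    using pair_sign_count[of quad_res] by (simp add: minus_one_power_iff split: if_splits)
qed

lemma pair_sign_quad_nonres:
  assumes "chi 2 = -1" shows "pair_sign quad_nonres = 1"
proof -
  let ?F = "{(s, t). s \<in> quad_nonres \<and> t \<in> quad_nonres \<and> s < t \<and> chi (t - s) = -1}"
  let ?f = "\<lambda>(s, t). (t - s, t)"
  have "even (card ?F)"
  proof (rule even_card_involution[of _ ?f])
    show "finite ?F" by (rule finite_subset[of _ "quad_nonres \<times> quad_nonres"]) auto
    fix x assume "x \<in> ?F"
    then obtain s t where x: "x = (s, t)" and h: "s \<in> quad_nonres" "t \<in> quad_nonres" "s < t" "chi (t - s) = -1" by auto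
    \<comment> \<open>A fixed point would have t = 2s, and then
      \<open>chi t = chi 2 * chi s = 1\<close>.\<close>
    have "t \<noteq> 2 * s" using h assms by (auto simp: quad_nonres_def chi_mult)
    then show "?f x \<in> ?F \<and> ?f (?f x) = x \<and> ?f x \<noteq> x" using h by (simp add: x quad_nonres_def)
  qed
  moreover have "quad_nonres \<subseteq> {0..<P}" by (auto simp: quad_nonres_def)
  ultimately show ?thesis using pair_sign_count[of quad_nonres] by simp
qed

section \<open>The product of the differences\<close>

lemma chi_fact_square: "k < p \<Longrightarrow> chi (fact k) * chi (fact k) = 1"
proof (rule chi_square)
  assume "k < p"
  then show "\<not> P dvd fact k"
    using prime_dvd_fact_iff[OF prime_p, of k] by (metis not_le of_nat_dvd_iff of_nat_fact)
qed

text \<open>Wilson's theorem is the case i = 0. Each further step moves one factor from the second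
  factorial to the first, and \<open>p - 1 - i\<close> is minus \<open>i + 1\<close> modulo
  p.\<close>

lemma chi_fact_complement: "i < p \<Longrightarrow> chi (fact i) * chi (fact (p - 1 - i)) = (-1) ^ (i + 1)"
proof (induction i)
  case 0
  have "[fact (p - 1) = (-1::int)] (mod P)" using wilson_theorem[OF prime_p] by simp
  then show ?case using chi_cong[of "fact (p - 1)" "-1"] by simp
next
  case (Suc i)
  have "p - 1 - i = Suc (p - 1 - Suc i)" using Suc.prems by simp
  then have "fact (p - 1 - i) = int (p - 1 - i) * fact (p - 1 - Suc i)" by (metis fact_Suc)
  also have "int (p - 1 - i) = P - int (Suc i)" using Suc.prems by simp
  finally have "chi (fact (p - 1 - i)) = - (chi (int (Suc i)) * chi (fact (p - 1 - Suc i)))"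
    by (simp only: chi_mult chi_P_minus)
  moreover have "chi (fact (Suc i)) = chi (int (Suc i)) * chi (fact i)"
    by (simp only: fact_Suc chi_mult of_nat_id)
  ultimately have "chi (fact (Suc i)) * chi (fact (p - 1 - Suc i)) = - (chi (fact i) * chi (fact (p - 1 - i)))"
    by (simp only: mult_ac mult_minus_right minus_minus)
  then show ?case using Suc by simp
qed

text \<open>Pair k with m - k: since \<open>2 * (m - k) = p - 1 - 2 * k\<close>, the two factorials
  are complementary, and each of the (m + 1)/2 pairs contributes -1 because 2k is even.\<close>

lemma prod_chi_even_facts: "(\<Prod>k\<in>{0..m}. chi (fact (2 * k))) = (-1) ^ ((m + 1) div 2)"
proof -
  define h where "h = (m + 1) div 2"
  have m: "m = 2 * h - 1" "h > 0" using odd_m by (auto simp: h_def elim!: oddE)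
  have "{0..m} = {0..<h} \<union> {h..m}" using m by auto
  then have "(\<Prod>k\<in>{0..m}. chi (fact (2 * k))) = (\<Prod>k\<in>{0..<h}. chi (fact (2 * k))) * (\<Prod>k\<in>{h..m}. chi (fact (2 * k)))"
    by (metis finite_atLeastAtMost finite_atLeastLessThan ivl_disj_int_two(7) prod.union_disjoint)
  also have "(\<Prod>k\<in>{h..m}. chi (fact (2 * k))) = (\<Prod>k\<in>{0..<h}. chi (fact (2 * (m - k))))"
    by (rule prod.reindex_bij_witness[of _ "\<lambda>k. m - k" "\<lambda>k. m - k"]) (use m in auto)
  also have "(\<Prod>k\<in>{0..<h}. chi (fact (2 * k))) * \<dots> = (\<Prod>k\<in>{0..<h}. -1)"
    unfolding prod.distrib[symmetric]
  proof (rule prod.cong)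
    fix k assume k: "k \<in> {0..<h}"
    then have "2 * (m - k) = p - 1 - 2 * k" "2 * k < p" using p_eq(1) m by auto
    then show "chi (fact (2 * k)) * chi (fact (2 * (m - k))) = -1"
      using chi_fact_complement[of "2 * k"] by simp
  qed simp
  finally show ?thesis by (simp add: h_def)
qed

text \<open>Telescopes up to squares: every integer from 2 to n occurs twice.\<close>

lemma prod_chi_consecutive:
  "n < p - 1 \<Longrightarrow> (\<Prod>k\<in>{1..n}. chi (int k) * chi (int k + 1)) = chi (int n + 1)"
proof (induction n)
  case (Suc n)
  have "\<not> P dvd int n + 1" using Suc.prems by (intro not_P_dvd_range) auto
  then have "chi (int n + 1) * chi (int n + 1) = 1" by (rule chi_square)
  then show ?case using Suc by (simp add: algebra_simps)
qed simp

lemma chi_m_plus_1: "chi (int m + 1) = chi 2"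
proof -
  have "2 * (int m + 1) = P + 1" using p_eq(2) by simp
  then have "chi (2 * (int m + 1)) = chi (P + 1)" by (rule arg_cong)
  also have "\<dots> = 1" using chi_cong[of "P + 1" 1] by (simp add: cong_iff_dvd_diff)
  finally have "chi 2 * chi (int m + 1) = 1" by (simp only: chi_mult)
  then show ?thesis using chi_values[of 2] chi_values[of "int m + 1"] by auto
qed

text \<open>Each difference factors as (k - j)(k + j + 1), so the product over j < k is (k - 1)!
  (2k)! / (k + 1)!, with the character of k (k + 1) (2k)!. The factors k (k + 1) telescope to
  \<open>chi 2\<close>, the factorials give \<open>(-1) ^ ((p + 1) div 4)\<close>, and the two agree
  by the supplementary law.\<close>

lemma prod_chi_differences:
  "(\<Prod>k\<in>{1..m}. \<Prod>j\<in>{1..<k}. chi (int (k * (k + 1)) - int (j * (j + 1)))) = 1"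
proof -
  have "(\<Prod>j\<in>{1..<k}. chi (int (k * (k + 1)) - int (j * (j + 1))))
      = chi (int k) * chi (int k + 1) * chi (fact (2 * k))" if k: "k \<in> {1..m}" for k
  proof -
    have e: "int (k * (k + 1)) - int (j * (j + 1)) = int (k - j) * int (k + j + 1)" if "j \<in> {1..<k}" for j
      using that by (simp add: of_nat_diff algebra_simps)
    have "(\<Prod>j\<in>{1..<k}. chi (int (k * (k + 1)) - int (j * (j + 1))))
      = chi (\<Prod>j\<in>{1..<k}. int (k - j)) * chi (\<Prod>j\<in>{1..<k}. int (k + j + 1))"
      by (simp only: prod.cong[OF refl arg_cong[OF e, of _ chi]] chi_prod chi_mult prod.distrib)
    also have "(\<Prod>j\<in>{1..<k}. int (k - j)) = (\<Prod>j\<in>{1..k-1}. int j)"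
      by (rule prod.reindex_bij_witness[of _ "\<lambda>j. k - j" "\<lambda>j. k - j"]) auto
    also have "\<dots> = fact (k - 1)" by (simp add: fact_prod)
    finally have 1: "(\<Prod>j\<in>{1..<k}. chi (int (k * (k + 1)) - int (j * (j + 1))))
      = chi (fact (k - 1)) * chi (\<Prod>j\<in>{1..<k}. int (k + j + 1))" .
    have "fact (2 * k) = (\<Prod>j\<in>{1..2*k}. int j)" by (simp add: fact_prod)
    also have "{1..2*k} = {1..k+1} \<union> {k+2..2*k}" using k by auto
    also have "(\<Prod>j\<in>{1..k+1} \<union> {k+2..2*k}. int j) = (\<Prod>j\<in>{1..k+1}. int j) * (\<Prod>j\<in>{k+2..2*k}. int j)"
      by (rule prod.union_disjoint) auto
    also have "(\<Prod>j\<in>{k+2..2*k}. int j) = (\<Prod>j\<in>{1..<k}. int (k + j + 1))"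
      by (rule prod.reindex_bij_witness[of _ "\<lambda>j. k + j + 1" "\<lambda>j. j - k - 1"]) auto
    also have "(\<Prod>j\<in>{1..k+1}. int j) = fact (k + 1)" by (simp only: fact_prod of_nat_prod)
    finally have 2: "chi (fact (2 * k)) = chi (fact (k + 1)) * chi (\<Prod>j\<in>{1..<k}. int (k + j + 1))"
      by (simp only: chi_mult)
    have 3: "chi (fact (k + 1)) = chi (int k + 1) * (chi (int k) * chi (fact (k - 1)))"
    proof -
      have "(fact (k + 1) :: int) = (int k + 1) * (int k * fact (k - 1))"
        using k by (cases k) (auto simp: algebra_simps)
      then show ?thesis by (simp only: chi_mult)
    qed
    have sq: "chi (fact (k - 1)) * chi (fact (k - 1)) = 1"
      using k p_eq(1) by (intro chi_fact_square) auto
    have sq2: "chi (int k) * chi (int k) = 1" "chi (int k + 1) * chi (int k + 1) = 1"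
      by (rule chi_square, rule not_P_dvd_range, use k p_eq(2) in auto)+
    have "chi (int k) * chi (int k + 1) * chi (fact (2 * k))
      = (chi (int k) * chi (int k)) * (chi (int k + 1) * chi (int k + 1)) * chi (fact (k - 1)) * chi (\<Prod>j\<in>{1..<k}. int (k + j + 1))"
      unfolding 2 3 by (simp add: mult_ac)
    then show ?thesis unfolding 1 sq2 by simp
  qed
  then have "(\<Prod>k\<in>{1..m}. \<Prod>j\<in>{1..<k}. chi (int (k * (k + 1)) - int (j * (j + 1))))
      = (\<Prod>k\<in>{1..m}. chi (int k) * chi (int k + 1)) * (\<Prod>k\<in>{1..m}. chi (fact (2 * k)))"
    by (simp add: prod.distrib)
  also have "(\<Prod>k\<in>{1..m}. chi (int k) * chi (int k + 1)) = chi 2"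
    using prod_chi_consecutive[of m] p_eq(1) m_pos chi_m_plus_1 by simp
  also have "(\<Prod>k\<in>{1..m}. chi (fact (2 * k))) = (\<Prod>k\<in>{0..m}. chi (fact (2 * k)))"
    by (subst (2) prod.atLeast_Suc_atMost) auto
  also have "\<dots> = (-1) ^ ((m + 1) div 2)" by (rule prod_chi_even_facts)
  also have "(m + 1) div 2 = (p + 1) div 4" using p_eq(1) by simp
  also have "chi 2 * (-1) ^ ((p + 1) div 4) = 1" unfolding chi_2 by (simp flip: power_mult_distrib)
  finally show ?thesis .
qed

lemma chi_4 [simp]: "chi 4 = 1"
proof -
  have "chi (2 * 2) = 1" unfolding chi_mult by (rule chi_square[OF not_P_dvd_2])
  then show ?thesis by simp
qed

text \<open>Modulo \<open>P\<close>, \<open>b j + w\<close> is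
  \<open>w * (2 * int j + 1)\<^sup>2\<close>. As j runs from 1 to m, the odd number 2j + 1 runs from
  3 to P: the square class of 1, which would give w, is left out, and j = m gives 0. So the
  translated set is A, the set {0} \<union> T without w, where T consists of the elements with the
  character of w. The sign of A follows by evaluating \<open>pair_sign\<close> of {0} \<union> T
  twice, as A with w added and as T with 0 added.\<close>

lemma pair_sign_affine_image:
  fixes b :: "nat \<Rightarrow> int" and u w :: int
  assumes w: "0 < w" "w < P" and uw: "[u * w = 1] (mod P)"
    and b: "\<And>j. u * b j + 1 = (2 * int j + 1)\<^sup>2"
  defines "s \<equiv> \<lambda>j. b j mod P"
  defines "c \<equiv> card {t. 0 < t \<and> t < w \<and> chi t = chi w}"
  shows "inj_on s {1..m}" "s ` {1..m} \<subseteq> {0..<P}"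
    "pair_sign (s ` {1..m}) = - pair_sign {t. 0 < t \<and> t < P \<and> chi t = chi w} * chi 2 * (-1) ^ c"
proof -
  define T where "T = {t. 0 < t \<and> t < P \<and> chi t = chi w}"
  define f where "f = (\<lambda>j. (w * (2 * int j + 1)\<^sup>2) mod P)"
  have P0: "P > 0" using p_gt_2 by simp
  have ndw: "\<not> P dvd w" using w by (rule not_P_dvd_range)
  have chiw: "chi w = 1 \<or> chi w = -1" using w by (rule chi_nonzero_range)
  have fs: "f j = (s j + w) mod P" for j
  proof -
    have "[w * (u * b j + 1) = 1 * b j + w] (mod P)"
      using cong_add[OF cong_scalar_right[OF uw, of "b j"] cong_refl[of w P]]
      by (simp add: algebra_simps)
    then have "[w * (2 * int j + 1)\<^sup>2 = b j + w] (mod P)" by (simp add: b)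
    then show ?thesis by (simp add: f_def s_def cong_iff_mod_eq mod_simps)
  qed
  have inj_f: "inj_on f {1..m}"
  proof (rule inj_onI)
    fix j k assume jk: "j \<in> {1..m}" "k \<in> {1..m}" and "f j = f k"
    then have "((2 * int j + 1)\<^sup>2 * w) mod P = ((2 * int k + 1)\<^sup>2 * w) mod P" by (simp add: f_def mult.commute)
    then have "P dvd (2 * int j + 1)\<^sup>2 - (2 * int k + 1)\<^sup>2"
      using mod_mult_cancel[OF ndw] mod_eq_dvd_iff by blast
    also have "(2 * int j + 1)\<^sup>2 - (2 * int k + 1)\<^sup>2 = (2 * 2) * ((int j - int k) * (int j + int k + 1))"
      by (simp add: power2_eq_square algebra_simps)
    finally have "P dvd int j - int k \<or> P dvd int j + int k + 1"
      using not_P_dvd_2 by (simp only: prime_dvd_mult_iff[OF prime_P]) auto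
    moreover have "P dvd int j + int k + 1 \<Longrightarrow> int j + int k + 1 = P"
      using zdvd_imp_le[of P "int j + int k + 1"] jk p_eq(2) by auto
    moreover have "P dvd int j - int k \<Longrightarrow> j = k"
      using dvd_imp_le_int[of "int j - int k" P] jk p_eq(2) by fastforce
    ultimately show "j = k" using jk p_eq(2) by auto
  qed
  show inj_s: "inj_on s {1..m}" using inj_onD[OF inj_f] by (intro inj_onI) (simp add: fs)
  show s_sub: "s ` {1..m} \<subseteq> {0..<P}" using P0 by (auto simp: s_def)
  have T_cases: "T = (if chi w = 1 then quad_res else quad_nonres)"
    using chiw by (auto simp: T_def quad_res_def quad_nonres_def)
  have finT: "finite T" and cardT: "card T = m"
    using T_cases card_quad_res card_quad_nonres by auto
  have wT: "w \<in> T" using w by (simp add: T_def)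
  define A where "A = f ` {1..m}"
  have fin: "finite A" by (simp add: A_def)
  \<comment> \<open>One inclusion is enough, as both sets have m elements.\<close>
  have "A \<subseteq> insert 0 T - {w}"
  proof
    fix t assume "t \<in> A"
    then obtain j where j: "j \<in> {1..m}" and t: "t = f j" by (auto simp: A_def)
    have "t \<noteq> w"
    proof
      assume "t = w"
      then have "((2 * int j + 1)\<^sup>2 * w) mod P = (1 * w) mod P" using w by (simp add: t f_def mult.commute)
      then have "P dvd (2 * int j + 1)\<^sup>2 - 1"
        using mod_mult_cancel[OF ndw] mod_eq_dvd_iff by blast
      also have "(2 * int j + 1)\<^sup>2 - 1 = (2 * 2) * (int j * (int j + 1))"
        by (simp add: power2_eq_square algebra_simps)
      finally have "P dvd int j \<or> P dvd int j + 1"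
        using not_P_dvd_2 by (simp only: prime_dvd_mult_iff[OF prime_P]) auto
      moreover have "\<not> P dvd int j" "\<not> P dvd int j + 1"
        by (rule not_P_dvd_range; use j p_eq(2) in auto)+
      ultimately show False by blast
    qed
    moreover have "0 \<le> t" "t < P" using P0 by (auto simp: t f_def)
    moreover have "chi t = chi w" if "t \<noteq> 0"
    proof -
      have "\<not> P dvd (2 * int j + 1)"
      proof
        assume "P dvd (2 * int j + 1)"
        then have "P dvd w * (2 * int j + 1)\<^sup>2" by (simp add: power2_eq_square)
        then show False using that by (simp add: t f_def)
      qed
      then show ?thesis by (simp add: t f_def chi_mult power2_eq_square chi_square)
    qed
    ultimately show "t \<in> insert 0 T - {w}" by (auto simp: T_def)
  qed
  moreover have "card A = m" using inj_f by (simp add: A_def card_image)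
  moreover have "card (insert 0 T - {w}) = m" using finT cardT wT w by (simp add: T_def)
  ultimately have A: "A = insert 0 T - {w}" by (intro card_subset_eq) (use finT in auto)
  have "A = (\<lambda>x. (x + w) mod P) ` (s ` {1..m})" by (simp add: A_def fs image_image)
  moreover have "odd (card (s ` {1..m}))" using inj_s odd_m by (simp add: card_image)
  ultimately have eq1: "pair_sign A = pair_sign (s ` {1..m})" using pair_sign_shift[OF s_sub] by simp
  have insA: "insert 0 T = insert w A" using A wT by auto
  have wA: "w \<notin> A" using A by simp
  \<comment> \<open>Modulo P the differences are 4 w j (j + 1), so the product telescopes; of the m
    factors \<open>chi w\<close> one survives because m is odd.\<close>
  have prodA: "(\<Prod>t\<in>A. chi (t - w)) = chi w * chi 2"
  proof -
    have "(\<Prod>t\<in>A. chi (t - w)) = (\<Prod>j\<in>{1..m}. chi (f j - w))"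
      unfolding A_def by (simp only: prod.reindex[OF inj_f] o_def)
    also have "\<dots> = (\<Prod>j\<in>{1..m}. chi w * (chi (int j) * chi (int j + 1)))"
    proof (rule prod.cong)
      fix j
      have "chi (f j - w) = chi (w * (2 * int j + 1)\<^sup>2 - w)"
        by (rule chi_cong) (simp add: f_def cong_iff_mod_eq mod_simps)
      also have "w * (2 * int j + 1)\<^sup>2 - w = w * (4 * (int j * (int j + 1)))"
        by (simp add: power2_eq_square algebra_simps)
      finally show "chi (f j - w) = chi w * (chi (int j) * chi (int j + 1))" by (simp only: chi_mult chi_4; simp)
    qed simp
    also have "\<dots> = chi w ^ m * chi (int m + 1)"
      using prod_chi_consecutive[of m] p_eq(1) m_pos by (simp add: prod.distrib)
    also have "chi w ^ m = chi w" using chiw odd_m by auto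
    finally show ?thesis by (simp only: chi_m_plus_1)
  qed
  have "(\<Prod>t\<in>A. chi \<bar>t - w\<bar>) = (\<Prod>t\<in>A. (if t < w then -1 else 1) * chi (t - w))"
    by (rule prod.cong) (auto simp: chi_minus_commute[of w])
  also have "\<dots> = (-1) ^ card {t \<in> A. t < w} * (chi w * chi 2)"
    by (simp only: prod.distrib prod_if_neg_one[OF fin] prodA)
  \<comment> \<open>Besides the c elements of T, also 0 lies below w; it is the source of the minus
    sign in the conclusion.\<close>
  also have "{t \<in> A. t < w} = insert 0 {t. 0 < t \<and> t < w \<and> chi t = chi w}"
    using w by (auto simp: A T_def)
  also have "card \<dots> = Suc c"
    unfolding c_def by (rule card_insert_disjoint) (auto intro: finite_subset[of _ "{0..w}"])
  finally have prod_abs: "(\<Prod>t\<in>A. chi \<bar>t - w\<bar>) = - (chi w * chi 2 * (-1) ^ c)" by simp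
  have "pair_sign (insert 0 T) = pair_sign A * (\<Prod>t\<in>A. chi \<bar>t - w\<bar>)"
    unfolding insA by (rule pair_sign_insert[OF fin wA])
  then have eq2: "pair_sign (insert 0 T) = - pair_sign A * (chi w * chi 2 * (-1) ^ c)"
    by (simp add: prod_abs)
  have sq: "(chi w * chi 2 * (-1) ^ c) * (chi w * chi 2 * (-1) ^ c) = 1"
  proof -
    have "chi w * chi w = 1" "chi 2 * chi 2 = 1" "(-1::int) ^ c * (-1) ^ c = 1"
      using chiw chi_square[OF not_P_dvd_2] by (auto simp flip: power_mult_distrib)
    then show ?thesis by (metis mult.assoc mult.commute mult_1)
  qed
  have "pair_sign (insert 0 T) = pair_sign T * (\<Prod>t\<in>T. chi \<bar>t - 0\<bar>)"
    by (rule pair_sign_insert[OF finT]) (simp add: T_def)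
  also have "(\<Prod>t\<in>T. chi \<bar>t - 0\<bar>) = (\<Prod>t\<in>T. chi w)" by (rule prod.cong) (auto simp: T_def)
  also have "\<dots> = chi w" using cardT chiw odd_m by auto
  finally have eq3: "pair_sign (insert 0 T) = pair_sign T * chi w" .
  have "pair_sign A = - pair_sign (insert 0 T) * (chi w * chi 2 * (-1) ^ c)"
    unfolding eq2 using sq by (metis (no_types, opaque_lifting) mult.assoc mult.right_neutral mult_minus_left minus_minus)
  also have "\<dots> = - pair_sign T * (chi w * chi w) * chi 2 * (-1) ^ c"
    by (simp add: eq3)
  also have "chi w * chi w = 1" using chiw by auto
  finally show "pair_sign (s ` {1..m}) = - pair_sign {t. 0 < t \<and> t < P \<and> chi t = chi w} * chi 2 * (-1) ^ c"
    by (simp add: eq1 T_def)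
qed

section \<open>Character sums over quarters and eighths of the period\<close>

lemma sum_chi_double_evens:
  "(\<Sum>a\<in>{k+1..l}. chi (2 * a)) = (\<Sum>e\<in>{e \<in> {2*k+1..2*l}. even e}. chi e)"
  by (rule sum.reindex_bij_witness[of _ "\<lambda>e. e div 2" "\<lambda>a. 2 * a"]) auto

text \<open>The numbers P - 2a are odd, and \<open>chi\<close> changes sign under reflection.
  Doubling thus carries sums over short intervals to the even or the odd part of other sums, and
  comparing the two gives linear relations.\<close>

lemma sum_chi_double_odds:
  "(\<Sum>a\<in>{k+1..l}. chi (2 * a)) = - (\<Sum>e\<in>{e \<in> {P-2*l..P-2*k-1}. odd e}. chi e)"
proof -
  have "(\<Sum>a\<in>{k+1..l}. chi (2 * a)) = (\<Sum>e\<in>{e \<in> {P-2*l..P-2*k-1}. odd e}. - chi e)"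
  proof (rule sum.reindex_bij_witness[of _ "\<lambda>e. (P - e) div 2" "\<lambda>a. P - 2 * a"])
    fix e assume e: "e \<in> {e \<in> {P-2*l..P-2*k-1}. odd e}"
    then have "even (P - e)" using odd_p by simp
    then obtain d where "P - e = 2 * d" by (elim evenE)
    then show "P - 2 * ((P - e) div 2) = e" "(P - e) div 2 \<in> {k + 1..l}" using e by auto
  qed (use odd_p in auto)
  then show ?thesis by (simp add: sum_negf)
qed

lemma sum_parity_split:
  "(\<Sum>e\<in>{1..l}. chi e) = (\<Sum>e\<in>{e \<in> {1..l}. even e}. chi e) + (\<Sum>e\<in>{e \<in> {1..l}. odd e}. chi e)"
proof -
  have "{1..l} = {e \<in> {1..l}. even e} \<union> {e \<in> {1..l}. odd e}" by auto
  then show ?thesis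
    by (smt (verit) sum.union_disjoint disjoint_iff finite_atLeastAtMost_int finite_Un mem_Collect_eq)
qed

lemma sum_chi_split: "0 \<le> k \<Longrightarrow> k \<le> l \<Longrightarrow> (\<Sum>e\<in>{1..l}. chi e) = (\<Sum>e\<in>{1..k}. chi e) + (\<Sum>e\<in>{k+1..l}. chi e)"
proof -
  assume "0 \<le> k" "k \<le> l"
  then have "{1..l} = {1..k} \<union> {k+1..l}" by auto
  then show ?thesis by (simp add: sum.union_disjoint)
qed

text \<open>Let A and B be the sums over the first and the second quarter. Since
  \<open>chi 2 = -1\<close>, doubling shows that the even part of the sum below p/2 is -A and the
  odd part is B, so A + B = -A + B.\<close>

lemma quarter_sum_3:
  assumes "P = 8 * M + 3" "chi 2 = -1"
  shows "(\<Sum>a\<in>{1..2*M}. chi a) = 0"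
proof -
  have M: "M \<ge> 0" using assms(1) by simp
  let ?A = "\<Sum>a\<in>{1..2*M}. chi a" and ?B = "\<Sum>a\<in>{2*M+1..4*M+1}. chi a"
  let ?E = "\<Sum>e\<in>{e \<in> {1..4*M+1}. even e}. chi e" and ?O = "\<Sum>e\<in>{e \<in> {1..4*M+1}. odd e}. chi e"
  have "- ?A = (\<Sum>a\<in>{0+1..2*M}. chi (2 * a))" by (simp add: chi_mult assms(2) sum_negf)
  also have "\<dots> = (\<Sum>e\<in>{e \<in> {2*0+1..2*(2*M)}. even e}. chi e)" by (rule sum_chi_double_evens)
  also have "{e \<in> {2*0+1..2*(2*M)}. even e} = {e \<in> {1..4*M+1}. even e}" by (auto; presburger)
  finally have 1: "- ?A = ?E" .
  have "- ?B = (\<Sum>a\<in>{2*M+1..4*M+1}. chi (2 * a))" by (simp add: chi_mult assms(2) sum_negf)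
  also have "\<dots> = - (\<Sum>e\<in>{e \<in> {P-2*(4*M+1)..P-2*(2*M)-1}. odd e}. chi e)" by (rule sum_chi_double_odds)
  also have "{e \<in> {P-2*(4*M+1)..P-2*(2*M)-1}. odd e} = {e \<in> {1..4*M+1}. odd e}"
    unfolding assms(1) by (auto; presburger)
  finally have 2: "?B = ?O" by simp
  have "?A + ?B = (\<Sum>a\<in>{1..4*M+1}. chi a)" using sum_chi_split[of "2*M" "4*M+1"] M by simp
  also have "\<dots> = ?E + ?O" by (rule sum_parity_split)
  finally show ?thesis using 1 2 by simp
qed

text \<open>Doubling takes the first interval to the even numbers up to 2M and the last one, after
  reflection, to the odd ones. The two parts are minus the first sum and plus the last, and their
  total vanishes by \<open>quarter_sum_3\<close>.\<close>

lemma eighth_sum_3: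
  assumes "P = 8 * M + 3" "chi 2 = -1"
  shows "(\<Sum>a\<in>{1..M}. chi a) = (\<Sum>a\<in>{3*M+2..4*M+1}. chi a)"
proof -
  let ?A = "\<Sum>a\<in>{1..M}. chi a" and ?B = "\<Sum>a\<in>{3*M+2..4*M+1}. chi a"
  let ?E = "\<Sum>e\<in>{e \<in> {1..2*M}. even e}. chi e" and ?O = "\<Sum>e\<in>{e \<in> {1..2*M}. odd e}. chi e"
  have "- ?A = (\<Sum>a\<in>{0+1..M}. chi (2 * a))" by (simp add: chi_mult assms(2) sum_negf)
  also have "\<dots> = (\<Sum>e\<in>{e \<in> {2*0+1..2*M}. even e}. chi e)" by (rule sum_chi_double_evens)
  finally have 1: "- ?A = ?E" by simp
  have "- ?B = (\<Sum>a\<in>{(3*M+1)+1..4*M+1}. chi (2 * a))" by (simp add: chi_mult assms(2) sum_negf add.commute)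
  also have "\<dots> = - (\<Sum>e\<in>{e \<in> {P-2*(4*M+1)..P-2*(3*M+1)-1}. odd e}. chi e)" by (rule sum_chi_double_odds)
  also have "{e \<in> {P-2*(4*M+1)..P-2*(3*M+1)-1}. odd e} = {e \<in> {1..2*M}. odd e}"
    unfolding assms(1) by auto
  finally have 2: "?B = ?O" by simp
  have "?E + ?O = (\<Sum>a\<in>{1..2*M}. chi a)" by (rule sum_parity_split[symmetric])
  then show ?thesis using 1 2 quarter_sum_3[OF assms] by simp
qed

text \<open>With \<open>chi 2 = 1\<close>, the even part of the sum below p/2 is the first quarter A
  and the odd part is minus the second quarter B, so A + B = A - B.\<close>

lemma quarter_sum_7:
  assumes "P = 8 * M + 7" "chi 2 = 1"
  shows "(\<Sum>a\<in>{2*M+2..4*M+3}. chi a) = 0"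
proof -
  have M: "M \<ge> 0" using assms(1) by simp
  let ?A = "\<Sum>a\<in>{1..2*M+1}. chi a" and ?B = "\<Sum>a\<in>{2*M+2..4*M+3}. chi a"
  let ?E = "\<Sum>e\<in>{e \<in> {1..4*M+3}. even e}. chi e" and ?O = "\<Sum>e\<in>{e \<in> {1..4*M+3}. odd e}. chi e"
  have "?A = (\<Sum>a\<in>{0+1..2*M+1}. chi (2 * a))" by (simp add: chi_mult assms(2))
  also have "\<dots> = (\<Sum>e\<in>{e \<in> {2*0+1..2*(2*M+1)}. even e}. chi e)" by (rule sum_chi_double_evens)
  also have "{e \<in> {2*0+1..2*(2*M+1)}. even e} = {e \<in> {1..4*M+3}. even e}" by (auto; presburger)
  finally have 1: "?A = ?E" .
  have "?B = (\<Sum>a\<in>{(2*M+1)+1..4*M+3}. chi (2 * a))" by (simp add: chi_mult assms(2) add.commute)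
  also have "\<dots> = - (\<Sum>e\<in>{e \<in> {P-2*(4*M+3)..P-2*(2*M+1)-1}. odd e}. chi e)" by (rule sum_chi_double_odds)
  also have "{e \<in> {P-2*(4*M+3)..P-2*(2*M+1)-1}. odd e} = {e \<in> {1..4*M+3}. odd e}"
    unfolding assms(1) by (auto; presburger)
  finally have 2: "?B = - ?O" by simp
  have "?A + ?B = (\<Sum>a\<in>{1..4*M+3}. chi a)" using sum_chi_split[of "2*M+1" "4*M+3"] M by (simp add: add.commute)
  also have "\<dots> = ?E + ?O" by (rule sum_parity_split)
  finally show ?thesis using 1 2 by simp
qed

lemma card_chi_interval:
  assumes "0 < k" "l < P"
  shows "2 * int (card {a \<in> {k..l}. chi a = 1}) = int (card {k..l}) + (\<Sum>a\<in>{k..l}. chi a)"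
    "2 * int (card {a \<in> {k..l}. chi a = -1}) = int (card {k..l}) - (\<Sum>a\<in>{k..l}. chi a)"
proof -
  have "\<not> P dvd a" if "a \<in> {k..l}" for a using that assms by (intro not_P_dvd_range) auto
  from sum_chi_count[of "{k..l}", OF _ this]
  show "2 * int (card {a \<in> {k..l}. chi a = 1}) = int (card {k..l}) + (\<Sum>a\<in>{k..l}. chi a)"
    "2 * int (card {a \<in> {k..l}. chi a = -1}) = int (card {k..l}) - (\<Sum>a\<in>{k..l}. chi a)" by simp_all
qed

section \<open>The inversion numbers of the two sequences\<close>

lemma nu_alt: "nu = card {a \<in> {1..int m}. chi a = -1}"
  unfolding nu_def by (rule arg_cong[of _ _ card]) auto

text \<open>The two sequences are the instances u = 4, for the products j (j + 1), and u = 8, for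
  the triangular numbers; w is the inverse of u modulo P.\<close>

lemma inversion_sign_affine:
  fixes b :: "nat \<Rightarrow> nat" and u w :: int
  assumes w: "0 < w" "w < P" and uw: "[u * w = 1] (mod P)"
    and b: "\<And>j. u * int (b j) + 1 = (2 * int j + 1)\<^sup>2"
    and diff: "(\<Prod>k\<in>{1..m}. \<Prod>j\<in>{1..<k}. chi (int (b k) - int (b j))) = 1"
  shows "(-1 :: int) ^ card {(j, k). 1 \<le> j \<and> j < k \<and> k \<le> (p - 1) div 2 \<and> b j mod p > b k mod p}
    = - pair_sign {t. 0 < t \<and> t < P \<and> chi t = chi w} * chi 2
        * (-1) ^ card {t. 0 < t \<and> t < w \<and> chi t = chi w}"
proof -
  let ?s = "\<lambda>j. int (b j) mod P"
  note aff = pair_sign_affine_image[of w u "\<lambda>j. int (b j)", OF w uw b]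
  have "{(j, k). 1 \<le> j \<and> j < k \<and> k \<le> (p - 1) div 2 \<and> b j mod p > b k mod p}
      = {(j, k). 1 \<le> j \<and> j < k \<and> k \<le> m \<and> ?s j > ?s k}"
    by (simp only: m_def of_nat_mod[symmetric] of_nat_less_iff)
  moreover have "(\<Prod>k\<in>{1..m}. \<Prod>j\<in>{1..<k}. chi (?s k - ?s j)) = 1"
    unfolding diff[symmetric] by (intro prod.cong refl chi_cong) (simp add: cong_iff_mod_eq mod_simps)
  ultimately show ?thesis
    using inversion_sign[OF aff(1,2)] aff(3) by (simp only: mult_1)
qed

lemma nat_card_eq: "card {k :: nat. 1 \<le> k \<and> k \<le> n \<and> Legendre (int k) (int p) = 1} = card {t. 0 < t \<and> t \<le> int n \<and> chi t = 1}"
proof -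
  have "{t. 0 < t \<and> t \<le> int n \<and> chi t = 1} = int ` {k :: nat. 1 \<le> k \<and> k \<le> n \<and> Legendre (int k) (int p) = 1}"
  proof (intro Set.equalityI subsetI)
    fix t assume t: "t \<in> {t. 0 < t \<and> t \<le> int n \<and> chi t = 1}"
    then have "t = int (nat t)" by simp
    moreover have "nat t \<in> {k :: nat. 1 \<le> k \<and> k \<le> n \<and> Legendre (int k) (int p) = 1}"
      using t by (auto simp: chi_def)
    ultimately show "t \<in> int ` {k :: nat. 1 \<le> k \<and> k \<le> n \<and> Legendre (int k) (int p) = 1}" by blast
  qed (auto simp: chi_def)
  then show ?thesis by (simp add: card_image)
qed

lemma mod_8_cases:
  obtains (three) M where "P = 8 * int M + 3" "m = 4 * M + 1" "(p + 1) div 8 = M" "chi 2 = -1"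
  | (seven) M where "P = 8 * int M + 7" "m = 4 * M + 3" "(p + 1) div 8 = M + 1" "chi 2 = 1"
proof -
  define M where "M = p div 8"
  have d: "p = 8 * M + p mod 8" by (simp add: M_def)
  from chi_2_cases show ?thesis
  proof (elim disjE conjE)
    assume h: "p mod 8 = 7" "chi 2 = 1"
    then have "p = 8 * M + 7" using d by simp
    then show ?thesis using seven[of M] h(2) p_eq by simp
  next
    assume h: "p mod 8 = 3" "chi 2 = -1"
    then have "p = 8 * M + 3" using d by simp
    then show ?thesis using three[of M] h(2) p_eq by simp
  qed
qed

text \<open>The inverse w = (p + 1)/4 of 4 is a residue, and c counts the residues in the first
  quarter. For p \<equiv> 3 modulo 8 the character sum over that quarter vanishes, so c = M. For p
  \<equiv> 7 the second quarter has sum 0, which determines c + nu, and this is what occurs because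
  the sign of \<open>quad_res\<close> is \<open>(-1) ^ nu\<close>.\<close>

lemma pronic_inversions:
  "(-1 :: int) ^ card {(j :: nat, k :: nat). 1 \<le> j \<and> j < k \<and> k \<le> (p - 1) div 2 \<and>
             (j * (j + 1)) mod p > (k * (k + 1)) mod p} = (-1) ^ ((p + 1) div 8)"
proof -
  define w where "w = int ((p + 1) div 4)"
  have w4: "4 * w = P + 1" using p_mod_4 unfolding w_def by presburger
  have w: "0 < w" "w < P" using w4 p_gt_2 by auto
  have uw: "[4 * w = 1] (mod P)" unfolding w4 by (simp add: cong_iff_dvd_diff)
  have "chi (4 * w) = 1" using chi_cong[OF uw] by simp
  then have chiw: "chi w = 1" by (simp only: chi_mult chi_4; simp)
  have res: "{t. 0 < t \<and> t < P \<and> chi t = chi w} = quad_res" by (simp add: chiw quad_res_def)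
  define c where "c = card {t. 0 < t \<and> t < w \<and> chi t = chi w}"
  have c: "c = card {a \<in> {1..w - 1}. chi a = 1}"
    unfolding c_def chiw by (rule arg_cong[of _ _ card]) auto
  have main: "(-1 :: int) ^ card {(j :: nat, k :: nat). 1 \<le> j \<and> j < k \<and> k \<le> (p - 1) div 2 \<and>
             (j * (j + 1)) mod p > (k * (k + 1)) mod p} = - pair_sign quad_res * chi 2 * (-1) ^ c"
    unfolding c_def res[symmetric]
    by (rule inversion_sign_affine[OF w uw _ prod_chi_differences]) (simp add: power2_eq_square algebra_simps)
  show ?thesis
  proof (cases rule: mod_8_cases)
    case (three M)
    have wM: "w - 1 = 2 * int M" using w4 three by simp
    have "2 * int c = int (card {1..2 * int M}) + (\<Sum>a\<in>{1..2 * int M}. chi a)"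
      unfolding c wM by (rule card_chi_interval) (use three in auto)
    also have "(\<Sum>a\<in>{1..2 * int M}. chi a) = 0" by (rule quarter_sum_3) (use three in auto)
    finally have "c = M" by simp
    moreover have "(p + 1) div 8 = M" using three by simp
    ultimately show ?thesis using main three by (simp add: pair_sign_quad_res)
  next
    case (seven M)
    have wM: "w - 1 = 2 * int M + 1" using w4 seven by simp
    have "2 * int c = int (card {1..2 * int M + 1}) + (\<Sum>a\<in>{1..2 * int M + 1}. chi a)"
      unfolding c wM by (rule card_chi_interval) (use seven in auto)
    moreover have "2 * int nu = int (card {1..int m}) - (\<Sum>a\<in>{1..int m}. chi a)"
      unfolding nu_alt by (rule card_chi_interval) (use p_eq in auto)
    moreover have "(\<Sum>a\<in>{1..int m}. chi a) = (\<Sum>a\<in>{1..2 * int M + 1}. chi a) + (\<Sum>a\<in>{2 * int M + 2..4 * int M + 3}. chi a)"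
      using sum_chi_split[of "2 * int M + 1" "int m"] seven by (simp add: add.commute)
    moreover have "(\<Sum>a\<in>{2 * int M + 2..4 * int M + 3}. chi a) = 0" by (rule quarter_sum_7) (use seven in auto)
    ultimately have "2 * int c + 2 * int nu = 6 * int M + 4" using seven by simp
    then have "c + nu = 3 * M + 2" by simp
    moreover have "(p + 1) div 8 = M + 1" using seven by simp
    ultimately show ?thesis using main seven
      by (simp add: pair_sign_quad_res power_add[symmetric] add.commute) (simp add: power_add power_mult)
  qed
qed

text \<open>The inverse w of 8 has the character of 2. For p \<equiv> 7 modulo 8 it is a residue,
  and nu enters through \<open>pair_sign_quad_res\<close>; for p \<equiv> 3 it is a nonresidue, and
  nu enters through the count of nonresidues below w.\<close>

lemma triangle_inversions:
  "(-1 :: int) ^ card {(j :: nat, k :: nat). 1 \<le> j \<and> j < k \<and> k \<le> (p - 1) div 2 \<and>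
             triangle j mod p > triangle k mod p}
   = (-1) ^ (nu + card {k :: nat. 1 \<le> k \<and> k \<le> (p + 1) div 8 \<and> Legendre (int k) (int p) = 1})"
proof -
  have tri: "2 * int (triangle j) = int (j * (j + 1))" for j
  proof -
    have "even (j * (j + 1))" by simp
    then have "2 * triangle j = j * (j + 1)" unfolding triangle_def by simp
    then show ?thesis by (metis of_nat_mult of_nat_numeral)
  qed
  have b: "8 * int (triangle j) + 1 = (2 * int j + 1)\<^sup>2" for j
    using tri[of j] by (simp add: power2_eq_square algebra_simps)
  have pairs: "2 * (\<Sum>k\<in>{1..n}. card {1..<k}) = n * (n - 1)" for n
  proof (induction n)
    case (Suc n)
    then show ?case by (cases n) (auto simp: algebra_simps)
  qed simp
  have diff: "(\<Prod>k\<in>{1..m}. \<Prod>j\<in>{1..<k}. chi (int (triangle k) - int (triangle j))) = 1"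
  proof -
    have "1 = (\<Prod>k\<in>{1..m}. \<Prod>j\<in>{1..<k}. chi (int (k * (k + 1)) - int (j * (j + 1))))"
      by (rule prod_chi_differences[symmetric])
    also have "\<dots> = (\<Prod>k\<in>{1..m}. \<Prod>j\<in>{1..<k}. chi 2 * chi (int (triangle k) - int (triangle j)))"
      unfolding tri[symmetric] right_diff_distrib[symmetric] chi_mult ..
    also have "\<dots> = chi 2 ^ (\<Sum>k\<in>{1..m}. card {1..<k}) * (\<Prod>k\<in>{1..m}. \<Prod>j\<in>{1..<k}. chi (int (triangle k) - int (triangle j)))"
      by (simp only: prod.distrib prod_constant power_sum)
    \<comment> \<open>There is one factor \<open>chi 2\<close> for each of the m (m - 1)/2 pairs.
      When \<open>chi 2 = -1\<close>, this number is even as m = 4M + 1.\<close>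
    also have "chi 2 ^ (\<Sum>k\<in>{1..m}. card {1..<k}) = 1"
    proof (cases rule: mod_8_cases)
      case (three M)
      have "2 * (\<Sum>k\<in>{1..m}. card {1..<k}) = 2 * (2 * ((4 * M + 1) * M))"
        unfolding pairs using three by (simp add: algebra_simps)
      then have "(\<Sum>k\<in>{1..m}. card {1..<k}) = 2 * ((4 * M + 1) * M)" by simp
      then show ?thesis using three by (simp only: power_mult) simp
    qed simp
    finally show ?thesis by simp
  qed
  show ?thesis
  proof (cases rule: mod_8_cases)
    case (three M)
    \<comment> \<open>The inverse of 8, as 8 (5M + 2) = 5P + 1.\<close>
    define w where "w = 5 * int M + 2"
    have "8 * w - 1 = P * 5" by (simp add: w_def three)
    then have uw: "[8 * w = 1] (mod P)" by (simp only: cong_iff_dvd_diff dvd_triv_left)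
    have w: "0 < w" "w < P" by (auto simp: w_def three)
    have "chi (2 * 4 * w) = 1" using chi_cong[OF uw] by simp
    then have chiw: "chi w = -1" by (simp only: chi_mult chi_4 three; simp)
    have res: "{t. 0 < t \<and> t < P \<and> chi t = chi w} = quad_nonres" by (simp add: chiw quad_nonres_def)
    let ?C = "{t. 0 < t \<and> t < w \<and> chi t = chi w}"
    let ?D = "{k :: nat. 1 \<le> k \<and> k \<le> (p + 1) div 8 \<and> Legendre (int k) (int p) = 1}"
    let ?E = "{a \<in> {3 * int M + 2..4 * int M + 1}. chi a = 1}"
    have inv: "(-1 :: int) ^ card {(j :: nat, k :: nat). 1 \<le> j \<and> j < k \<and> k \<le> (p - 1) div 2 \<and>
             triangle j mod p > triangle k mod p} = (-1) ^ card ?C"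
      using inversion_sign_affine[OF w uw b diff] unfolding res pair_sign_quad_nonres[OF three(4)] three(4) by simp
    have D: "card ?D = card {a \<in> {1..int M}. chi a = 1}"
      unfolding nat_card_eq using three by (intro arg_cong[of _ _ card]) auto
    have "2 * int (card ?D) = 2 * int (card ?E)"
    proof -
      have "2 * int (card ?E) = int (card {3 * int M + 2..4 * int M + 1}) + (\<Sum>a\<in>{3 * int M + 2..4 * int M + 1}. chi a)"
        by (rule card_chi_interval) (use three in auto)
      also have "(\<Sum>a\<in>{3 * int M + 2..4 * int M + 1}. chi a) = (\<Sum>a\<in>{1..int M}. chi a)"
        by (rule eighth_sum_3[symmetric]) (use three in auto)
      also have "int (card {3 * int M + 2..4 * int M + 1}) = int (card {1..int M})" by simp
      also have "\<dots> + (\<Sum>a\<in>{1..int M}. chi a) = 2 * int (card {a \<in> {1..int M}. chi a = 1})"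
        by (rule card_chi_interval[symmetric]) (use three in auto)
      finally show ?thesis by (simp only: D)
    qed
    then have DE: "card ?D = card ?E" by simp
    \<comment> \<open>The nonresidues up to m are counted by nu. Those between m and w reflect to
      residues in the last eighth below p/2, which are as many as the residues up to M.\<close>
    have "?C = {a. 0 < a \<and> a \<le> int m \<and> chi a = -1} \<union> (\<lambda>t. P - t) ` ?E" (is "_ = ?C1 \<union> ?C2")
    proof (intro Set.equalityI subsetI)
      fix t assume t: "t \<in> ?C"
      show "t \<in> ?C1 \<union> ?C2"
      proof (cases "t \<le> int m")
        case False
        have "chi (P - t) = 1" using t chiw by simp
        moreover have "P - t \<in> {3 * int M + 2..4 * int M + 1}" using t False three(1,2) by (auto simp: w_def)
        ultimately have "P - t \<in> ?E" by blast
        then show ?thesis by (auto intro!: image_eqI[of _ _ "P - t"])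
      qed (use t chiw in auto)
    next
      fix t assume t: "t \<in> ?C1 \<union> ?C2"
      then have "chi t = -1" by auto
      moreover have "0 < t \<and> t < w" using t three(1,2) by (auto simp: w_def)
      ultimately show "t \<in> ?C" by (simp add: chiw)
    qed
    moreover have "?C1 \<inter> ?C2 = {}" by (auto simp: three)
    moreover have "finite ?C1" by (rule finite_subset[of _ "{0..int m}"]) auto
    moreover have "card ?C2 = card ?E" by (rule card_image) (auto simp: inj_on_def)
    moreover have "finite ?C2"
      by (rule finite_imageI, rule finite_subset[of _ "{3 * int M + 2..4 * int M + 1}"]) auto
    ultimately have "card ?C = nu + card ?E" using card_Un_disjoint[of ?C1 ?C2] by (simp add: nu_def)
    then show ?thesis using inv DE by simp
  next
    case (seven M)
    define w where "w = int M + 1"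
    have "8 * w - 1 = P" by (simp add: w_def seven(1))
    then have uw: "[8 * w = 1] (mod P)" by (simp only: cong_iff_dvd_diff dvd_refl)
    have w: "0 < w" "w < P" by (auto simp: w_def seven)
    have "chi (2 * 4 * w) = 1" using chi_cong[OF uw] by simp
    then have chiw: "chi w = 1" by (simp only: chi_mult chi_4 seven; simp)
    have res: "{t. 0 < t \<and> t < P \<and> chi t = chi w} = quad_res" by (simp add: chiw quad_res_def)
    let ?C = "{t. 0 < t \<and> t < w \<and> chi t = chi w}"
    let ?D = "{k :: nat. 1 \<le> k \<and> k \<le> (p + 1) div 8 \<and> Legendre (int k) (int p) = 1}"
    have inv: "(-1 :: int) ^ card {(j :: nat, k :: nat). 1 \<le> j \<and> j < k \<and> k \<le> (p - 1) div 2 \<and>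
             triangle j mod p > triangle k mod p} = - ((-1) ^ nu * (-1) ^ card ?C)"
      using inversion_sign_affine[OF w uw b diff] unfolding res pair_sign_quad_res seven(4) by simp
    have "card ?D = card {t. 0 < t \<and> t \<le> w \<and> chi t = 1}"
      unfolding nat_card_eq w_def using seven by (intro arg_cong[of _ _ card]) auto
    \<comment> \<open>The bound (p + 1)/8 is w itself, a residue: the count in the conclusion
      includes it and \<open>?C\<close> does not, which absorbs the minus sign.\<close>
    also have "{t. 0 < t \<and> t \<le> w \<and> chi t = 1} = insert w ?C" using w chiw by auto
    also have "card \<dots> = Suc (card ?C)"
      by (rule card_insert_disjoint) (auto intro: finite_subset[of _ "{0..w}"])
    finally show ?thesis using inv by (simp add: power_add)
  qed
qed

end

section \<open>Counting ideals of given norm\<close>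

lemma prime_power_induct_mult:
  fixes f g :: "nat \<Rightarrow> int"
  assumes f: "\<And>a b. coprime a b \<Longrightarrow> a > 0 \<Longrightarrow> b > 0 \<Longrightarrow> f (a * b) = f a * f b"
    and g: "\<And>a b. coprime a b \<Longrightarrow> a > 0 \<Longrightarrow> b > 0 \<Longrightarrow> g (a * b) = g a * g b"
    and pp: "\<And>l k. prime l \<Longrightarrow> f (l ^ k) = g (l ^ k)"
    and "n > 0"
  shows "f n = g n"
  using \<open>n > 0\<close>
proof (induction n rule: less_induct)
  case (less n)
  show ?case
  proof (cases "n = 1")
    case True
    then show ?thesis using pp[of 2 0] two_is_prime_nat by simp
  next
    case False
    then obtain l where l: "prime l" "l dvd n" using prime_factor_nat by blast
    define k where "k = multiplicity l n"
    obtain y where y: "n = l ^ k * y" "\<not> l dvd y"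
      using multiplicity_decompose'[of n l] l(1) less.prems unfolding k_def
      by (metis bot_nat_0.not_eq_extremum not_prime_unit)
    have "k > 0" using y l by (cases k) auto
    then have "1 < l ^ k" using one_less_power[OF prime_gt_1_nat[OF l(1)]] by blast
    moreover have y0: "y > 0" using y(1) less.prems by (cases y) auto
    ultimately have "y < n" unfolding y(1) by simp
    moreover note y0
    moreover have "coprime (l ^ k) y" using y(2) l(1) by (simp add: prime_imp_coprime)
    moreover have "l ^ k > 0" using l(1) prime_gt_0_nat by simp
    ultimately show ?thesis using f g pp[OF l(1)] less.IH[of y] by (simp add: y(1))
  qed
qed

lemma gcd_coprime_divisors:
  fixes a b d e :: nat
  assumes "coprime a b"
  shows "d dvd a \<Longrightarrow> e dvd b \<Longrightarrow> gcd (d * e) a = d"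
    and "d dvd a \<Longrightarrow> e dvd b \<Longrightarrow> gcd (d * e) b = e"
    and "d dvd a * b \<Longrightarrow> gcd d a * gcd d b = d"
proof -
  have *: "gcd (d * e) a = d" if "coprime a b" "d dvd a" "e dvd b" for a b d e :: nat
    using that by (metis coprime_divisors gcd_mult_left_right_cancel gcd_nat.orderE gcd_nat.order_iff_strict)
  show 1: "d dvd a \<Longrightarrow> e dvd b \<Longrightarrow> gcd (d * e) a = d" for d e using *[OF assms] .
  show 2: "d dvd a \<Longrightarrow> e dvd b \<Longrightarrow> gcd (d * e) b = e" for d e
    using *[of b a e d] assms by (simp add: coprime_commute mult.commute)
  assume "d dvd a * b"
  then obtain d' e' where "d = d' * e'" "d' dvd a" "e' dvd b" using division_decomp by blast
  then show "gcd d a * gcd d b = d" using 1 2 by simp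
qed

lemma sum_divisors_coprime:
  fixes h :: "nat \<Rightarrow> int"
  assumes "coprime a b"
  shows "(\<Sum>d | d dvd a * b. h d) = (\<Sum>d | d dvd a. \<Sum>e | e dvd b. h (d * e))"
proof -
  have "(\<Sum>d | d dvd a * b. h d) = (\<Sum>(d, e) \<in> {d. d dvd a} \<times> {e. e dvd b}. h (d * e))"
    by (rule sum.reindex_bij_witness[of _ "\<lambda>(d, e). d * e" "\<lambda>d. (gcd d a, gcd d b)"])
      (auto simp: gcd_coprime_divisors[OF assms] mult_dvd_mono)
  then show ?thesis by (simp add: sum.cartesian_product)
qed

text \<open>If d^2 divides a b with a and b coprime, then d is the product of its greatest common
  divisors with a and with b, and the squares of these divide a and b respectively.\<close>

lemma sum_square_divisors_coprime:
  fixes h :: "nat \<Rightarrow> int"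
  assumes "coprime a b"
  shows "(\<Sum>d | d\<^sup>2 dvd a * b. h d) = (\<Sum>d | d\<^sup>2 dvd a. \<Sum>e | e\<^sup>2 dvd b. h (d * e))"
proof -
  have le: "d dvd c" if "d\<^sup>2 dvd c" for d c :: nat using that by (meson dvd_trans dvd_power pos2)
  have gcd_sq: "(gcd d a)\<^sup>2 dvd a" if "d\<^sup>2 dvd a * b" "coprime a b" for a b d :: nat
  proof -
    have "(gcd d a)\<^sup>2 dvd a * b" using that(1) by (meson dvd_trans dvd_power_same gcd_dvd1)
    moreover have "coprime ((gcd d a)\<^sup>2) b" using that(2) by (metis coprime_divisors coprime_power_left_iff dvd_refl gcd_dvd2)
    ultimately show ?thesis by (simp add: coprime_dvd_mult_left_iff)
  qed
  have "(\<Sum>d | d\<^sup>2 dvd a * b. h d) = (\<Sum>(d, e) \<in> {d. d\<^sup>2 dvd a} \<times> {e. e\<^sup>2 dvd b}. h (d * e))"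
  proof (rule sum.reindex_bij_witness[of _ "\<lambda>(d, e). d * e" "\<lambda>d. (gcd d a, gcd d b)"])
    fix d assume "d \<in> {d. d\<^sup>2 dvd a * b}"
    then have d: "d\<^sup>2 dvd a * b" by simp
    show "(case (gcd d a, gcd d b) of (d, e) \<Rightarrow> d * e) = d" using gcd_coprime_divisors(3)[OF assms le[OF d]] by simp
    then show "(case (gcd d a, gcd d b) of (d, e) \<Rightarrow> h (d * e)) = h d" by simp
    show "(gcd d a, gcd d b) \<in> {d. d\<^sup>2 dvd a} \<times> {e. e\<^sup>2 dvd b}"
      using gcd_sq[OF d assms] gcd_sq[of d b a] d assms by (simp add: coprime_commute mult.commute)
  next
    fix x assume "x \<in> {d. d\<^sup>2 dvd a} \<times> {e. e\<^sup>2 dvd b}"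
    then obtain d e where x: "x = (d, e)" "d\<^sup>2 dvd a" "e\<^sup>2 dvd b" by auto
    show "(gcd (case x of (d, e) \<Rightarrow> d * e) a, gcd (case x of (d, e) \<Rightarrow> d * e) b) = x"
      using gcd_coprime_divisors(1,2)[OF assms le[OF x(2)] le[OF x(3)]] by (simp add: x(1))
    show "(case x of (d, e) \<Rightarrow> d * e) \<in> {d. d\<^sup>2 dvd a * b}" using x by (simp add: power_mult_distrib mult_dvd_mono)
  qed
  then show ?thesis by (simp add: sum.cartesian_product)
qed

lemma finite_square_divisors: "n > 0 \<Longrightarrow> finite {d::nat. d\<^sup>2 dvd n}"
proof (rule finite_subset[of _ "{d. d dvd n}"])
  show "{d. d\<^sup>2 dvd n} \<subseteq> {d. d dvd n}" by (auto intro: dvd_trans[OF dvd_power[OF disjI1[OF pos2]]])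
qed simp

context prime_3_mod_4
begin

section \<open>Roots of x^2 + x + q and the decomposition of primes\<close>

text \<open>The norm of \<omega>; the polynomial \<open>x\<^sup>2 + x + q\<close> is the norm of x +
  \<omega> and has discriminant -p.\<close>

definition q :: int where "q = (P + 1) div 4"

lemma four_q: "4 * q = P + 1"
  unfolding q_def using p_mod_4 by presburger

text \<open>With \<open>\<omega> = (1 + \<surd>(-p))/2\<close>, the nonzero ideals are the lattices \<open>g (\<int> n + \<int> (x + \<omega>))\<close> where
  \<open>x\<close> is a root of \<open>x\<^sup>2 + x + q\<close> modulo \<open>n\<close>; such an ideal has norm \<open>g\<^sup>2 n\<close>.\<close>

definition roots :: "int \<Rightarrow> int set" where "roots n = {x. 0 \<le> x \<and> x < n \<and> n dvd x\<^sup>2 + x + q}"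
definition ideal_count :: "nat \<Rightarrow> int" where
  "ideal_count n = (\<Sum>g | g\<^sup>2 dvd n. int (card (roots (int (n div g\<^sup>2)))))"
definition chi_sum :: "nat \<Rightarrow> int" where "chi_sum n = (\<Sum>d | d dvd n. chi (int d))"

lemma finite_roots [simp]: "finite (roots n)"
  unfolding roots_def by (rule finite_subset[of _ "{0..n}"]) auto

lemma root_cong: "[x = y] (mod n) \<Longrightarrow> n dvd x\<^sup>2 + x + q \<longleftrightarrow> n dvd y\<^sup>2 + y + q"
  by (rule cong_dvd_iff) (intro cong_add cong_pow cong_refl; simp)

lemma card_roots_mult:
  assumes "coprime a b" "a > 0" "b > 0"
  shows "card (roots (a * b)) = card (roots a) * card (roots b)"
proof -
  have "bij_betw (\<lambda>x. (x mod a, x mod b)) (roots (a * b)) (roots a \<times> roots b)"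
  proof (rule bij_betwI')
    fix x y assume xy: "x \<in> roots (a * b)" "y \<in> roots (a * b)"
    show "(x mod a, x mod b) = (y mod a, y mod b) \<longleftrightarrow> x = y"
    proof
      assume "(x mod a, x mod b) = (y mod a, y mod b)"
      then have "a dvd x - y" "b dvd x - y" by (auto simp: mod_eq_dvd_iff)
      then have "a * b dvd x - y" using assms(1) by (rule divides_mult)
      moreover have "\<bar>x - y\<bar> < a * b" using xy by (auto simp: roots_def)
      ultimately show "x = y" using dvd_imp_le_int[of "x - y" "a * b"] by fastforce
    qed simp
  next
    fix x assume "x \<in> roots (a * b)"
    then have "a dvd x\<^sup>2 + x + q" "b dvd x\<^sup>2 + x + q" by (auto simp: roots_def dest: dvd_mult_left dvd_mult_right)
    then show "(x mod a, x mod b) \<in> roots a \<times> roots b"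
      using assms root_cong[of "x mod a" x a] root_cong[of "x mod b" x b] by (simp add: roots_def)
  next
    fix yz assume "yz \<in> roots a \<times> roots b"
    then obtain y z where yz: "yz = (y, z)" "y \<in> roots a" "z \<in> roots b" by auto
    obtain x where x: "[x = y] (mod a)" "[x = z] (mod b)" using binary_chinese_remainder_int[OF assms(1)] by blast
    define x' where "x' = x mod (a * b)"
    have x': "[x' = y] (mod a)" "[x' = z] (mod b)"
      using x by (simp_all add: x'_def cong_iff_mod_eq mod_mod_cancel)
    have "a dvd x'\<^sup>2 + x' + q" "b dvd x'\<^sup>2 + x' + q"
      using yz x' root_cong by (auto simp: roots_def)
    then have "a * b dvd x'\<^sup>2 + x' + q" using assms(1) by (rule divides_mult)
    then have "x' \<in> roots (a * b)" using assms by (simp add: roots_def x'_def)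
    moreover have "yz = (x' mod a, x' mod b)" using yz x' by (auto simp: roots_def cong_iff_mod_eq)
    ultimately show "\<exists>x\<in>roots (a * b). yz = (x mod a, x mod b)" by blast
  qed
  then show ?thesis by (simp add: bij_betw_same_card card_cartesian_product)
qed

lemma ideal_count_mult:
  assumes "coprime a b" "a > 0" "b > 0"
  shows "ideal_count (a * b) = ideal_count a * ideal_count b"
proof -
  have "ideal_count (a * b) = (\<Sum>d | d\<^sup>2 dvd a. \<Sum>e | e\<^sup>2 dvd b. int (card (roots (int (a * b div (d * e)\<^sup>2)))))"
    unfolding ideal_count_def by (rule sum_square_divisors_coprime[OF assms(1)])
  also have "\<dots> = (\<Sum>d | d\<^sup>2 dvd a. \<Sum>e | e\<^sup>2 dvd b. int (card (roots (int (a div d\<^sup>2)))) * int (card (roots (int (b div e\<^sup>2)))))"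
  proof (intro sum.cong refl)
    fix d e assume de: "d \<in> {d. d\<^sup>2 dvd a}" "e \<in> {e. e\<^sup>2 dvd b}"
    then obtain a' b' where ab: "a = d\<^sup>2 * a'" "b = e\<^sup>2 * b'" by (auto elim!: dvdE)
    have "d \<noteq> 0" "e \<noteq> 0" using ab assms by auto
    then have 1: "a * b div (d * e)\<^sup>2 = a' * b'" "a div d\<^sup>2 = a'" "b div e\<^sup>2 = b'"
      unfolding ab by (simp_all add: power_mult_distrib mult_ac)
    have "coprime a' b'" using assms(1) unfolding ab by simp
    moreover have "a' > 0" "b' > 0" using ab assms by (auto intro: gr0I)
    ultimately show "int (card (roots (int (a * b div (d * e)\<^sup>2)))) = int (card (roots (int (a div d\<^sup>2)))) * int (card (roots (int (b div e\<^sup>2))))"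
      unfolding 1 using card_roots_mult[of "int a'" "int b'"] by simp
  qed
  finally show ?thesis unfolding ideal_count_def by (simp add: sum_product)
qed

lemma chi_sum_mult:
  assumes "coprime a b"
  shows "chi_sum (a * b) = chi_sum a * chi_sum b"
  unfolding chi_sum_def sum_divisors_coprime[OF assms] by (simp add: sum_product chi_mult)

lemma root_disc: "4 * (x\<^sup>2 + x + q) = (2 * x + 1)\<^sup>2 + P"
  using four_q by (simp add: power2_eq_square algebra_simps)

lemma roots_1: "roots 1 = {0}"
  by (auto simp: roots_def)

lemma card_roots_p: "card (roots P) = 1"
proof -
  have "P dvd x\<^sup>2 + x + q \<longleftrightarrow> P dvd 2 * x + 1" for x
  proof -
    have "P dvd x\<^sup>2 + x + q \<longleftrightarrow> P dvd 2 * 2 * (x\<^sup>2 + x + q)"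
      using not_P_dvd_2 by (simp only: prime_dvd_mult_iff[OF prime_P]) auto
    also have "\<dots> \<longleftrightarrow> P dvd (2 * x + 1)\<^sup>2" using root_disc[of x] by simp
    also have "\<dots> \<longleftrightarrow> P dvd 2 * x + 1" using prime_P by (simp add: prime_dvd_power_iff)
    finally show ?thesis .
  qed
  then have "roots P = {x. 0 \<le> x \<and> x < P \<and> P dvd 2 * x + 1}" by (simp add: roots_def)
  also have "\<dots> = {int m}"
  proof (intro Set.equalityI subsetI)
    fix x assume "x \<in> {x. 0 \<le> x \<and> x < P \<and> P dvd 2 * x + 1}"
    then have x: "0 \<le> x" "x < P" "P dvd 2 * x + 1" by auto
    then obtain k where k: "2 * x + 1 = P * k" by (auto elim: dvdE)
    have "0 < P * k" "P * k < P * 2" using x k by linarith+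
    then have "0 < k" "k < 2" by (simp_all add: zero_less_mult_iff mult_less_cancel_left)
    then have "k = 1" by simp
    then show "x \<in> {int m}" using k p_eq(2) by simp
  next
    fix x assume "x \<in> {int m}"
    then show "x \<in> {x. 0 \<le> x \<and> x < P \<and> P dvd 2 * x + 1}" using p_eq(2) by simp
  qed
  finally show ?thesis by simp
qed

text \<open>The prime p ramifies: the root modulo p is double. If it lifted to p^2, then p would
  divide 2x + 1, and p^2 would divide (2x + 1)^2 + p, hence p.\<close>

lemma roots_p_power: "k \<ge> 2 \<Longrightarrow> roots (P ^ k) = {}"
proof (rule ccontr)
  assume k: "k \<ge> 2" and "roots (P ^ k) \<noteq> {}"
  then obtain x where "P ^ k dvd x\<^sup>2 + x + q" by (auto simp: roots_def)
  moreover have "P\<^sup>2 dvd P ^ k" using k by (rule le_imp_power_dvd)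
  ultimately have 1: "P\<^sup>2 dvd (2 * x + 1)\<^sup>2 + P" using root_disc[of x] by (metis dvd_mult dvd_trans)
  then have "P dvd (2 * x + 1)\<^sup>2 + P" by (meson dvd_trans dvd_power pos2)
  then have "P dvd 2 * x + 1" using prime_P by (simp add: prime_dvd_power_iff)
  then have "P\<^sup>2 dvd (2 * x + 1)\<^sup>2" by (rule dvd_power_same)
  with 1 have "P\<^sup>2 dvd P" by (simp add: dvd_add_right_iff)
  then have "P * P \<le> P" using p_gt_2 by (auto dest!: zdvd_imp_le simp: power2_eq_square)
  then show False using p_gt_2 by simp
qed

text \<open>Since m is odd, the reciprocity sign for p and l is (-1)^((l - 1)/2), the same that
  Euler's criterion gives for -1 modulo l.\<close>

lemma Legendre_minus_p:
  assumes "prime l" "l > 2" "l \<noteq> p"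
  shows "Legendre (- P) (int l) = chi (int l)"
proof -
  let ?k = "(l - 1) div 2"
  have odd_l: "odd l" using assms prime_odd_nat by auto
  have np: "\<not> int l dvd P" using assms primes_dvd_imp_eq[of l p] prime_p by auto
  have val: "Legendre a (int l) \<in> {-1, 0, 1}" for a by (simp add: Legendre_def)
  have uniq: "x = y" if "[x = y] (mod int l)" "x \<in> {-1,0,1}" "y \<in> {-1,0,1}" for x y
  proof -
    have "int l dvd x - y" using that(1) by (simp add: cong_iff_dvd_diff)
    moreover have "\<bar>x - y\<bar> < int l" using that(2,3) assms(2) by auto
    ultimately show ?thesis using dvd_imp_le_int[of "x - y" "int l"] by fastforce
  qed
  have "[Legendre (- P) (int l) = (- P) ^ ?k] (mod int l)" using euler_criterion[OF assms(1,2)] by simp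
  also have "(- P) ^ ?k = (-1) ^ ?k * P ^ ?k" by (rule power_minus)
  also have "[(-1) ^ ?k * P ^ ?k = (-1) ^ ?k * Legendre P (int l)] (mod int l)"
    using euler_criterion[OF assms(1,2), of P] by (intro cong_mult cong_refl) (rule cong_sym, simp)
  finally have "[Legendre (- P) (int l) = (-1) ^ ?k * Legendre P (int l)] (mod int l)" .
  then have "Legendre (- P) (int l) = (-1) ^ ?k * Legendre P (int l)"
    by (rule uniq) (use val minus_one_power_iff[of ?k, where ?'a = int] in auto)
  moreover have "Legendre P (int l) * Legendre (int l) P = (-1) ^ (m * ?k)"
    unfolding m_def using Quadratic_Reciprocity[OF prime_p p_gt_2 assms(1,2)] assms(3) by simp
  moreover have "(-1 :: int) ^ (m * ?k) = (-1) ^ ?k" using odd_m by (simp add: minus_one_power_iff)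
  moreover have "chi (int l) = 1 \<or> chi (int l) = -1"
  proof -
    have "\<not> P dvd int l" using assms primes_dvd_imp_eq[of p l] prime_p by auto
    then show ?thesis using chi_values chi_eq_0_iff by blast
  qed
  ultimately show ?thesis by (auto simp: chi_def minus_one_power_iff split: if_splits)
qed

lemma root_mod_prime_iff:
  assumes l: "prime l" "l \<noteq> p"
  shows "(\<exists>x. int l dvd x\<^sup>2 + x + q) \<longleftrightarrow> chi (int l) = 1"
proof (cases "l = 2")
  case True
  \<comment> \<open>Completing the square fails at 2. But x^2 + x is always even, so the parity of q
    decides, hence p modulo 8.\<close>
  have "even (x\<^sup>2 + x + q) \<longleftrightarrow> even q" for x by auto
  moreover have "even q \<longleftrightarrow> chi 2 = 1"
    using chi_2_cases four_q by presburger
  ultimately show ?thesis using True by simp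
next
  case False
  then have l2: "l > 2" using prime_gt_1_nat[OF l(1)] by simp
  then have odd_l: "odd (int l)" using l(1) prime_odd_nat by auto
  have pl: "prime (int l)" using l(1) by simp
  have n4: "\<not> int l dvd 2" using l2 zdvd_not_zless[of 2 "int l"] by simp
  have disc: "int l dvd x\<^sup>2 + x + q \<longleftrightarrow> int l dvd (2 * x + 1)\<^sup>2 + P" for x
  proof -
    have "int l dvd x\<^sup>2 + x + q \<longleftrightarrow> int l dvd 2 * 2 * (x\<^sup>2 + x + q)"
      using n4 by (simp only: prime_dvd_mult_iff[OF pl]) auto
    then show ?thesis using root_disc[of x] by simp
  qed
  have "(\<exists>x. int l dvd x\<^sup>2 + x + q) \<longleftrightarrow> (\<exists>y. int l dvd y\<^sup>2 + P)"
  proof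
    assume "\<exists>y. int l dvd y\<^sup>2 + P"
    then obtain y where y: "int l dvd y\<^sup>2 + P" by blast
    \<comment> \<open>As l is odd, one of y and y + l is odd and thus of the form 2x + 1.\<close>
    define z where "z = (if odd y then y else y + int l)"
    have "odd z" using odd_l by (simp add: z_def)
    then obtain x where x: "z = 2 * x + 1" by (elim oddE)
    have "[z\<^sup>2 + P = y\<^sup>2 + P] (mod int l)"
      by (intro cong_add cong_pow cong_refl) (simp add: z_def cong_iff_mod_eq)
    then have "int l dvd z\<^sup>2 + P" using y cong_dvd_iff by blast
    then show "\<exists>x. int l dvd x\<^sup>2 + x + q" using disc x by blast
  qed (use disc in blast)
  also have "\<dots> \<longleftrightarrow> QuadRes (int l) (- P)" by (simp add: QuadRes_def cong_iff_dvd_diff)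
  also have "\<dots> \<longleftrightarrow> Legendre (- P) (int l) = 1"
  proof -
    have "\<not> int l dvd P" using l primes_dvd_imp_eq[of l p] prime_p by auto
    then show ?thesis by (simp add: Legendre_def cong_0_iff)
  qed
  finally show ?thesis using Legendre_minus_p[OF l(1) l2 l(2)] by simp
qed

lemma root_derivative_unit:
  assumes l: "prime l" "l \<noteq> p" and "int l dvd x\<^sup>2 + x + q"
  shows "\<not> int l dvd 2 * x + 1"
proof
  assume a: "int l dvd 2 * x + 1"
  have "int l dvd (2 * x + 1)\<^sup>2 + P" using assms(3) root_disc[of x] by (metis dvd_mult)
  moreover have "int l dvd (2 * x + 1)\<^sup>2" using a by (simp add: power2_eq_square)
  ultimately have "int l dvd P" by (simp add: dvd_add_right_iff)
  then show False using l primes_dvd_imp_eq[of l p] prime_p by auto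
qed

text \<open>Hensel's lemma; the derivative 2y + 1 at a root is prime to l.\<close>

lemma root_lift:
  assumes l: "prime l" "l \<noteq> p" and "int l dvd x\<^sup>2 + x + q"
  shows "\<exists>y. int l ^ Suc k dvd y\<^sup>2 + y + q"
proof (induction k)
  case 0
  then show ?case using assms(3) by auto
next
  case (Suc k)
  let ?L = "int l ^ Suc k"
  obtain y c where y: "y\<^sup>2 + y + q = ?L * c" using Suc by (auto elim!: dvdE)
  then have "int l dvd y\<^sup>2 + y + q" by simp
  then have "coprime (2 * y + 1) (int l)"
    using root_derivative_unit[OF l] l(1) by (meson coprime_commute prime_imp_coprime prime_nat_int_transfer)
  then obtain u where "[(2 * y + 1) * u = 1] (mod int l)" using cong_solve_coprime_int by blast
  then have u: "int l dvd (2 * y + 1) * u - 1" by (simp add: cong_iff_dvd_diff)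
  \<comment> \<open>The Newton correction: it solves c + t (2y + 1) \<equiv> 0 modulo l.\<close>
  define t where "t = - c * u"
  have "(y + t * ?L)\<^sup>2 + (y + t * ?L) + q = ?L * (c + t * (2 * y + 1) + t\<^sup>2 * ?L)"
    using y by (simp add: power2_eq_square algebra_simps)
  moreover have "c + t * (2 * y + 1) = - c * ((2 * y + 1) * u - 1)" by (simp add: t_def algebra_simps)
  then have "int l dvd c + t * (2 * y + 1)" using u by (metis dvd_mult)
  then have "int l dvd c + t * (2 * y + 1) + t\<^sup>2 * ?L" by simp
  then have "int l * ?L dvd ?L * (c + t * (2 * y + 1) + t\<^sup>2 * ?L)"
    by (subst mult.commute) (intro mult_dvd_mono dvd_refl)
  ultimately show ?case by (metis power_Suc)
qed

text \<open>One formula covers the three kinds of primes: two roots if l splits, none if l is inert,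
  and for l = p one root at k = 1 and none beyond, where the convention 0^0 = 1 makes the
  distinction.\<close>

lemma card_roots_prime_power:
  assumes l: "prime l" and k: "k > 0"
  shows "int (card (roots (int l ^ k))) = chi (int l) ^ (k - 1) * (1 + chi (int l))"
proof (cases "l = p")
  case True
  have "chi (int l) = 0" by (simp add: True chi_eq_0_iff)
  moreover have "k = 1 \<or> k \<ge> 2" using k by linarith
  ultimately show ?thesis using True card_roots_p roots_p_power[of k] by auto
next
  case False
  let ?L = "int l ^ k"
  have l0: "int l > 0" using prime_gt_0_nat[OF l] by simp
  have L0: "?L > 0" using l0 by simp
  have lL: "int l dvd ?L" using k by simp
  have ndvd: "\<not> P dvd int l" using False l primes_dvd_imp_eq[of p l] prime_p by auto
  then have cases: "chi (int l) = 1 \<or> chi (int l) = -1" using chi_values chi_eq_0_iff by blast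
  show ?thesis
  proof (cases "chi (int l) = 1")
    case True
    then obtain x where "int l dvd x\<^sup>2 + x + q" using root_mod_prime_iff[OF l False] by blast
    then obtain y where y: "?L dvd y\<^sup>2 + y + q" using root_lift[OF l False, of x "k - 1"] k by auto
    have ly: "\<not> int l dvd 2 * y + 1" by (rule root_derivative_unit[OF l False]) (use y lL in \<open>blast intro: dvd_trans\<close>)
    \<comment> \<open>The two roots of x^2 + x + q add up to -1.\<close>
    define y1 y2 where "y1 = y mod ?L" and "y2 = (- 1 - y) mod ?L"
    have neq: "y1 \<noteq> y2"
    proof
      assume "y1 = y2"
      then have "?L dvd y - (- 1 - y)" by (simp only: y1_def y2_def mod_eq_dvd_iff)
      then have "int l dvd y - (- 1 - y)" using lL by (rule dvd_trans[rotated])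
      then show False using ly by (simp add: algebra_simps)
    qed
    have "roots ?L = {y1, y2}"
    proof (intro Set.equalityI subsetI)
      fix x assume x: "x \<in> roots ?L"
      then have "?L dvd (x\<^sup>2 + x + q) - (y\<^sup>2 + y + q)" using y by (intro dvd_diff) (auto simp: roots_def)
      also have "(x\<^sup>2 + x + q) - (y\<^sup>2 + y + q) = (x - y) * (x - (- 1 - y))" by (simp add: power2_eq_square algebra_simps)
      finally have d: "?L dvd (x - y) * (x - (- 1 - y))" .
      have pe: "prime_elem (int l)" using l by simp
      have "?L dvd x - y \<or> ?L dvd x - (- 1 - y)"
      proof (cases "int l dvd x - y")
        case True
        have "\<not> int l dvd x - (- 1 - y)"
        proof
          assume "int l dvd x - (- 1 - y)"
          then have "int l dvd (x - (- 1 - y)) - (x - y)" using True by (rule dvd_diff)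
          then show False using ly by (simp add: algebra_simps)
        qed
        then show ?thesis using prime_power_dvd_multD[OF pe _ k, of "x - (- 1 - y)" "x - y"] d by (simp add: mult.commute)
      next
        case False
        then show ?thesis using prime_power_dvd_multD[OF pe d k] by blast
      qed
      moreover have "x mod ?L = x" using x by (simp add: roots_def)
      ultimately show "x \<in> {y1, y2}" unfolding y1_def y2_def by (metis insertCI mod_eq_dvd_iff)
    next
      fix x assume "x \<in> {y1, y2}"
      moreover have "?L dvd (- 1 - y)\<^sup>2 + (- 1 - y) + q"
        using y by (simp add: power2_eq_square algebra_simps)
      ultimately have "?L dvd x\<^sup>2 + x + q"
        using y root_cong[of y1 y ?L] root_cong[of y2 "- 1 - y" ?L] by (auto simp: y1_def y2_def)
      moreover have "0 \<le> x \<and> x < ?L" using \<open>x \<in> {y1, y2}\<close> L0 by (auto simp: y1_def y2_def)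
      ultimately show "x \<in> roots ?L" by (simp add: roots_def)
    qed
    then show ?thesis using neq True by simp
  next
    case nr: False
    have "roots ?L = {}"
    proof (rule ccontr)
      assume "roots ?L \<noteq> {}"
      then obtain x where "?L dvd x\<^sup>2 + x + q" by (auto simp: roots_def)
      then have "int l dvd x\<^sup>2 + x + q" using lL dvd_trans by blast
      then show False using root_mod_prime_iff[OF l False] nr by blast
    qed
    then show ?thesis using nr cases by simp
  qed
qed

text \<open>Either l does not divide g, and then g = 1, or g = l h where h^2 divides l^k.\<close>

lemma ideal_count_prime_power_Suc:
  assumes l: "prime l"
  shows "ideal_count (l ^ (k + 2)) = int (card (roots (int l ^ (k + 2)))) + ideal_count (l ^ k)"
proof -
  have l0: "l > 0" using prime_gt_0_nat[OF l] .
  have l1: "l \<noteq> 1" using l by auto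
  have eq: "{g. g\<^sup>2 dvd l ^ (k + 2)} = insert 1 ((\<lambda>g. l * g) ` {g. g\<^sup>2 dvd l ^ k})" (is "?A = insert 1 ?B")
  proof (intro Set.equalityI subsetI)
    fix g assume g: "g \<in> ?A"
    show "g \<in> insert 1 ?B"
    proof (cases "l dvd g")
      case True
      then obtain h where h: "g = l * h" by blast
      have "l\<^sup>2 * h\<^sup>2 dvd l\<^sup>2 * l ^ k" using g by (simp add: h power_mult_distrib power_add mult.commute power2_eq_square)
      then have "h\<^sup>2 dvd l ^ k" using l0 by simp
      then show ?thesis using h by blast
    next
      case False
      have "g dvd l ^ (k + 2)" using g by (auto intro: dvd_trans[OF dvd_power[OF disjI1[OF pos2]]])
      then obtain i where i: "g = l ^ i" using divides_primepow_nat[OF l] by blast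
      then have "i = 0" using False by (cases i) auto
      then show ?thesis using i by simp
    qed
  next
    fix g assume "g \<in> insert 1 ?B"
    then show "g \<in> ?A"
    proof
      assume "g \<in> ?B"
      then obtain h where h: "g = l * h" "h\<^sup>2 dvd l ^ k" by blast
      then have "l\<^sup>2 * h\<^sup>2 dvd l\<^sup>2 * l ^ k" by (intro mult_dvd_mono dvd_refl)
      then show ?thesis by (simp only: h(1) power_mult_distrib power_add mult.commute mem_Collect_eq)
    qed simp
  qed
  have fin: "finite {g. g\<^sup>2 dvd l ^ k}" using l0 by (intro finite_square_divisors) simp
  have nin: "1 \<notin> ?B"
  proof
    assume "1 \<in> ?B"
    then obtain g where "1 = l * g" by blast
    then have "l dvd 1" by (rule dvdI)
    then show False using l1 by simp
  qed
  have "ideal_count (l ^ (k + 2)) = int (card (roots (int (l ^ (k + 2) div 1\<^sup>2))))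
      + (\<Sum>g\<in>?B. int (card (roots (int (l ^ (k + 2) div g\<^sup>2)))))"
    unfolding ideal_count_def eq by (rule sum.insert[OF finite_imageI[OF fin] nin])
  also have "(\<Sum>g\<in>?B. int (card (roots (int (l ^ (k + 2) div g\<^sup>2)))))
      = (\<Sum>g | g\<^sup>2 dvd l ^ k. int (card (roots (int (l ^ (k + 2) div (l * g)\<^sup>2)))))"
    using l0 by (subst sum.reindex) (auto simp: inj_on_def)
  also have "\<dots> = ideal_count (l ^ k)"
    unfolding ideal_count_def
  proof (intro sum.cong refl)
    fix g
    have "l ^ (k + 2) div (l * g)\<^sup>2 = (l\<^sup>2 * l ^ k) div (l\<^sup>2 * g\<^sup>2)" by (simp only: power_mult_distrib power_add mult.commute)
    also have "\<dots> = l ^ k div g\<^sup>2" using l0 by simp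
    finally show "int (card (roots (int (l ^ (k + 2) div (l * g)\<^sup>2)))) = int (card (roots (int (l ^ k div g\<^sup>2))))" by simp
  qed
  finally show ?thesis by simp
qed

lemma chi_sum_prime_power:
  assumes "prime l" shows "chi_sum (l ^ k) = (\<Sum>i\<le>k. chi (int l) ^ i)"
proof -
  have "{d. d dvd l ^ k} = (\<lambda>i. l ^ i) ` {..k}" using divides_primepow_nat[OF assms] by auto
  moreover have "inj_on (\<lambda>i. l ^ i) {..k}" using prime_gt_1_nat[OF assms] by (auto simp: inj_on_def)
  ultimately show ?thesis by (simp add: chi_sum_def sum.reindex chi_power)
qed

lemma ideal_count_prime_power:
  assumes l: "prime l" shows "ideal_count (l ^ k) = chi_sum (l ^ k)"
proof (induction k rule: less_induct)
  case (less k)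
  have c1: "ideal_count 1 = 1" by (simp add: ideal_count_def roots_1)
  consider "k = 0" | "k = 1" | j where "k = j + 2" by (metis add_2_eq_Suc' not0_implies_Suc One_nat_def)
  then show ?case
  proof cases
    case 1
    then show ?thesis using c1 chi_sum_prime_power[OF l, of 0] by simp
  next
    case 2
    have "{g. g\<^sup>2 dvd l} = {1}"
    proof (intro Set.equalityI subsetI)
      fix g assume "g \<in> {g. g\<^sup>2 dvd l}"
      then have g: "g\<^sup>2 dvd l" by simp
      then have "g\<^sup>2 = 1 \<or> g\<^sup>2 = l" using l prime_nat_iff by blast
      moreover have "g\<^sup>2 \<noteq> l" using l by (metis prime_power_iff One_nat_def Suc_1 nat.inject n_not_Suc_n)
      ultimately show "g \<in> {1}" by simp
    qed auto
    then have "ideal_count l = int (card (roots (int l ^ 1)))" by (simp add: ideal_count_def)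
    then show ?thesis using 2 card_roots_prime_power[OF l, of 1] chi_sum_prime_power[OF l, of 1] by simp
  next
    case 3
    have "chi (int l) ^ (j + 1) * (1 + chi (int l)) = chi (int l) ^ (j + 1) + chi (int l) ^ (j + 2)"
      by (simp add: algebra_simps)
    then show ?thesis unfolding 3
      using ideal_count_prime_power_Suc[OF l, of j] less.IH[of j] card_roots_prime_power[OF l, of "j + 2"]
        chi_sum_prime_power[OF l, of "j + 2"] chi_sum_prime_power[OF l, of j] 3
      by simp
  qed
qed

text \<open>Coefficient by coefficient, this is the factorisation of the Dedekind zeta function of
  the field into the Riemann zeta function and the L-series of \<open>chi\<close>.\<close>

theorem ideal_count_eq_chi_sum: "n > 0 \<Longrightarrow> ideal_count n = chi_sum n"
  by (rule prime_power_induct_mult[of ideal_count chi_sum])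
    (auto intro: ideal_count_mult chi_sum_mult ideal_count_prime_power)

end

section \<open>Asymptotics of exponential sums\<close>

lemma has_sum_Suc_reindex:
  fixes f :: "nat \<Rightarrow> real"
  shows "(f has_sum S) {1..} \<longleftrightarrow> ((\<lambda>n. f (Suc n)) has_sum S) UNIV"
  by (rule has_sum_reindex_bij_witness[of _ Suc "\<lambda>n. n - 1"]) auto

text \<open>By the mean value theorem each increment of F over a step t lies between t times the
  values of g at the two ends. The increments add up to L - F(\<delta>), and lower and upper sums
  differ by the single term t g(\<delta>).\<close>

lemma riemann_sum_antitone:
  fixes g F :: "real \<Rightarrow> real"
  assumes t: "t > 0" and d: "\<delta> \<ge> 0"
    and deriv: "\<And>u. u \<ge> 0 \<Longrightarrow> (F has_real_derivative g u) (at u)"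
    and anti: "\<And>x y. 0 \<le> x \<Longrightarrow> x \<le> y \<Longrightarrow> g y \<le> g x"
    and nonneg: "\<And>x. 0 \<le> x \<Longrightarrow> 0 \<le> g x"
    and lim: "(F \<longlongrightarrow> L) at_top"
  shows "\<exists>S. ((\<lambda>m::nat. g (t * real m + \<delta>)) has_sum S) {1..} \<and>
           L - F \<delta> - t * g \<delta> \<le> t * S \<and> t * S \<le> L - F \<delta>"
proof -
  define x where "x = (\<lambda>m::nat. t * real m + \<delta>)"
  have x0: "x m \<ge> 0" for m using t d by (simp add: x_def)
  have step: "t * g (x (Suc m)) \<le> F (x (Suc m)) - F (x m) \<and> F (x (Suc m)) - F (x m) \<le> t * g (x m)" for m
  proof -
    have lt: "x m < x (Suc m)" using t by (simp add: x_def algebra_simps)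
    have "\<exists>z>x m. z < x (Suc m) \<and> F (x (Suc m)) - F (x m) = (x (Suc m) - x m) * g z"
      by (rule MVT2[OF lt]) (use deriv x0 in \<open>meson order_trans\<close>)
    then obtain z where z: "x m < z" "z < x (Suc m)" "F (x (Suc m)) - F (x m) = (x (Suc m) - x m) * g z" by blast
    have "x (Suc m) - x m = t" by (simp add: x_def algebra_simps)
    moreover have "g (x (Suc m)) \<le> g z" "g z \<le> g (x m)"
      using z x0[of m] by (auto intro!: anti)
    ultimately show ?thesis using z(3) t by (simp add: mult_left_mono)
  qed
  have "filterlim x at_top sequentially"
    unfolding x_def
    by (rule filterlim_at_top_mono[OF filterlim_tendsto_pos_mult_at_top[OF tendsto_const t filterlim_real_sequentially]])
      (use d in simp)
  then have "(\<lambda>m. F (x m)) \<longlonglongrightarrow> L" by (rule filterlim_compose[OF lim])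
  then have tele: "(\<lambda>m. F (x (Suc m)) - F (x m)) sums (L - F (x 0))" by (rule telescope_sums)
  have sum1: "summable (\<lambda>m. t * g (x (Suc m)))"
    by (rule summable_comparison_test'[OF sums_summable[OF tele], of 0])
      (use step nonneg[OF x0] t in \<open>auto simp: abs_mult\<close>)
  then have sum2: "summable (\<lambda>m. g (x (Suc m)))" using t by (simp add: summable_cmult_iff)
  define S where "S = (\<Sum>m. g (x (Suc m)))"
  have S: "(\<lambda>m. g (x (Suc m))) sums S" unfolding S_def using sum2 by (rule summable_sums)
  then have tS: "(\<lambda>m. t * g (x (Suc m))) sums (t * S)" by (rule sums_mult)
  have "((\<lambda>m. g (x (Suc m))) has_sum S) UNIV"
    by (rule sums_nonneg_imp_has_sum[OF S]) (use nonneg[OF x0] in simp)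
  then have "((\<lambda>m. g (x m)) has_sum S) {1..}" by (subst has_sum_Suc_reindex)
  moreover have "t * S \<le> L - F (x 0)" using step by (intro sums_le[OF _ tS tele]) auto
  moreover have "L - F (x 0) \<le> t * S + t * g (x 0)"
  proof (rule sums_le[OF _ tele])
    show "(\<lambda>m. t * g (x m)) sums (t * S + t * g (x 0))"
      using tS by (subst sums_Suc_iff[symmetric]) simp
  qed (use step in auto)
  ultimately show ?thesis by (intro exI[of _ S]) (simp add: x_def)
qed

section \<open>Gaussian sums over a binary quadratic form\<close>

text \<open>The integral starts at -1 so that 0 is an interior point and the two-sided derivative
  exists there; the extra piece is \<open>gauss_int 0\<close> and cancels in differences.\<close>

definition gauss_int :: "real \<Rightarrow> real" where
  "gauss_int u = integral {-1..u} (\<lambda>x. exp (- x\<^sup>2))"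

lemma gauss_int_deriv:
  assumes "u \<ge> 0" shows "(gauss_int has_real_derivative exp (- u\<^sup>2)) (at u)"
proof -
  have "(gauss_int has_real_derivative exp (- u\<^sup>2)) (at u within {-1..u+1})"
    unfolding gauss_int_def[abs_def]
    by (rule integral_has_real_derivative) (use assms in \<open>auto intro!: continuous_intros\<close>)
  moreover have "at u within {-1..u+1} = at u"
    by (rule at_within_interior) (use assms in auto)
  ultimately show ?thesis by simp
qed

lemma gauss_int_lim: "(gauss_int \<longlongrightarrow> gauss_int 0 + sqrt pi / 2) at_top"
proof -
  let ?f = "\<lambda>x::real. indicator {0..} x *\<^sub>R exp (- x\<^sup>2)"
  have int: "integrable lborel ?f" and val: "integral\<^sup>L lborel ?f = sqrt pi / 2"
    using gaussian_moment_0 by (auto simp: has_bochner_integral_iff)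
  have "((\<lambda>y. \<integral> x. indicator {..y} x *\<^sub>R ?f x \<partial>lborel) \<longlongrightarrow> sqrt pi / 2) at_top"
    unfolding val[symmetric] by (rule tendsto_integral_at_top) (use int in auto)
  moreover have "(\<integral> x. indicator {..y} x *\<^sub>R ?f x \<partial>lborel) = gauss_int y - gauss_int 0" if "y \<ge> 0" for y
  proof -
    have "(\<integral> x. indicator {..y} x *\<^sub>R ?f x \<partial>lborel) = (\<integral> x. exp (- x\<^sup>2) * indicator {0..y} x \<partial>lborel)"
      by (rule Bochner_Integration.integral_cong) (auto simp: indicator_def)
    also have "\<dots> = gauss_int y - gauss_int 0"
      by (rule integral_FTC_Icc_real)
        (use that in \<open>auto intro!: gauss_int_deriv\<close>)
    finally show ?thesis .
  qed
  then have "eventually (\<lambda>y. (\<integral> x. indicator {..y} x *\<^sub>R ?f x \<partial>lborel) = gauss_int y - gauss_int 0) at_top"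
    by (intro eventually_at_top_linorderI[of 0])
  ultimately have "((\<lambda>y. gauss_int y - gauss_int 0) \<longlongrightarrow> sqrt pi / 2) at_top"
    by (rule Lim_transform_eventually)
  from tendsto_add[OF this tendsto_const[of "gauss_int 0"]] show ?thesis by (simp add: add.commute)
qed

lemma gauss_int_diff: "0 \<le> u \<Longrightarrow> gauss_int 0 \<le> gauss_int u \<and> gauss_int u - gauss_int 0 \<le> u"
proof (cases "u = 0")
  assume u: "0 \<le> u" "\<not> u = 0"
  then have "\<exists>z>0. z < u \<and> gauss_int u - gauss_int 0 = (u - 0) * exp (- z\<^sup>2)"
    by (intro MVT2) (auto intro: gauss_int_deriv)
  then obtain z where "gauss_int u - gauss_int 0 = u * exp (- z\<^sup>2)" by auto
  moreover have "u * exp (- z\<^sup>2) \<le> u * 1" "0 \<le> u * exp (- z\<^sup>2)" using u by (auto intro!: mult_left_mono)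
  ultimately show ?thesis by linarith
qed auto

text \<open>The error 2s has two sources: the first term of the Riemann sum, at most s, and the
  missing integral from 0 to s \<delta>, also at most s.\<close>

lemma theta_half:
  assumes "s > 0" "\<delta> \<ge> 0" "\<delta> \<le> 1"
  shows "\<exists>S. ((\<lambda>m::nat. exp (- (s * (real m + \<delta>))\<^sup>2)) has_sum S) {1..} \<and>
    sqrt pi / 2 - 2 * s \<le> s * S \<and> s * S \<le> sqrt pi / 2"
proof -
  from riemann_sum_antitone[of s "s * \<delta>" gauss_int "\<lambda>u. exp (- u\<^sup>2)" "gauss_int 0 + sqrt pi / 2"]
  obtain S where S: "((\<lambda>m::nat. exp (- (s * real m + s * \<delta>)\<^sup>2)) has_sum S) {1..}"
    and b: "gauss_int 0 + sqrt pi / 2 - gauss_int (s * \<delta>) - s * exp (- (s * \<delta>)\<^sup>2) \<le> s * S"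
    "s * S \<le> gauss_int 0 + sqrt pi / 2 - gauss_int (s * \<delta>)"
    using assms gauss_int_deriv gauss_int_lim by (auto simp: power_mono)
  have "s * exp (- (s * \<delta>)\<^sup>2) \<le> s * 1" using assms by (intro mult_left_mono) auto
  moreover have "s * \<delta> \<le> s" using assms by (simp add: mult_left_le)
  moreover have "gauss_int 0 \<le> gauss_int (s * \<delta>)" "gauss_int (s * \<delta>) - gauss_int 0 \<le> s * \<delta>"
    using gauss_int_diff[of "s * \<delta>"] assms by simp_all
  ultimately have "sqrt pi / 2 - 2 * s \<le> s * S" "s * S \<le> sqrt pi / 2" using b assms(1,2) by linarith+
  then show ?thesis using S by (auto simp: distrib_left)
qed

text \<open>The bound is uniform in \<delta>, which in a binary form varies with the outer variable.
  Once \<delta> is reduced to its fractional part, the terms k \<ge> 1 and k \<le> -2 form two half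
  sums with error 2s each, and the terms k = -1 and k = 0 add between 0 and 2s, so 4s suffices in
  both directions.\<close>

lemma theta_sum:
  fixes \<delta> s :: real
  assumes "s > 0"
  shows "\<exists>S. ((\<lambda>k::int. exp (- (s * (of_int k + \<delta>))\<^sup>2)) has_sum S) UNIV \<and> \<bar>s * S - sqrt pi\<bar> \<le> 4 * s"
proof -
  define e where "e = frac \<delta>"
  have e: "0 \<le> e" "e < 1" by (auto simp: e_def frac_lt_1)
  let ?h = "\<lambda>k::int. exp (- (s * (of_int k + e))\<^sup>2)"
  obtain S1 where S1: "((\<lambda>m::nat. exp (- (s * (real m + e))\<^sup>2)) has_sum S1) {1..}"
    "sqrt pi / 2 - 2 * s \<le> s * S1" "s * S1 \<le> sqrt pi / 2"
    using theta_half[of s e] assms e by auto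
  obtain S2 where S2: "((\<lambda>m::nat. exp (- (s * (real m + (1 - e)))\<^sup>2)) has_sum S2) {1..}"
    "sqrt pi / 2 - 2 * s \<le> s * S2" "s * S2 \<le> sqrt pi / 2"
    using theta_half[of s "1 - e"] assms e by auto
  have "(?h has_sum S1) {1..}"
    using S1(1) by (subst has_sum_reindex_bij_witness[of _ int nat "{1..}" "\<lambda>m. exp (- (s * (real m + e))\<^sup>2)"]) auto
  moreover have "(?h has_sum S2) {..-2}"
  proof (subst has_sum_reindex_bij_witness[of _ "\<lambda>m. - int m - 1" "\<lambda>k. nat (- k - 1)" "{1..}" "\<lambda>m. exp (- (s * (real m + (1 - e)))\<^sup>2)"])
    fix k :: int assume "k \<in> {..-2}"
    then have "real (nat (- k - 1)) + (1 - e) = - (of_int k + e)" by simp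
    then show "exp (- (s * (real (nat (- k - 1)) + (1 - e)))\<^sup>2) = ?h k" by (simp only: mult_minus_right power2_minus)
  qed (use S2(1) in auto)
  ultimately have "(?h has_sum (S1 + S2)) ({1..} \<union> {..-2})" by (rule has_sum_Un_disjoint) auto
  then have "(?h has_sum ((S1 + S2) + (\<Sum>k\<in>{-1,0}. ?h k))) (({1..} \<union> {..-2}) \<union> {-1,0})"
    by (rule has_sum_Un_disjoint) (auto intro: has_sum_finiteI)
  moreover have "({1..} \<union> {..-2}) \<union> {-1,0} = (UNIV :: int set)" by auto
  ultimately have h: "(?h has_sum ((S1 + S2) + (\<Sum>k\<in>{-1,0}. ?h k))) UNIV" by simp
  define S where "S = (S1 + S2) + (\<Sum>k\<in>{-1,0}. ?h k)"
  have "0 \<le> (\<Sum>k\<in>{-1,0}. ?h k)" "(\<Sum>k\<in>{-1,0}. ?h k) \<le> 2"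
    using add_mono[of "?h (-1)" 1 "?h 0" 1] by auto
  then have "0 \<le> s * (\<Sum>k\<in>{-1,0}. ?h k)" "s * (\<Sum>k\<in>{-1,0}. ?h k) \<le> s * 2"
    using assms by (auto intro!: mult_left_mono simp del: sum.insert)
  then have "\<bar>s * S - sqrt pi\<bar> \<le> 4 * s"
    using S1(2,3) S2(2,3) unfolding S_def distrib_left by linarith
  moreover have "((\<lambda>k::int. exp (- (s * (of_int k + \<delta>))\<^sup>2)) has_sum S) UNIV"
  proof (subst has_sum_reindex_bij_witness[of _ "\<lambda>k. k - \<lfloor>\<delta>\<rfloor>" "\<lambda>k. k + \<lfloor>\<delta>\<rfloor>" UNIV ?h])
    fix k :: int
    show "?h (k + \<lfloor>\<delta>\<rfloor>) = exp (- (s * (of_int k + \<delta>))\<^sup>2)" by (simp add: e_def frac_def)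
  qed (use h in \<open>auto simp: S_def\<close>)
  ultimately show ?thesis by blast
qed

text \<open>Completing the square in k makes the inner sum a shifted Gaussian sum, close to sqrt pi
  / (\<alpha> sqrt t) for every v, and leaves a Gaussian sum over v, close to sqrt pi / (\<beta>
  sqrt t). The constant comes from \<alpha> \<beta> = sqrt D / 2.\<close>

lemma binary_form_theta_sum:
  fixes a b c D :: real
  assumes a: "a > 0" and D: "D = 4 * a * c - b\<^sup>2" "D > 0"
  shows "\<exists>C. \<forall>t. 0 < t \<and> t \<le> 1 \<longrightarrow> (\<exists>S.
     ((\<lambda>(v, k). exp (- t * (a * of_int k ^ 2 + b * of_int k * of_int v + c * of_int v ^ 2)))
        has_sum S) (UNIV :: (int \<times> int) set) \<and> \<bar>t * S - 2 * pi / sqrt D\<bar> \<le> C * sqrt t)"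
proof -
  define \<alpha> where "\<alpha> = sqrt a"
  define \<beta> where "\<beta> = sqrt (D / (4 * a))"
  have \<alpha>: "\<alpha> > 0" "\<alpha>\<^sup>2 = a" and \<beta>: "\<beta> > 0" "\<beta>\<^sup>2 = D / (4 * a)"
    using a D(2) by (auto simp: \<alpha>_def \<beta>_def)
  have prod: "\<alpha> * \<beta> = sqrt D / 2"
    unfolding \<alpha>_def \<beta>_def using a by (simp flip: real_sqrt_mult) (simp add: real_sqrt_divide)
  \<comment> \<open>The first summand is the error of the inner sums, with r K bounded as in
    \<open>Kle\<close>; the second is the error of the outer sum.\<close>
  define C where "C = 4 * ((sqrt pi + 4 * \<beta>) / \<beta>) + 4 * \<beta> * (sqrt pi / (\<alpha> * \<beta>))"
  have "\<exists>S. ((\<lambda>(v, k). exp (- t * (a * of_int k ^ 2 + b * of_int k * of_int v + c * of_int v ^ 2)))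
        has_sum S) (UNIV :: (int \<times> int) set) \<and> \<bar>t * S - 2 * pi / sqrt D\<bar> \<le> C * sqrt t"
    if t: "0 < t" "t \<le> 1" for t
  proof -
    define r where "r = sqrt t"
    have r: "r > 0" "r \<le> 1" "r\<^sup>2 = t" using t by (auto simp: r_def)
    let ?E = "\<lambda>v k :: int. exp (- t * (a * of_int k ^ 2 + b * of_int k * of_int v + c * of_int v ^ 2))"
    let ?O = "\<lambda>v :: int. exp (- (r * \<beta> * (of_int v + 0))\<^sup>2)"
    let ?I = "\<lambda>v k :: int. exp (- (r * \<alpha> * (of_int k + b * of_int v / (2 * a)))\<^sup>2)"
    have E: "?E v k = ?O v * ?I v k" for v k
    proof -
      have "t * (a * of_int k ^ 2 + b * of_int k * of_int v + c * of_int v ^ 2)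
        = r\<^sup>2 * \<beta>\<^sup>2 * (of_int v)\<^sup>2 + r\<^sup>2 * \<alpha>\<^sup>2 * (of_int k + b * of_int v / (2 * a))\<^sup>2"
        unfolding r(3) \<alpha>(2) \<beta>(2) D(1) using a by (simp add: power2_eq_square field_simps)
      then show ?thesis by (simp add: exp_add[symmetric] power_mult_distrib)
    qed
    have "\<forall>v. \<exists>S. (?I v has_sum S) UNIV \<and> \<bar>r * \<alpha> * S - sqrt pi\<bar> \<le> 4 * (r * \<alpha>)"
      using theta_sum[of "r * \<alpha>"] r \<alpha> by simp
    then obtain J where J: "\<And>v. (?I v has_sum J v) UNIV" "\<And>v. \<bar>r * \<alpha> * J v - sqrt pi\<bar> \<le> 4 * (r * \<alpha>)"
      by metis
    obtain K where K: "(?O has_sum K) UNIV" "\<bar>r * \<beta> * K - sqrt pi\<bar> \<le> 4 * (r * \<beta>)"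
      using theta_sum[of "r * \<beta>" 0] r \<beta> by auto
    have Jle: "J v \<le> (sqrt pi + 4 * (r * \<alpha>)) / (r * \<alpha>)" "J v \<ge> (sqrt pi - 4 * (r * \<alpha>)) / (r * \<alpha>)" for v
      using J(2)[of v] r(1) \<alpha>(1) by (auto simp: field_simps abs_le_iff)
    have J0: "J v \<ge> 0" for v by (rule has_sum_nonneg[OF J(1)]) simp
    have inner: "((\<lambda>k. ?E v k) has_sum (?O v * J v)) UNIV" for v
      unfolding E by (rule has_sum_cmult_right[OF J(1)])
    have outer: "(\<lambda>v. ?O v * J v) summable_on UNIV"
    proof (rule summable_on_comparison_test[OF summable_on_cmult_left[OF has_sum_imp_summable[OF K(1)]]])
      show "?O v * J v \<le> ?O v * ((sqrt pi + 4 * (r * \<alpha>)) / (r * \<alpha>))" for v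
        by (rule mult_left_mono[OF Jle(1)]) simp
      show "0 \<le> ?O v * J v" for v using J0 by simp
    qed
    define S where "S = (\<Sum>\<^sub>\<infinity>v. ?O v * J v)"
    have S: "((\<lambda>v. ?O v * J v) has_sum S) UNIV" unfolding S_def using outer by simp
    have summ: "(\<lambda>(v, k). ?E v k) summable_on (UNIV \<times> UNIV)"
      by (rule summable_on_SigmaI[OF _ outer]) (use inner in auto)
    have tot: "((\<lambda>(v, k). ?E v k) has_sum S) (UNIV \<times> UNIV)"
      by (rule has_sum_SigmaI[OF _ S summ]) (use inner in simp)
    have up: "S \<le> K * ((sqrt pi + 4 * (r * \<alpha>)) / (r * \<alpha>))"
      by (rule has_sum_mono[OF S has_sum_cmult_left[OF K(1)]]) (rule mult_left_mono[OF Jle(1)], simp)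
    have lo: "K * ((sqrt pi - 4 * (r * \<alpha>)) / (r * \<alpha>)) \<le> S"
      by (rule has_sum_mono[OF has_sum_cmult_left[OF K(1)] S]) (rule mult_left_mono[OF Jle(2)], simp)
    have K0: "K \<ge> 0" by (rule has_sum_nonneg[OF K(1)]) simp
    have Kle: "r * K \<le> (sqrt pi + 4 * \<beta>) / \<beta>"
    proof -
      have "r * \<beta> * K \<le> sqrt pi + 4 * (r * \<beta>)" using K(2) by linarith
      also have "\<dots> \<le> sqrt pi + 4 * \<beta>" using r \<beta> by (simp add: mult_left_le_one_le)
      finally show ?thesis using \<beta>(1) by (simp add: field_simps)
    qed
    have tK: "t * (K * ((sqrt pi + x * (r * \<alpha>)) / (r * \<alpha>))) = r * K * sqrt pi / \<alpha> + x / \<alpha> * (r * K) * (r * \<alpha>)" for x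
      unfolding r(3)[symmetric] using r(1) \<alpha>(1) by (simp add: field_simps power2_eq_square)
    have main: "\<bar>r * K * sqrt pi / \<alpha> - 2 * pi / sqrt D\<bar> \<le> 4 * \<beta> * (sqrt pi / (\<alpha> * \<beta>)) * r"
    proof -
      have "2 * pi / sqrt D = sqrt pi * sqrt pi / (\<alpha> * \<beta>)" unfolding prod by simp
      then have "r * K * sqrt pi / \<alpha> - 2 * pi / sqrt D = (r * \<beta> * K - sqrt pi) * (sqrt pi / (\<alpha> * \<beta>))"
        using \<alpha>(1) \<beta>(1) by (simp add: field_simps)
      then have "\<bar>r * K * sqrt pi / \<alpha> - 2 * pi / sqrt D\<bar> = \<bar>r * \<beta> * K - sqrt pi\<bar> * (sqrt pi / (\<alpha> * \<beta>))"
        using \<alpha>(1) \<beta>(1) by (simp add: abs_mult)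
      also have "\<dots> \<le> 4 * (r * \<beta>) * (sqrt pi / (\<alpha> * \<beta>))"
        using K(2) \<alpha>(1) \<beta>(1) by (intro mult_right_mono) auto
      finally show ?thesis by (simp only: mult_ac)
    qed
    have "t * S \<le> r * K * sqrt pi / \<alpha> + 4 * (r * K) * r"
    proof -
      have "t * S \<le> t * (K * ((sqrt pi + 4 * (r * \<alpha>)) / (r * \<alpha>)))" using up t by (intro mult_left_mono) auto
      then show ?thesis unfolding tK using \<alpha>(1) by (simp add: mult_ac)
    qed
    moreover have "r * K * sqrt pi / \<alpha> - 4 * (r * K) * r \<le> t * S"
    proof -
      have "t * (K * ((sqrt pi + (-4) * (r * \<alpha>)) / (r * \<alpha>))) \<le> t * S" using lo t by (intro mult_left_mono) auto
      then show ?thesis unfolding tK using \<alpha>(1) by (simp add: mult_ac)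
    qed
    moreover have "4 * (r * K) * r \<le> 4 * ((sqrt pi + 4 * \<beta>) / \<beta>) * r"
      using Kle r by (intro mult_right_mono mult_left_mono) auto
    moreover have tri: "\<bar>x - l\<bar> \<le> B' + M" if "x \<le> A + B" "A - B \<le> x" "B \<le> B'" "\<bar>A - l\<bar> \<le> M"
      for x l A B B' M :: real using that by linarith
    ultimately have "\<bar>t * S - 2 * pi / sqrt D\<bar> \<le> (4 * ((sqrt pi + 4 * \<beta>) / \<beta>) + 4 * \<beta> * (sqrt pi / (\<alpha> * \<beta>))) * r"
      unfolding distrib_right using main by (intro tri)
    then show ?thesis using tot unfolding C_def r_def UNIV_Times_UNIV by blast
  qed
  then show ?thesis by blast
qed

section \<open>Double sums of sines\<close>

text \<open>The imaginary part of z / (1 - z) for z = exp (- u + i \<theta>); at u = 0 and sin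
  \<theta> different from 0 it is half the cotangent of \<theta> / 2.\<close>

definition cot_kernel :: "real \<Rightarrow> real \<Rightarrow> real" where
  "cot_kernel \<theta> u = sin \<theta> / (exp u + exp (- u) - 2 * cos \<theta>)"

lemma cot_kernel_reflect: "cot_kernel (2 * pi - \<theta>) u = - cot_kernel \<theta> u"
  by (simp add: cot_kernel_def sin_diff cos_diff)

text \<open>In this range the kernel is positive and decreases for u \<ge> 0. Its antiderivative
  arctan ((exp u - cos \<theta>) / sin \<theta>) rises from \<theta> / 2 to pi / 2.\<close>

lemma cot_kernel_sum_lt_pi:
  assumes \<theta>: "0 < \<theta>" "\<theta> < pi"
  shows "\<exists>C. \<forall>t>0. \<exists>S. ((\<lambda>m::nat. cot_kernel \<theta> (t * real m)) has_sum S) {1..} \<and> \<bar>t * S - (pi - \<theta>) / 2\<bar> \<le> C * t"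
proof -
  define s c where "s = sin \<theta>" and "c = cos \<theta>"
  have s: "s > 0" unfolding s_def using \<theta> by (rule sin_gt_zero)
  have sc: "s\<^sup>2 + c\<^sup>2 = 1" by (simp add: s_def c_def)
  have c1: "c < 1"
  proof -
    have "c\<^sup>2 < 1" using sc s by (smt (verit) zero_less_power)
    then show ?thesis by (simp add: abs_square_less_1 abs_less_iff)
  qed
  define F where "F = (\<lambda>u. arctan ((exp u - c) / s))"
  have e2: "exp u + exp (- u) \<ge> 2" for u :: real
    using cosh_real_ge_1[of u] by (simp add: cosh_def)
  have pos: "exp u + exp (- u) - 2 * c > 0" for u using e2[of u] c1 by linarith
  have deriv: "(F has_real_derivative cot_kernel \<theta> u) (at u)" for u
  proof -
    have "(F has_real_derivative (exp u / s) / (1 + ((exp u - c) / s)\<^sup>2)) (at u)"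
      unfolding F_def using s by (auto intro!: derivative_eq_intros simp: field_simps)
    also have "(exp u / s) / (1 + ((exp u - c) / s)\<^sup>2) = exp u * s / (s\<^sup>2 + (exp u - c)\<^sup>2)"
    proof -
      have "1 + ((exp u - c) / s)\<^sup>2 = (s\<^sup>2 + (exp u - c)\<^sup>2) / s\<^sup>2"
        using s by (simp add: power_divide add_divide_distrib)
      then show ?thesis using s by (simp add: power2_eq_square)
    qed
    also have "s\<^sup>2 + (exp u - c)\<^sup>2 = exp u * (exp u + exp (- u) - 2 * c)"
      using sc by (simp add: power2_eq_square algebra_simps flip: exp_add)
    also have "exp u * s / \<dots> = cot_kernel \<theta> u" by (simp add: cot_kernel_def s_def c_def)
    finally show ?thesis .
  qed
  have lim: "(F \<longlongrightarrow> pi / 2) at_top"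
  proof -
    have "filterlim (\<lambda>u::real. (exp u - c) / s) at_top at_top"
    proof -
      have "filterlim (\<lambda>u::real. - c + exp u) at_top at_top"
        by (rule filterlim_tendsto_add_at_top[OF tendsto_const exp_at_top])
      then have "filterlim (\<lambda>u::real. exp u - c) at_top at_top" by simp
      from filterlim_tendsto_pos_mult_at_top[OF tendsto_const[of "1 / s"] _ this]
      show ?thesis using s by simp
    qed
    then show ?thesis unfolding F_def
      by (rule filterlim_compose[OF tendsto_arctan_at_top])
  qed
  have F0: "F 0 = \<theta> / 2"
  proof -
    have "sin \<theta> = 2 * sin (\<theta> / 2) * cos (\<theta> / 2)" using sin_double[of "\<theta> / 2"] by simp
    moreover have "cos \<theta> = 1 - 2 * (sin (\<theta> / 2))\<^sup>2" using cos_double_sin[of "\<theta> / 2"] by simp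
    moreover have "sin (\<theta> / 2) > 0" "cos (\<theta> / 2) > 0" using \<theta> by (auto intro: sin_gt_zero cos_gt_zero)
    ultimately have "1 - c = 2 * sin (\<theta> / 2) * sin (\<theta> / 2)" "s = 2 * sin (\<theta> / 2) * cos (\<theta> / 2)"
      "sin (\<theta> / 2) > 0" by (simp_all add: s_def c_def power2_eq_square)
    then have "(1 - c) / s = tan (\<theta> / 2)" by (simp add: tan_def)
    then show ?thesis unfolding F_def using \<theta> by (simp add: arctan_tan)
  qed
  have anti: "cot_kernel \<theta> y \<le> cot_kernel \<theta> x" if "0 \<le> x" "x \<le> y" for x y
  proof -
    have "cosh x \<le> cosh y" using that by (simp add: cosh_real_nonneg_le_iff)
    then have "exp x + exp (- x) \<le> exp y + exp (- y)" by (simp add: cosh_def)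
    then show ?thesis unfolding cot_kernel_def s_def[symmetric] c_def[symmetric]
      using s pos[of x] by (intro divide_left_mono mult_pos_pos pos) auto
  qed
  have nonneg: "0 \<le> cot_kernel \<theta> x" for x
    using s pos[of x] by (simp add: cot_kernel_def s_def c_def)
  have "\<exists>S. ((\<lambda>m::nat. cot_kernel \<theta> (t * real m)) has_sum S) {1..} \<and> \<bar>t * S - (pi - \<theta>) / 2\<bar> \<le> cot_kernel \<theta> 0 * t"
    if t: "t > 0" for t
  proof -
    obtain S where S: "((\<lambda>m::nat. cot_kernel \<theta> (t * real m + 0)) has_sum S) {1..}"
      "pi / 2 - F 0 - t * cot_kernel \<theta> 0 \<le> t * S" "t * S \<le> pi / 2 - F 0"
      using riemann_sum_antitone[OF t, of 0 F "cot_kernel \<theta>" "pi / 2"] deriv anti nonneg lim by auto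
    have "t * cot_kernel \<theta> 0 \<ge> 0" using t nonneg[of 0] by simp
    then have "\<bar>t * S - (pi - \<theta>) / 2\<bar> \<le> cot_kernel \<theta> 0 * t"
      using S(2,3) unfolding F0 by (simp add: abs_le_iff diff_divide_distrib mult.commute)
    then show ?thesis using S(1) by auto
  qed
  then show ?thesis by blast
qed

text \<open>Beyond pi the kernel is negative, and reflection to 2 pi - \<theta> reduces to the
  previous lemma, since kernel and limit are both odd under it. The angles 2 pi a / p avoid pi
  because p is odd.\<close>

lemma cot_kernel_sum:
  assumes \<theta>: "0 < \<theta>" "\<theta> < 2 * pi" "\<theta> \<noteq> pi"
  shows "\<exists>C. \<forall>t>0. \<exists>S. ((\<lambda>m::nat. cot_kernel \<theta> (t * real m)) has_sum S) {1..} \<and> \<bar>t * S - (pi - \<theta>) / 2\<bar> \<le> C * t"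
proof (cases "\<theta> < pi")
  case True
  then show ?thesis using cot_kernel_sum_lt_pi \<theta> by blast
next
  case False
  then obtain C where C: "\<And>t. t > 0 \<Longrightarrow> \<exists>S. ((\<lambda>m::nat. cot_kernel (2 * pi - \<theta>) (t * real m)) has_sum S) {1..}
      \<and> \<bar>t * S - (pi - (2 * pi - \<theta>)) / 2\<bar> \<le> C * t"
    using cot_kernel_sum_lt_pi[of "2 * pi - \<theta>"] \<theta> by auto
  have "\<exists>S. ((\<lambda>m::nat. cot_kernel \<theta> (t * real m)) has_sum S) {1..} \<and> \<bar>t * S - (pi - \<theta>) / 2\<bar> \<le> C * t"
    if t: "t > 0" for t
  proof -
    obtain S where S: "((\<lambda>m::nat. - cot_kernel \<theta> (t * real m)) has_sum S) {1..}" "\<bar>t * S - (\<theta> - pi) / 2\<bar> \<le> C * t"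
      using C[OF t] by (auto simp: cot_kernel_reflect)
    have "((\<lambda>m::nat. cot_kernel \<theta> (t * real m)) has_sum - S) {1..}" using has_sum_cmult_right[OF S(1), of "-1"] by simp
    moreover have "\<bar>t * - S - (pi - \<theta>) / 2\<bar> = \<bar>t * S - (\<theta> - pi) / 2\<bar>" by (simp add: diff_divide_distrib)
    ultimately show ?thesis using S(2) by (metis (no_types, lifting))
  qed
  then show ?thesis by blast
qed

lemma cot_kernel_series:
  assumes "u > 0"
  shows "((\<lambda>d::nat. sin (real d * \<theta>) * exp (- u * real d)) has_sum cot_kernel \<theta> u) {1..}"
proof -
  define r where "r = exp (- u)"
  have r: "0 < r" "r < 1" using assms by (auto simp: r_def)
  define z where "z = complex_of_real r * cis \<theta>"
  have nz: "norm z < 1" using r by (simp add: z_def norm_mult)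
  have "((\<lambda>d. Im (z ^ d)) has_sum Im (z / (1 - z))) {1..}"
    by (rule has_sum_Im[OF has_sum_geometric_from_1[OF nz]])
  also have "(\<lambda>d. Im (z ^ d)) = (\<lambda>d. sin (real d * \<theta>) * exp (- u * real d))"
  proof
    fix d
    have "z ^ d = complex_of_real (r ^ d) * cis (real d * \<theta>)" by (simp add: z_def power_mult_distrib Complex.DeMoivre)
    moreover have "r ^ d = exp (- u * real d)" by (simp add: r_def exp_of_nat_mult[symmetric] mult.commute)
    ultimately show "Im (z ^ d) = sin (real d * \<theta>) * exp (- u * real d)" by simp
  qed
  also have "Im (z / (1 - z)) = cot_kernel \<theta> u"
  proof -
    have sq: "(1 - r * x)\<^sup>2 + (r * y)\<^sup>2 = 1 - 2 * r * x + r\<^sup>2 * (y\<^sup>2 + x\<^sup>2)" for x y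
      by (simp add: power2_eq_square algebra_simps)
    have "Im (z / (1 - z)) = r * sin \<theta> / ((1 - r * cos \<theta>)\<^sup>2 + (r * sin \<theta>)\<^sup>2)"
      by (simp add: Im_divide z_def algebra_simps)
    also have "(1 - r * cos \<theta>)\<^sup>2 + (r * sin \<theta>)\<^sup>2 = 1 - 2 * r * cos \<theta> + r\<^sup>2 * ((sin \<theta>)\<^sup>2 + (cos \<theta>)\<^sup>2)"
      by (rule sq)
    also have "(sin \<theta>)\<^sup>2 + (cos \<theta>)\<^sup>2 = 1" by simp
    also have "1 - 2 * r * cos \<theta> + r\<^sup>2 * 1 = r * (exp u + exp (- u) - 2 * cos \<theta>)"
      by (simp add: r_def power2_eq_square algebra_simps flip: exp_add)
    finally show ?thesis using r by (simp add: cot_kernel_def)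
  qed
  finally show ?thesis .
qed

text \<open>Since m + d \<le> 2 m d for positive integers, the product of two geometric series of
  ratio exp (- t / 2) dominates.\<close>

lemma double_exp_summable:
  assumes "t > 0"
  shows "(\<lambda>(m::nat, d::nat). exp (- t * real m * real d)) summable_on ({1..} \<times> {1..})"
proof -
  define q where "q = exp (- t / 2)"
  have q: "0 < q" "q < 1" using assms by (auto simp: q_def)
  have "(\<lambda>(m::nat, d::nat). q ^ m * q ^ d) summable_on ({1..} \<times> {1..})"
  proof (rule summable_on_SigmaI)
    show "((\<lambda>d. case (m, d) of (m, d) \<Rightarrow> q ^ m * q ^ d) has_sum q ^ m * (q / (1 - q))) {1..}" for m :: nat
      using has_sum_cmult_right[OF has_sum_geometric_from_1[of q], of "q ^ m"] q by simp
    show "(\<lambda>m::nat. q ^ m * (q / (1 - q))) summable_on {1..}"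
      using has_sum_cmult_left[OF has_sum_geometric_from_1[of q], of "q / (1 - q)"] q
      by (auto dest: has_sum_imp_summable)
  qed (use q in auto)
  then show ?thesis
  proof (rule summable_on_comparison_test)
    fix x :: "nat \<times> nat" assume "x \<in> {1..} \<times> {1..}"
    then obtain m d where x: "x = (m, d)" and md: "m \<ge> 1" "d \<ge> 1" by auto
    have "m + d \<le> 2 * m * d"
    proof -
      have "m \<le> m * d" "d \<le> m * d" using md by simp_all
      then show ?thesis unfolding mult.assoc by linarith
    qed
    then have "q ^ (2 * m * d) \<le> q ^ (m + d)" using q by (intro power_decreasing) auto
    moreover have "q ^ (2 * m * d) = exp (- t * real m * real d)"
      by (simp add: q_def exp_of_nat_mult[symmetric])
    ultimately show "(case x of (m, d) \<Rightarrow> exp (- t * real m * real d)) \<le> (case x of (m, d) \<Rightarrow> q ^ m * q ^ d)"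
      by (simp add: x power_add)
  qed auto
qed

text \<open>Summing over d first produces the kernel at the multiples of t; absolute summability
  allows this order.\<close>

lemma sine_double_sum:
  assumes \<theta>: "0 < \<theta>" "\<theta> < 2 * pi" "\<theta> \<noteq> pi"
  shows "\<exists>C. \<forall>t>0. \<exists>S. ((\<lambda>(m::nat, d::nat). sin (real d * \<theta>) * exp (- t * real m * real d)) has_sum S) ({1..} \<times> {1..})
     \<and> \<bar>t * S - (pi - \<theta>) / 2\<bar> \<le> C * t"
proof -
  obtain C where C: "\<And>t. t > 0 \<Longrightarrow> \<exists>S. ((\<lambda>m::nat. cot_kernel \<theta> (t * real m)) has_sum S) {1..}
      \<and> \<bar>t * S - (pi - \<theta>) / 2\<bar> \<le> C * t"
    using cot_kernel_sum[OF \<theta>] by blast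
  have "\<exists>S. ((\<lambda>(m::nat, d::nat). sin (real d * \<theta>) * exp (- t * real m * real d)) has_sum S) ({1..} \<times> {1..})
     \<and> \<bar>t * S - (pi - \<theta>) / 2\<bar> \<le> C * t" if t: "t > 0" for t
  proof -
    obtain S where S: "((\<lambda>m::nat. cot_kernel \<theta> (t * real m)) has_sum S) {1..}" "\<bar>t * S - (pi - \<theta>) / 2\<bar> \<le> C * t"
      using C[OF t] by blast
    have "((\<lambda>(m::nat, d::nat). sin (real d * \<theta>) * exp (- t * real m * real d)) has_sum S) ({1..} \<times> {1..})"
    proof (rule has_sum_SigmaI[OF _ S(1)])
      fix m :: nat assume "m \<in> {1..}"
      then show "((\<lambda>d. case (m, d) of (m, d) \<Rightarrow> sin (real d * \<theta>) * exp (- t * real m * real d)) has_sum cot_kernel \<theta> (t * real m)) {1..}"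
        using cot_kernel_series[of "t * real m" \<theta>] t by simp
    next
      have "(\<lambda>x. norm (case x of (m::nat, d::nat) \<Rightarrow> sin (real d * \<theta>) * exp (- t * real m * real d))) summable_on ({1..} \<times> {1..})"
        by (rule Infinite_Sum.abs_summable_on_comparison_test'[OF double_exp_summable[OF t]])
          (auto simp: abs_mult mult_left_le_one_le)
      then show "(\<lambda>(m::nat, d::nat). sin (real d * \<theta>) * exp (- t * real m * real d)) summable_on ({1..} \<times> {1..})"
        by (rule abs_summable_summable)
    qed
    then show ?thesis using S(2) by blast
  qed
  then show ?thesis by blast
qed

section \<open>The ring of integers and its ideals\<close>

text \<open>Every power of the reduced denominator b divides D.\<close>

lemma Ints_of_bounded_denominator:
  fixes r :: real
  assumes r: "r \<in> \<rat>" and D: "D > (0::nat)" "\<And>k. real D * r ^ k \<in> \<int>"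
  shows "r \<in> \<int>"
proof -
  obtain a b where ab: "b \<noteq> 0" "\<bar>r\<bar> = real a / real b" "coprime a b"
    using Rats_abs_nat_div_natE[OF r] by blast
  have "b ^ k dvd D" for k
  proof -
    have "real D * \<bar>r\<bar> ^ k \<in> \<int>"
      using D(2)[of k] by (metis Ints_abs abs_mult abs_of_nat power_abs)
    then obtain j where "real D * (real a / real b) ^ k = of_int j" unfolding ab(2) by (elim Ints_cases)
    then have "real_of_int (int (D * a ^ k)) = real_of_int (j * int (b ^ k))"
      using ab(1) by (simp add: power_divide field_simps)
    then have "int (D * a ^ k) = j * int (b ^ k)" by (simp only: of_int_eq_iff)
    then have "int (b ^ k) dvd int (D * a ^ k)" by simp
    then have "b ^ k dvd D * a ^ k" by (simp only: of_nat_dvd_iff)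
    moreover have "coprime (b ^ k) (a ^ k)" using ab(3) by (simp add: coprime_commute)
    ultimately show ?thesis by (simp add: coprime_dvd_mult_left_iff)
  qed
  \<comment> \<open>D itself is a large enough exponent: b \<ge> 2 would give b^D \<ge> 2^D >
    D.\<close>
  then have "b ^ D \<le> D" using D(1) by (intro dvd_imp_le)
  moreover have "D < 2 ^ D" by (rule less_exp)
  ultimately have "\<not> 2 \<le> b" using power_mono[of 2 b D] by linarith
  then have "b = 1" using ab(1) by linarith
  then have "\<bar>r\<bar> \<in> \<int>" using ab(2) by simp
  then show ?thesis by (cases "r \<ge> 0") auto
qed

text \<open>After division by the greatest common divisor, the square of a' divides l, and a prime
  has no square factor except 1.\<close>

lemma prime_square_dvd:
  fixes a b l :: int
  assumes l: "prime l" and dvd: "a\<^sup>2 dvd l * b\<^sup>2" and a: "a \<noteq> 0"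
  shows "a dvd b"
proof -
  obtain a' b' where ab: "a = a' * gcd a b" "b = b' * gcd a b" "coprime a' b'"
    using gcd_coprime_exists[of a b] a by auto
  let ?g = "gcd a b"
  have g: "?g \<noteq> 0" using a by simp
  have "(a' * ?g)\<^sup>2 dvd l * (b' * ?g)\<^sup>2" using dvd ab(1,2) by metis
  then have "a'\<^sup>2 * ?g\<^sup>2 dvd (l * b'\<^sup>2) * ?g\<^sup>2" by (simp only: power_mult_distrib mult.assoc)
  then have "a'\<^sup>2 dvd l * b'\<^sup>2" using g by (simp only: dvd_mult_cancel_right) auto
  then have sq: "a'\<^sup>2 dvd l" using ab(3) by (simp add: coprime_dvd_mult_left_iff)
  have "a' dvd l" using sq by (meson dvd_trans dvd_power pos2)
  have "irreducible l" using l by (intro prime_elem_imp_irreducible) auto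
  then have cases: "l dvd a' \<or> is_unit a'" using \<open>a' dvd l\<close> by (rule irreducibleD')
  have "is_unit a'"
  proof (rule ccontr)
    assume "\<not> is_unit a'"
    then have "l dvd a'" using cases by simp
    then have "l * l dvd a'\<^sup>2" by (simp add: mult_dvd_mono power2_eq_square)
    then have "l * l dvd l" using sq by (rule dvd_trans)
    then have "l dvd 1" using l by (metis dvd_times_left_cancel_iff mult.right_neutral not_prime_0)
    then show False using l not_prime_unit by blast
  qed
  then have "a' dvd b'" by (rule unit_imp_dvd)
  then show ?thesis using ab(1,2) by (metis dvd_refl mult_dvd_mono)
qed

context prime_3_mod_4
begin

definition sqrt_neg_p :: complex where "sqrt_neg_p = \<i> * complex_of_real (sqrt (real p))"
definition omega :: complex where "omega = (1 + sqrt_neg_p) / 2"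
definition emb :: "int \<Rightarrow> int \<Rightarrow> complex" where "emb a b = of_int a + of_int b * omega"
definition OK :: "complex set" where "OK = {emb a b | a b. True}"
definition K :: "complex set" where "K = quadratic_field (- P)"
definition R :: "complex ring" where "R = ring_of_integers K"

lemma sqrt_p: "sqrt (real p) > 0" "sqrt (real p) * sqrt (real p) = real p"
  using p_gt_2 by auto

lemma sqrt_neg_p_simps [simp]: "Re sqrt_neg_p = 0" "Im sqrt_neg_p = sqrt (real p)" "sqrt_neg_p * sqrt_neg_p = - of_nat p" "cnj sqrt_neg_p = - sqrt_neg_p"
proof -
  have "sqrt_neg_p * sqrt_neg_p = - (complex_of_real (sqrt (real p) * sqrt (real p)))" unfolding sqrt_neg_p_def
    by (simp only: of_real_mult) (simp add: algebra_simps flip: power2_eq_square)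
  then show "sqrt_neg_p * sqrt_neg_p = - of_nat p" by (simp only: sqrt_p(2)) simp
qed (auto simp: sqrt_neg_p_def)

lemma omega_simps [simp]: "Re omega = 1 / 2" "Im omega = sqrt (real p) / 2" "cnj omega = 1 - omega"
  by (auto simp: omega_def sqrt_neg_p_def complex_eq_iff)

lemma omega_square: "omega * omega = omega - of_int q"
proof -
  have "omega * omega = (1 + 2 * sqrt_neg_p + sqrt_neg_p * sqrt_neg_p) / 4" by (simp add: omega_def field_simps)
  also have "\<dots> = omega - (of_nat p + 1) / 4" by (simp add: omega_def field_simps)
  also have "(of_nat p + 1 :: complex) = of_int (P + 1)" by simp
  also have "\<dots> = 4 * of_int q" unfolding four_q[symmetric] by simp
  finally show ?thesis by simp
qed

lemma emb_inject [simp]: "emb a b = emb c d \<longleftrightarrow> a = c \<and> b = d"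
proof
  assume e: "emb a b = emb c d"
  from arg_cong[OF e, of Im] have "b = d" using sqrt_p(1) by (simp add: emb_def)
  with e show "a = c \<and> b = d" by (simp add: emb_def)
qed simp

lemma emb_add: "emb a b + emb c d = emb (a + c) (b + d)" by (simp add: emb_def algebra_simps)
lemma emb_minus: "- emb a b = emb (- a) (- b)" by (simp add: emb_def algebra_simps)
lemma emb_mult: "emb a b * emb c d = emb (a * c - q * b * d) (a * d + b * c + b * d)"
proof -
  have "emb a b * emb c d = of_int (a * c) + of_int (a * d + b * c) * omega + of_int (b * d) * (omega * omega)"
    by (simp add: emb_def algebra_simps)
  then show ?thesis by (simp add: omega_square emb_def algebra_simps)
qed
lemma emb_cnj: "cnj (emb a b) = emb (a + b) (- b)" by (simp add: emb_def algebra_simps)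
lemma emb_0: "emb 0 0 = 0" by (simp add: emb_def)
lemma emb_eq_0_iff [simp]: "emb a b = 0 \<longleftrightarrow> a = 0 \<and> b = 0" using emb_inject[of a b 0 0] by (simp only: emb_0)
lemma emb_of_int: "of_int a = emb a 0" by (simp add: emb_def)

lemma emb_norm: "(cmod (emb a b))\<^sup>2 = of_int (a\<^sup>2 + a * b + q * b\<^sup>2)"
proof -
  have "complex_of_real ((cmod (emb a b))\<^sup>2) = emb a b * cnj (emb a b)" by (rule complex_norm_square)
  also have "\<dots> = of_int (a\<^sup>2 + a * b + q * b\<^sup>2)"
    unfolding emb_cnj emb_mult emb_of_int by (simp add: power2_eq_square algebra_simps)
  finally show ?thesis by (metis of_real_eq_iff of_real_of_int_eq)
qed

lemma OK_closed:
  "x \<in> OK \<Longrightarrow> y \<in> OK \<Longrightarrow> x + y \<in> OK" "x \<in> OK \<Longrightarrow> - x \<in> OK" "x \<in> OK \<Longrightarrow> y \<in> OK \<Longrightarrow> x * y \<in> OK"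
  "0 \<in> OK" "1 \<in> OK" "of_int a \<in> OK" "emb a b \<in> OK" "x \<in> OK \<Longrightarrow> cnj x \<in> OK"
  unfolding OK_def
  by (auto simp: emb_add emb_minus emb_mult emb_of_int emb_cnj simp flip: emb_0)
    (metis emb_of_int of_int_1)

lemma K_alt: "K = {complex_of_real a + complex_of_real b * sqrt_neg_p | a b. a \<in> \<rat> \<and> b \<in> \<rat>}"
proof -
  have 1: "csqrt (of_int (- P)) = sqrt_neg_p"
    by (subst csqrt_of_real_nonpos) (auto simp: sqrt_neg_p_def)
  have rat: "x \<in> \<rat> \<longleftrightarrow> (\<exists>a::real. a \<in> \<rat> \<and> x = of_real a)" for x :: complex
  proof
    assume "x \<in> \<rat>"
    then obtain a b where "x = of_int a / of_int b" by (auto elim!: Rats_cases')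
    then have "x = of_real (of_int a / of_int b)" by simp
    then show "\<exists>a::real. a \<in> \<rat> \<and> x = of_real a" by (intro exI[of _ "of_int a / of_int b"]) auto
  next
    assume "\<exists>a::real. a \<in> \<rat> \<and> x = of_real a"
    then obtain a b where "x = of_real (of_int a / of_int b)" by (auto elim!: Rats_cases')
    then show "x \<in> \<rat>" by simp
  qed
  show ?thesis unfolding K_def quadratic_field_def 1 by (auto simp: rat)
qed

lemma OK_subset: "OK \<subseteq> {z \<in> K. algebraic_int z}"
proof
  fix z assume "z \<in> OK"
  then obtain a b where z: "z = emb a b" by (auto simp: OK_def)
  have "z = complex_of_real (of_int a + of_int b / 2) + complex_of_real (of_int b / 2) * sqrt_neg_p"
    by (simp add: z emb_def omega_def field_simps)
  then have "z \<in> K" unfolding K_alt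
    by (intro CollectI exI[of _ "of_int a + of_int b / 2"] exI[of _ "of_int b / 2"]) simp
  moreover have "algebraic_int z"
  proof (rule algebraic_int.intros)
    let ?f = "[: of_int (a\<^sup>2 + a * b + q * b\<^sup>2), - of_int (2 * a + b), 1 :: complex :]"
    show "lead_coeff ?f = 1" by simp
    show "\<forall>i. poly.coeff ?f i \<in> \<int>" by (auto simp: coeff_pCons split: nat.split)
    have "z * z = of_int (2 * a + b) * z - of_int (a\<^sup>2 + a * b + q * b\<^sup>2)"
      unfolding z emb_of_int diff_conv_add_uminus emb_mult emb_minus emb_add
      by (simp add: power2_eq_square algebra_simps)
    then show "poly ?f z = 0" by (simp add: algebra_simps)
  qed
  ultimately show "z \<in> {z \<in> K. algebraic_int z}" by simp
qed

text \<open>An algebraic integer has powers of bounded denominator, so its norm and trace are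
  rational numbers with powers of bounded denominator, hence integers.\<close>

lemma bounded_denominator:
  assumes z: "z \<in> K" "algebraic_int z"
  shows "\<exists>D>0. \<forall>k. \<exists>a b :: int. of_nat D * z ^ k = of_int a + of_int b * sqrt_neg_p"
proof -
  define M where "M = {of_int a + of_int b * sqrt_neg_p | a b :: int. True}"
  have M_add: "x + y \<in> M" if xy: "x \<in> M" "y \<in> M" for x y
  proof -
    obtain a b c d where "x = of_int a + of_int b * sqrt_neg_p" "y = of_int c + of_int d * sqrt_neg_p" using xy by (auto simp: M_def)
    then have "x + y = of_int (a + c) + of_int (b + d) * sqrt_neg_p" by (simp add: algebra_simps)
    then show ?thesis unfolding M_def by blast
  qed
  have M_mult: "x * y \<in> M" if xy: "x \<in> M" "y \<in> M" for x y
  proof -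
    obtain a b c d where "x = of_int a + of_int b * sqrt_neg_p" "y = of_int c + of_int d * sqrt_neg_p" using xy by (auto simp: M_def)
    then have "x * y = of_int (a * c) + of_int (a * d + b * c) * sqrt_neg_p + of_int (b * d) * (sqrt_neg_p * sqrt_neg_p)" by (simp add: algebra_simps del: sqrt_neg_p_simps)
    also have "\<dots> = of_int (a * c - b * d * P) + of_int (a * d + b * c) * sqrt_neg_p" by simp
    finally show ?thesis unfolding M_def by blast
  qed
  have M_int: "of_int a \<in> M" for a unfolding M_def by (force intro: exI[of _ a] exI[of _ 0])
  have M_sum: "sum f A \<in> M" if "\<And>x. x \<in> A \<Longrightarrow> f x \<in> M" for f :: "nat \<Rightarrow> complex" and A
    using that M_int[of 0] by (induction A rule: infinite_finite_induct) (auto intro: M_add)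
  have M_power: "x ^ k \<in> M" if "x \<in> M" for x k
    using that M_int[of 1] by (induction k) (auto intro: M_mult)
  obtain u v :: real where uv: "u \<in> \<rat>" "v \<in> \<rat>" "z = complex_of_real u + complex_of_real v * sqrt_neg_p"
    using z(1) unfolding K_alt by blast
  obtain a b where u: "u = of_int a / of_int b" "b > 0" using uv(1) by (auto elim!: Rats_cases')
  obtain c d where v: "v = of_int c / of_int d" "d > 0" using uv(2) by (auto elim!: Rats_cases')
  define D0 where "D0 = nat (b * d)"
  have D0: "D0 > 0" "of_nat D0 = (of_int (b * d) :: complex)" using u v by (auto simp: D0_def)
  have "of_nat D0 * z = of_int (a * d) + of_int (b * c) * sqrt_neg_p"
    unfolding D0(2) uv(3) u(1) v(1) using u(2) v(2) by (simp add: field_simps)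
  then have D0z: "of_nat D0 * z \<in> M" unfolding M_def by blast
  obtain f where f: "lead_coeff f = 1" "\<forall>i. poly.coeff f i \<in> \<int>" "poly f z = 0"
    using z(2) by (auto elim: algebraic_int.cases)
  define n where "n = degree f"
  have zn: "z ^ n = - (\<Sum>i<n. poly.coeff f i * z ^ i)"
  proof -
    have "{..n} = insert n {..<n}" by auto
    then have "0 = poly.coeff f n * z ^ n + (\<Sum>i<n. poly.coeff f i * z ^ i)"
      using f(3) unfolding poly_altdef n_def by simp
    then show ?thesis using f(1) by (simp add: n_def add_eq_0_iff)
  qed
  have "of_nat (D0 ^ n) * z ^ k \<in> M" for k
  proof (induction k rule: less_induct)
    case (less k)
    show ?case
    proof (cases "k < n")
      case True
      then have "of_nat (D0 ^ n) * z ^ k = of_int (int (D0 ^ (n - k))) * (of_nat D0 * z) ^ k"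
        by (simp add: power_mult_distrib mult.assoc[symmetric] power_add[symmetric])
      then show ?thesis using M_mult[OF M_int M_power[OF D0z]] by metis
    next
      case False
      then have "z ^ k = z ^ (k - n) * z ^ n" by (simp add: power_add[symmetric])
      then have "of_nat (D0 ^ n) * z ^ k = (\<Sum>i<n. - poly.coeff f i * (of_nat (D0 ^ n) * z ^ (k - n + i)))"
        unfolding zn by (simp add: sum_distrib_left sum_negf power_add mult_ac)
      also have "\<dots> \<in> M"
      proof (rule M_sum)
        fix i assume i: "i \<in> {..<n}"
        have "- poly.coeff f i \<in> \<int>" using f(2) by auto
        then obtain c where "- poly.coeff f i = of_int c" by (elim Ints_cases)
        then have "- poly.coeff f i \<in> M" using M_int by simp
        moreover have "of_nat (D0 ^ n) * z ^ (k - n + i) \<in> M" by (rule less.IH) (use i False in auto)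
        ultimately show "- poly.coeff f i * (of_nat (D0 ^ n) * z ^ (k - n + i)) \<in> M" by (rule M_mult)
      qed
      finally show ?thesis .
    qed
  qed
  moreover have "D0 ^ n > 0" using D0(1) by simp
  ultimately show ?thesis unfolding M_def by blast
qed

lemma norm_Ints:
  assumes z: "z \<in> K" and D: "D > 0" "\<And>k. \<exists>a b :: int. of_nat D * z ^ k = of_int a + of_int b * sqrt_neg_p"
  shows "(cmod z)\<^sup>2 \<in> \<int>"
proof (rule Ints_of_bounded_denominator[of _ "D\<^sup>2"])
  have norm: "(cmod (complex_of_real a + complex_of_real b * sqrt_neg_p))\<^sup>2 = a\<^sup>2 + real p * b\<^sup>2" for a b
    by (simp add: cmod_power2 power_mult_distrib)
  obtain u v :: real where uv: "u \<in> \<rat>" "v \<in> \<rat>" "z = complex_of_real u + complex_of_real v * sqrt_neg_p"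
    using z unfolding K_alt by blast
  show "(cmod z)\<^sup>2 \<in> \<rat>" unfolding uv(3) norm using uv by (auto intro!: Rats_add Rats_mult)
  fix k
  obtain a b where ab: "of_nat D * z ^ k = of_int a + of_int b * sqrt_neg_p" using D(2) by blast
  have "real (D\<^sup>2) * ((cmod z)\<^sup>2) ^ k = (cmod (of_nat D * z ^ k))\<^sup>2"
    by (simp add: norm_mult norm_power power_mult_distrib power_mult[symmetric] mult.commute)
  also have "\<dots> = of_int (a\<^sup>2 + P * b\<^sup>2)" unfolding ab using norm[of "of_int a" "of_int b"] by simp
  finally show "real (D\<^sup>2) * ((cmod z)\<^sup>2) ^ k \<in> \<int>" by simp
qed (use D in simp)

text \<open>For the harder inclusion, norm and trace of z are integers, the trace A being N(z + 1) -
  N(z) - 1. Then p (2v)^2 is an integer; as p is squarefree, 2v is an integer B, and A^2 + p B^2 =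
  4N forces A and B to have the same parity.\<close>

lemma OK_eq: "OK = {z \<in> K. algebraic_int z}"
proof
  show "{z \<in> K. algebraic_int z} \<subseteq> OK"
  proof
    fix z assume "z \<in> {z \<in> K. algebraic_int z}"
    then have z: "z \<in> K" "algebraic_int z" by auto
    obtain D where D: "D > 0" "\<And>k. \<exists>a b :: int. of_nat D * z ^ k = of_int a + of_int b * sqrt_neg_p"
      using bounded_denominator[OF z] by blast
    obtain u v :: real where uv: "u \<in> \<rat>" "v \<in> \<rat>" "z = complex_of_real u + complex_of_real v * sqrt_neg_p"
      using z(1) unfolding K_alt by blast
    have z1: "z + 1 \<in> K" unfolding K_alt uv(3)
      by (rule CollectI, rule exI[of _ "u + 1"], rule exI[of _ v]) (use uv in auto)
    \<comment> \<open>The denominator D of the powers of z serves for z + 1 too, by the binomial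
      theorem.\<close>
    have D1: "\<exists>a b :: int. of_nat D * (z + 1) ^ k = of_int a + of_int b * sqrt_neg_p" for k
    proof -
      obtain a b where ab: "\<And>i. of_nat D * z ^ i = of_int (a i) + of_int (b i) * sqrt_neg_p" using D(2) by metis
      have "of_nat D * (z + 1) ^ k = (\<Sum>i\<le>k. of_nat (k choose i) * (of_nat D * z ^ i))"
        by (simp add: binomial_ring sum_distrib_left mult_ac)
      also have "\<dots> = of_int (\<Sum>i\<le>k. int (k choose i) * a i) + of_int (\<Sum>i\<le>k. int (k choose i) * b i) * sqrt_neg_p"
        unfolding ab by (simp add: sum.distrib distrib_left sum_distrib_left sum_distrib_right mult_ac)
      finally show ?thesis by blast
    qed
    obtain N where N: "(cmod z)\<^sup>2 = of_int N" using norm_Ints[OF z(1) D] by (elim Ints_cases)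
    obtain N1 where N1: "(cmod (z + 1))\<^sup>2 = of_int N1" using norm_Ints[OF z1 D(1) D1] by (elim Ints_cases)
    have nz: "(cmod z)\<^sup>2 = u\<^sup>2 + real p * v\<^sup>2" "(cmod (z + 1))\<^sup>2 = (u + 1)\<^sup>2 + real p * v\<^sup>2"
      unfolding uv(3) by (simp_all add: cmod_power2 power_mult_distrib)
    define A where "A = N1 - N - 1"
    have A: "2 * u = of_int A"
      using N N1 nz by (simp add: A_def power2_eq_square algebra_simps)
    have B: "real p * (2 * v)\<^sup>2 = of_int (4 * N - A\<^sup>2)"
    proof -
      have "(2 * u)\<^sup>2 + real p * (2 * v)\<^sup>2 = of_int (4 * N)" using N nz by (simp add: power_mult_distrib)
      then show ?thesis unfolding A by simp
    qed
    have "2 * v \<in> \<rat>" using uv by simp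
    then obtain c d where cd: "2 * v = of_int c / of_int d" "d > 0" by (elim Rats_cases') auto
    have "real_of_int (P * c\<^sup>2) = real_of_int ((4 * N - A\<^sup>2) * d\<^sup>2)"
      using B unfolding cd(1) using cd(2) by (simp add: power_divide field_simps)
    then have "P * c\<^sup>2 = (4 * N - A\<^sup>2) * d\<^sup>2" by (simp only: of_int_eq_iff)
    then have "d\<^sup>2 dvd P * c\<^sup>2" by simp
    then have "d dvd c" by (rule prime_square_dvd[OF prime_P]) (use cd in auto)
    then obtain Bv where Bv: "c = d * Bv" by blast
    then have v: "2 * v = of_int Bv" using cd by simp
    have "real_of_int (A\<^sup>2 + P * Bv\<^sup>2) = real_of_int (4 * N)" using B unfolding v by simp
    then have "A\<^sup>2 + P * Bv\<^sup>2 = 4 * N" by (simp only: of_int_eq_iff)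
    moreover have "odd P" using odd_p by simp
    ultimately have "even (A\<^sup>2 + P * Bv\<^sup>2)" by simp
    then have "even (A - Bv)" using \<open>odd P\<close> by simp
    then obtain a where a: "A = Bv + 2 * a" by (metis add.commute diff_add_cancel evenE)
    have "2 * z = of_int A + of_int Bv * sqrt_neg_p"
      unfolding uv(3) distrib_left mult.assoc[symmetric] using A v by (metis of_real_mult of_real_numeral of_real_of_int_eq)
    also have "\<dots> = 2 * emb a Bv" by (simp add: emb_def omega_def a field_simps)
    finally show "z \<in> OK" using OK_closed(7) by simp
  qed
qed (rule OK_subset)

lemma R_simps [simp]: "carrier R = OK" "x \<otimes>\<^bsub>R\<^esub> y = x * y" "x \<oplus>\<^bsub>R\<^esub> y = x + y" "\<one>\<^bsub>R\<^esub> = 1" "\<zero>\<^bsub>R\<^esub> = 0"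
  by (simp_all add: R_def ring_of_integers_def OK_eq)

lemma cring_R: "cring R"
proof (rule cringI)
  show "abelian_group R"
  proof (rule abelian_groupI)
    fix x assume "x \<in> carrier R"
    then show "\<exists>y\<in>carrier R. y \<oplus>\<^bsub>R\<^esub> x = \<zero>\<^bsub>R\<^esub>" by (auto intro!: bexI[of _ "- x"] OK_closed)
  qed (auto intro: OK_closed)
  show "Group.comm_monoid R" by (rule comm_monoidI) (auto intro: OK_closed)
qed (auto simp: algebra_simps)

lemma a_inv_R: "x \<in> OK \<Longrightarrow> inv\<^bsub>add_monoid R\<^esub> x = - x"
proof -
  interpret cring R by (rule cring_R)
  assume "x \<in> OK"
  then have "\<ominus>\<^bsub>R\<^esub> x = - x" by (intro minus_equality) (auto intro: OK_closed)
  then show ?thesis by (simp add: a_inv_def)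
qed

lemma ideal_R_iff:
  "ideal I R \<longleftrightarrow> I \<subseteq> OK \<and> 0 \<in> I \<and> (\<forall>x\<in>I. \<forall>y\<in>I. x + y \<in> I) \<and> (\<forall>x\<in>I. \<forall>r\<in>OK. r * x \<in> I)"
proof
  assume "ideal I R"
  then interpret ideal I R .
  show "I \<subseteq> OK \<and> 0 \<in> I \<and> (\<forall>x\<in>I. \<forall>y\<in>I. x + y \<in> I) \<and> (\<forall>x\<in>I. \<forall>r\<in>OK. r * x \<in> I)"
    using a_subset additive_subgroup.a_closed[OF is_additive_subgroup]
      additive_subgroup.zero_closed[OF is_additive_subgroup] I_l_closed by auto
next
  assume h: "I \<subseteq> OK \<and> 0 \<in> I \<and> (\<forall>x\<in>I. \<forall>y\<in>I. x + y \<in> I) \<and> (\<forall>x\<in>I. \<forall>r\<in>OK. r * x \<in> I)"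
  have neg: "- x \<in> I" if "x \<in> I" for x
    using h that OK_closed(2)[OF OK_closed(5)] by (metis mult_minus1)
  show "ideal I R"
  proof (rule idealI)
    show "ring R" using cring_R by (simp add: cring_def)
    show "subgroup I (add_monoid R)"
      unfolding subgroup_def using h neg a_inv_R by auto
  qed (use h in \<open>auto simp: mult.commute\<close>)
qed

end

section \<open>Covolumes and the classification of ideals\<close>

definition lattice :: "complex \<Rightarrow> complex \<Rightarrow> complex set" where
  "lattice \<alpha> \<beta> = {of_int k * \<alpha> + of_int v * \<beta> | k v. True}"

text \<open>Defined from the set alone, hence independent of a basis: the least positive area of a
  parallelogram spanned by two elements.\<close>

definition covolume :: "complex set \<Rightarrow> real" where
  "covolume L = Inf {r. 0 < r \<and> (\<exists>\<alpha>\<in>L. \<exists>\<beta>\<in>L. r = \<bar>Im (cnj \<alpha> * \<beta>)\<bar>)}"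

text \<open>Any two lattice elements span an area that is an integer multiple of that of the basis,
  the factor being a determinant.\<close>

lemma covolume_lattice:
  assumes "Im (cnj \<alpha> * \<beta>) \<noteq> 0"
  shows "covolume (lattice \<alpha> \<beta>) = \<bar>Im (cnj \<alpha> * \<beta>)\<bar>"
  unfolding covolume_def
proof (rule cInf_eq_minimum)
  have "\<alpha> = of_int 1 * \<alpha> + of_int 0 * \<beta>" "\<beta> = of_int 0 * \<alpha> + of_int 1 * \<beta>" by simp_all
  then have "\<alpha> \<in> lattice \<alpha> \<beta>" "\<beta> \<in> lattice \<alpha> \<beta>" unfolding lattice_def by blast+
  then show "\<bar>Im (cnj \<alpha> * \<beta>)\<bar> \<in> {r. 0 < r \<and> (\<exists>a\<in>lattice \<alpha> \<beta>. \<exists>b\<in>lattice \<alpha> \<beta>. r = \<bar>Im (cnj a * b)\<bar>)}"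
    using assms by auto
next
  fix r assume "r \<in> {r. 0 < r \<and> (\<exists>a\<in>lattice \<alpha> \<beta>. \<exists>b\<in>lattice \<alpha> \<beta>. r = \<bar>Im (cnj a * b)\<bar>)}"
  then obtain a b where r0: "0 < r" "a \<in> lattice \<alpha> \<beta>" "b \<in> lattice \<alpha> \<beta>" "r = \<bar>Im (cnj a * b)\<bar>" by blast
  then obtain k v k' v' :: int where "a = of_int k * \<alpha> + of_int v * \<beta>" "b = of_int k' * \<alpha> + of_int v' * \<beta>"
    unfolding lattice_def by blast
  with r0 have r: "0 < r" "r = \<bar>Im (cnj (of_int k * \<alpha> + of_int v * \<beta>) * (of_int k' * \<alpha> + of_int v' * \<beta>))\<bar>"
    by simp_all
  have "Im (cnj (of_int k * \<alpha> + of_int v * \<beta>) * (of_int k' * \<alpha> + of_int v' * \<beta>))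
      = of_int (k * v' - v * k') * Im (cnj \<alpha> * \<beta>)"
    by (simp add: algebra_simps)
  then have r2: "r = \<bar>of_int (k * v' - v * k')\<bar> * \<bar>Im (cnj \<alpha> * \<beta>)\<bar>" using r(2) by (simp only: abs_mult)
  have "k * v' - v * k' \<noteq> 0"
  proof
    assume "k * v' - v * k' = 0"
    then have "r = 0" unfolding r2 by (simp only: of_int_0 abs_zero mult_zero_left)
    then show False using r(1) by simp
  qed
  then have "1 \<le> \<bar>k * v' - v * k'\<bar>" by linarith
  then have "1 \<le> \<bar>real_of_int (k * v' - v * k')\<bar>" by linarith
  then have "1 * \<bar>Im (cnj \<alpha> * \<beta>)\<bar> \<le> r" unfolding r2 by (intro mult_right_mono) auto
  then show "\<bar>Im (cnj \<alpha> * \<beta>)\<bar> \<le> r" by simp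
qed

context prime_3_mod_4
begin

text \<open>Normalised by the covolume sqrt p / 2 of the ring of integers, so that an ideal gets its
  usual norm. In this form the behaviour under multiplication by a complex number is
  immediate.\<close>

definition ideal_norm :: "complex set \<Rightarrow> real" where "ideal_norm I = 2 * covolume I / sqrt (real p)"

definition triples :: "(nat \<times> nat \<times> int) set" where
  "triples = {(g, n, x). g > 0 \<and> n > 0 \<and> x \<in> roots (int n)}"

definition ideal_of :: "nat \<times> nat \<times> int \<Rightarrow> complex set" where
  "ideal_of = (\<lambda>(g, n, x). {emb (int g * (k * int n + v * x)) (int g * v) | k v. True})"

lemma ideal_of_lattice: "ideal_of (g, n, x) = lattice (of_nat g * of_nat n) (of_nat g * (of_int x + omega))"
proof -
  have "emb (int g * (k * int n + v * x)) (int g * v)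
    = of_int k * (of_nat g * of_nat n) + of_int v * (of_nat g * (of_int x + omega))" for k v
    by (simp add: emb_def algebra_simps)
  then show ?thesis by (simp add: ideal_of_def lattice_def)
qed

lemma ideal_norm_ideal_of:
  assumes "(g, n, x) \<in> triples" shows "ideal_norm (ideal_of (g, n, x)) = real (g\<^sup>2 * n)"
proof -
  have Im: "Im (cnj (of_nat g * of_nat n) * (of_nat g * (of_int x + omega))) = real (g\<^sup>2 * n) * sqrt (real p) / 2"
    by (simp add: power2_eq_square)
  have pos: "real (g\<^sup>2 * n) * sqrt (real p) / 2 > 0" using assms sqrt_p(1) by (simp add: triples_def)
  have "covolume (ideal_of (g, n, x)) = \<bar>Im (cnj (of_nat g * of_nat n) * (of_nat g * (of_int x + omega)))\<bar>"
    unfolding ideal_of_lattice by (rule covolume_lattice) (use pos in \<open>simp only: Im; simp\<close>)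
  then have cov: "covolume (ideal_of (g, n, x)) = real (g\<^sup>2 * n) * sqrt (real p) / 2" unfolding Im using pos by linarith
  show ?thesis unfolding ideal_norm_def cov using p_gt_2 by simp
qed

lemma ideal_of_ideal:
  assumes "(g, n, x) \<in> triples" shows "ideal_of (g, n, x) \<in> nonzero_ideals R"
proof -
  obtain c where c: "x\<^sup>2 + x + q = int n * c" using assms by (auto simp: triples_def roots_def)
  have q: "q = int n * c - x * x - x" using c by (simp add: power2_eq_square)
  have "ideal (ideal_of (g, n, x)) R"
    unfolding ideal_R_iff
  proof (intro conjI ballI)
    show "ideal_of (g, n, x) \<subseteq> OK" by (auto simp: ideal_of_def intro: OK_closed)
    have "0 = emb (int g * (0 * int n + 0 * x)) (int g * 0)" by (simp add: emb_def)
    then show "0 \<in> ideal_of (g, n, x)" unfolding ideal_of_def by blast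
  next
    fix y z assume "y \<in> ideal_of (g, n, x)" "z \<in> ideal_of (g, n, x)"
    then obtain k v k' v' where "y = emb (int g * (k * int n + v * x)) (int g * v)"
      "z = emb (int g * (k' * int n + v' * x)) (int g * v')" by (auto simp: ideal_of_def)
    then have "y + z = emb (int g * ((k + k') * int n + (v + v') * x)) (int g * (v + v'))"
      by (simp add: emb_add algebra_simps)
    then show "y + z \<in> ideal_of (g, n, x)" unfolding ideal_of_def by blast
  next
    fix y r assume "y \<in> ideal_of (g, n, x)" "r \<in> OK"
    then obtain k v a b where y: "y = emb (int g * (k * int n + v * x)) (int g * v)" and r: "r = emb a b"
      by (auto simp: ideal_of_def OK_def)
    \<comment> \<open>These are the coordinates of r y in the lattice basis; that k' is an integer
      rests on q = n c - x^2 - x.\<close>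
    define v' where "v' = a * v + b * (k * int n + v * x) + b * v"
    define k' where "k' = a * k - b * v * c - b * (k * x)"
    have "r * y = emb (int g * (k' * int n + v' * x)) (int g * v')"
      unfolding r y emb_mult emb_inject by (simp add: v'_def k'_def q algebra_simps)
    then show "r * y \<in> ideal_of (g, n, x)" unfolding ideal_of_def by blast
  qed
  moreover have "emb (int g * (1 * int n + 0 * x)) (int g * 0) \<in> ideal_of (g, n, x)" unfolding ideal_of_def by blast
  moreover have "emb (int g * (1 * int n + 0 * x)) (int g * 0) \<noteq> 0" using assms by (simp add: triples_def)
  ultimately have "ideal (ideal_of (g, n, x)) R" "ideal_of (g, n, x) \<noteq> {0}" by blast+
  then show ?thesis by (simp add: nonzero_ideals_def)
qed

lemma ideal_of_mem_iff:
  assumes "g > 0"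
  shows "emb a b \<in> ideal_of (g, n, x) \<longleftrightarrow> int g dvd b \<and> int g * int n dvd a - b * x"
proof
  assume "emb a b \<in> ideal_of (g, n, x)"
  then obtain k v where "a = int g * (k * int n + v * x)" "b = int g * v" by (auto simp: ideal_of_def)
  then have "b = int g * v" "a - b * x = (int g * int n) * k" by (auto simp: algebra_simps)
  then show "int g dvd b \<and> int g * int n dvd a - b * x" by (metis dvd_triv_left)
next
  assume "int g dvd b \<and> int g * int n dvd a - b * x"
  then obtain v k where "b = int g * v" "a - b * x = int g * int n * k" by (auto elim!: dvdE)
  then have "emb a b = emb (int g * (k * int n + v * x)) (int g * v)" by (simp add: algebra_simps)
  then show "emb a b \<in> ideal_of (g, n, x)" unfolding ideal_of_def by blast
qed

text \<open>The triple can be read off from the ideal: g generates the group of second coordinates,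
  g n generates the intersection with the integers, and x modulo n comes from the elements with
  second coordinate g.\<close>

lemma ideal_of_inj: "inj_on ideal_of triples"
proof (rule inj_onI)
  fix s t assume s: "s \<in> triples" and t: "t \<in> triples" and eq: "ideal_of s = ideal_of t"
  obtain g n x g' n' x' where s': "s = (g, n, x)" and t': "t = (g', n', x')" by (metis prod_cases3)
  have h: "g > 0" "n > 0" "0 \<le> x" "x < int n" "g' > 0" "n' > 0" "0 \<le> x'" "x' < int n'"
    using s t by (auto simp: s' t' triples_def roots_def)
  have mem: "int g dvd b \<and> int g * int n dvd a - b * x \<longleftrightarrow> int g' dvd b \<and> int g' * int n' dvd a - b * x'" for a b
    using ideal_of_mem_iff[OF h(1), of a b n x] ideal_of_mem_iff[OF h(5), of a b n' x'] eq by (simp add: s' t')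
  have "int g dvd int g'" using mem[of "int g'" "int g' * x'"] by simp
  moreover have "int g' dvd int g" using mem[of "int g" "int g * x"] by simp
  ultimately have g: "g = g'" by (simp add: dvd_antisym)
  have "int g * int n dvd int g * int n'" using mem[of 0 "int g' * int n'"] by (simp add: g)
  moreover have "int g' * int n' dvd int g' * int n" using mem[of 0 "int g * int n"] by (simp add: g)
  ultimately have n: "n = n'" using h by (simp add: g dvd_antisym)
  have "int g * int n dvd int g * (x - x')" using mem[of "int g" "int g * x"] by (simp add: g n right_diff_distrib)
  then have "int n dvd x - x'" using h by simp
  moreover have "\<bar>x - x'\<bar> < int n" using h n by auto
  ultimately have "x = x'" using dvd_imp_le_int[of "x - x'" "int n"] by fastforce
  then show "s = t" by (simp add: s' t' g n)
qed

lemma int_subgroup_generator: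
  fixes S :: "int set"
  assumes "0 \<in> S" "\<And>a b. a \<in> S \<Longrightarrow> b \<in> S \<Longrightarrow> a + b \<in> S" "\<And>a. a \<in> S \<Longrightarrow> - a \<in> S" "c \<in> S" "c \<noteq> 0"
  obtains g :: nat where "g > 0" "\<And>a. a \<in> S \<longleftrightarrow> int g dvd a"
proof -
  have "\<exists>k::nat. k > 0 \<and> int k \<in> S"
    using assms(3)[OF assms(4)] assms(4,5) by (intro exI[of _ "nat \<bar>c\<bar>"]) (cases "c \<ge> 0"; simp)
  define g where "g = (LEAST k::nat. k > 0 \<and> int k \<in> S)"
  have g: "g > 0" "int g \<in> S" using LeastI_ex[OF \<open>\<exists>k::nat. k > 0 \<and> int k \<in> S\<close>] by (auto simp: g_def)
  have mult: "int k * a \<in> S" if "a \<in> S" for a k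
    using that assms(1,2) by (induction k) (auto simp: algebra_simps)
  have mult': "k * a \<in> S" if "a \<in> S" for a k
    using mult[OF that, of "nat k"] assms(3)[OF mult[OF that, of "nat (- k)"]] by (cases "k \<ge> 0") auto
  have "a \<in> S \<longleftrightarrow> int g dvd a" for a
  proof
    assume a: "a \<in> S"
    have "a mod int g = a + (- (a div int g)) * int g" by (simp add: minus_mult_div_eq_mod[symmetric] mult.commute)
    then have r: "a mod int g \<in> S" using assms(2)[OF a mult'[OF g(2)]] by metis
    have "a mod int g = 0"
    proof (rule ccontr)
      assume "a mod int g \<noteq> 0"
      moreover have b: "0 \<le> a mod int g" "a mod int g < int g" using g(1) by simp_all
      ultimately have "nat (a mod int g) > 0 \<and> int (nat (a mod int g)) \<in> S" using r by simp
      then have "g \<le> nat (a mod int g)" unfolding g_def by (rule Least_le)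
      then show False using b by linarith
    qed
    then show "int g dvd a" by auto
  next
    assume "int g dvd a"
    then show "a \<in> S" using mult'[OF g(2)] by (auto elim!: dvdE simp: mult.commute)
  qed
  then show ?thesis using that g(1) by blast
qed

text \<open>A Hermite normal form of the ideal: S is the group of second coordinates, generated by
  g, and T its intersection with the integers, generated by d. Multiplication by \<omega> produces
  new second coordinates, which shows that g divides d and the first coordinate y belonging to
  g.\<close>

lemma ideal_of_surj:
  assumes "I \<in> nonzero_ideals R" shows "\<exists>s\<in>triples. I = ideal_of s"
proof -
  have "ideal I R" and nz: "I \<noteq> {0}" using assms by (auto simp: nonzero_ideals_def)
  then have sub: "I \<subseteq> OK" and I0: "0 \<in> I" and add: "\<And>x y. x \<in> I \<Longrightarrow> y \<in> I \<Longrightarrow> x + y \<in> I"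
    and mul: "\<And>x r. x \<in> I \<Longrightarrow> r \<in> OK \<Longrightarrow> r * x \<in> I" unfolding ideal_R_iff by auto
  have neg: "- x \<in> I" if "x \<in> I" for x using mul[OF that, of "- 1"] OK_closed(2)[OF OK_closed(5)] by simp
  obtain x0 where x0: "x0 \<in> I" "x0 \<noteq> 0" using nz I0 by blast
  then obtain a0 b0 where "x0 = emb a0 b0" using sub by (auto simp: OK_def)
  then have ab0: "emb a0 b0 \<in> I" "emb a0 b0 \<noteq> 0" using x0 by simp_all
  have omega: "emb 0 1 * emb a b = emb (- q * b) (a + b)" for a b by (simp add: emb_mult)
  have omega_mem: "emb (- q * b) (a + b) \<in> I" if "emb a b \<in> I" for a b
    using mul[OF that, of "emb 0 1"] OK_closed(7) unfolding omega by blast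
  define S where "S = {b. \<exists>a. emb a b \<in> I}"
  \<comment> \<open>A nonzero rational integer in the ideal, multiplied by \<omega>, gets a nonzero
    second coordinate.\<close>
  have "\<exists>c\<in>S. c \<noteq> 0"
  proof (cases "b0 = 0")
    case True
    have "a0 + b0 \<in> S" unfolding S_def using omega_mem[OF ab0(1)] by blast
    moreover have "a0 + b0 \<noteq> 0" using True ab0(2) by simp
    ultimately show ?thesis by blast
  qed (use ab0 in \<open>auto simp: S_def\<close>)
  then obtain c where c: "c \<in> S" "c \<noteq> 0" by blast
  have S0: "0 \<in> S" using I0 unfolding S_def by (metis (mono_tags) emb_0 mem_Collect_eq)
  have Sadd: "a + b \<in> S" if "a \<in> S" "b \<in> S" for a b
    using that add unfolding S_def by (auto simp: emb_add) (metis emb_add)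
  have Sneg: "- a \<in> S" if "a \<in> S" for a
    using that neg unfolding S_def by (auto simp: emb_minus) (metis emb_minus)
  obtain g where g: "g > 0" "\<And>a. a \<in> S \<longleftrightarrow> int g dvd a"
    using int_subgroup_generator[OF S0 Sadd Sneg c] by blast
  define T where "T = {a. emb a 0 \<in> I}"
  have T0: "0 \<in> T" using I0 by (simp add: T_def emb_0)
  have Tadd: "a + b \<in> T" if "a \<in> T" "b \<in> T" for a b
    using that add[of "emb a 0" "emb b 0"] by (simp add: T_def emb_add)
  have Tneg: "- a \<in> T" if "a \<in> T" for a using that neg[of "emb a 0"] by (simp add: T_def emb_minus)
  have "a0\<^sup>2 + a0 * b0 + q * b0\<^sup>2 \<in> T"
  proof -
    have "cnj (emb a0 b0) * emb a0 b0 = emb (a0\<^sup>2 + a0 * b0 + q * b0\<^sup>2) 0"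
      unfolding emb_cnj emb_mult by (simp add: power2_eq_square algebra_simps)
    then show ?thesis unfolding T_def using mul[OF ab0(1), of "cnj (emb a0 b0)"] OK_closed(7,8) by simp
  qed
  moreover have "a0\<^sup>2 + a0 * b0 + q * b0\<^sup>2 \<noteq> 0"
    using emb_norm[of a0 b0] ab0(2) by (metis norm_eq_zero of_int_0 zero_eq_power2)
  ultimately obtain d where d: "d > 0" "\<And>a. a \<in> T \<longleftrightarrow> int d dvd a"
    using int_subgroup_generator[OF T0 Tadd Tneg] by blast
  obtain y where y: "emb y (int g) \<in> I" using g(2)[of "int g"] by (auto simp: S_def)
  have "emb (- q * 0) (int d + 0) \<in> I" by (rule omega_mem) (use d(2)[of "int d"] in \<open>simp add: T_def\<close>)
  then have "int d \<in> S" by (auto simp: S_def)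
  then have "int g dvd int d" using g(2) by blast
  then obtain n where n: "d = g * n" by auto
  have "emb (- q * int g) (y + int g) \<in> I" by (rule omega_mem[OF y])
  then have "y + int g \<in> S" by (auto simp: S_def)
  then have "int g dvd y" using g(2) by (simp add: dvd_add_left_iff)
  then obtain x0 where x0: "y = int g * x0" by blast
  have "n > 0" using n d(1) by simp
  define x where "x = x0 mod int n"
  have x: "0 \<le> x" "x < int n" using \<open>n > 0\<close> by (auto simp: x_def)
  have gx: "emb (int g * x) (int g) \<in> I"
  proof -
    have "int g * x - y = - (x0 div int n) * int d" by (simp add: x_def x0 n minus_div_mult_eq_mod[symmetric] algebra_simps)
    then have "int g * x - y \<in> T" using d(2) by simp
    then have "emb (int g * x - y) 0 + emb y (int g) \<in> I" using y by (intro add) (auto simp: T_def)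
    then show ?thesis by (simp add: emb_add)
  qed
  have "int n dvd x\<^sup>2 + x + q"
  proof -
    \<comment> \<open>The multiplier x + 1 - \<omega> is the conjugate of x + \<omega>, so the
      product is g times a norm.\<close>
    have "emb (x + 1) (- 1) * emb (int g * x) (int g) = emb (int g * (x\<^sup>2 + x + q)) 0"
      unfolding emb_mult by (simp add: power2_eq_square algebra_simps)
    then have "int g * (x\<^sup>2 + x + q) \<in> T" unfolding T_def using mul[OF gx, of "emb (x + 1) (- 1)"] OK_closed(7) by simp
    then have "int g * int n dvd int g * (x\<^sup>2 + x + q)" using d(2) n by simp
    then show ?thesis using g(1) by simp
  qed
  then have tr: "(g, n, x) \<in> triples" using g(1) \<open>n > 0\<close> x by (simp add: triples_def roots_def)
  have "emb a b \<in> I \<longleftrightarrow> emb a b \<in> ideal_of (g, n, x)" for a b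
  proof -
    have "emb a b \<in> I \<longleftrightarrow> int g dvd b \<and> int g * int n dvd a - b * x"
    proof
      assume ab: "emb a b \<in> I"
      then have gb: "int g dvd b" using g(2) by (auto simp: S_def)
      then obtain v where v: "b = int g * v" by blast
      have "emb (- v) 0 * emb (int g * x) (int g) \<in> I" using mul[OF gx] OK_closed(7) by blast
      then have "emb a b + emb (- v) 0 * emb (int g * x) (int g) \<in> I" by (rule add[OF ab])
      then have "emb (a - b * x) 0 \<in> I" by (simp add: emb_mult emb_add v algebra_simps)
      then have "a - b * x \<in> T" by (simp add: T_def)
      then have "int g * int n dvd a - b * x" using d(2) n by simp
      then show "int g dvd b \<and> int g * int n dvd a - b * x" using gb by blast
    next
      assume h: "int g dvd b \<and> int g * int n dvd a - b * x"
      then obtain v where v: "b = int g * v" by blast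
      have "emb v 0 * emb (int g * x) (int g) \<in> I" using mul[OF gx] OK_closed(7) by blast
      moreover have "emb (a - b * x) 0 \<in> I" using h d(2) n by (simp add: T_def)
      ultimately have "emb (a - b * x) 0 + emb v 0 * emb (int g * x) (int g) \<in> I" by (intro add)
      then show "emb a b \<in> I" by (simp add: emb_mult emb_add v algebra_simps)
    qed
    then show ?thesis by (simp add: ideal_of_mem_iff[OF g(1)])
  qed
  moreover have "ideal_of (g, n, x) \<subseteq> OK" by (auto simp: ideal_of_def intro: OK_closed)
  ultimately have "I = ideal_of (g, n, x)" using sub by (auto simp: OK_def)
  then show ?thesis using tr by blast
qed

lemma ideal_of_bij: "bij_betw ideal_of triples (nonzero_ideals R)"
proof (rule bij_betw_imageI[OF ideal_of_inj])
  show "ideal_of ` triples = nonzero_ideals R"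
    using ideal_of_ideal ideal_of_surj by (auto simp: image_iff)
qed

lemma l_coset_R: "a <#\<^bsub>R\<^esub> I = (\<lambda>y. a * y) ` I"
  by (auto simp: l_coset_def)

lemma class_rel_iff:
  "(I, J) \<in> ideal_class_rel R \<longleftrightarrow> I \<in> nonzero_ideals R \<and> J \<in> nonzero_ideals R \<and>
     (\<exists>a b. a \<in> OK \<and> a \<noteq> 0 \<and> b \<in> OK \<and> b \<noteq> 0 \<and> (\<lambda>y. a * y) ` I = (\<lambda>y. b * y) ` J)"
  unfolding ideal_class_rel_def by (auto simp: l_coset_R)

lemma equiv_class_rel: "equiv (nonzero_ideals R) (ideal_class_rel R)"
proof (rule equivI)
  show "ideal_class_rel R \<subseteq> nonzero_ideals R \<times> nonzero_ideals R" by (auto simp: ideal_class_rel_def)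
  show "refl_on (nonzero_ideals R) (ideal_class_rel R)"
    by (rule refl_onI) (auto simp: class_rel_iff intro!: exI[of _ 1] OK_closed)
  show "sym (ideal_class_rel R)" by (rule symI) (auto simp: class_rel_iff, metis)
  show "trans (ideal_class_rel R)"
  proof (rule transI)
    fix I J L assume IJ: "(I, J) \<in> ideal_class_rel R" and JL: "(J, L) \<in> ideal_class_rel R"
    from IJ obtain a b where h1: "I \<in> nonzero_ideals R"
      "a \<in> OK" "a \<noteq> 0" "b \<in> OK" "b \<noteq> 0" "(\<lambda>y. a * y) ` I = (\<lambda>y. b * y) ` J"
      unfolding class_rel_iff by (elim conjE exE)
    from JL obtain c d where h2: "L \<in> nonzero_ideals R"
      "c \<in> OK" "c \<noteq> 0" "d \<in> OK" "d \<noteq> 0" "(\<lambda>y. c * y) ` J = (\<lambda>y. d * y) ` L"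
      unfolding class_rel_iff by (elim conjE exE)
    have "(\<lambda>y. (c * a) * y) ` I = (\<lambda>y. c * y) ` ((\<lambda>y. a * y) ` I)" by (simp add: image_image mult.assoc)
    also have "\<dots> = (\<lambda>y. b * y) ` ((\<lambda>y. c * y) ` J)" unfolding h1(6) by (simp add: image_image mult.left_commute)
    also have "\<dots> = (\<lambda>y. (b * d) * y) ` L" unfolding h2(6) by (simp add: image_image mult.assoc)
    finally show "(I, L) \<in> ideal_class_rel R"
      unfolding class_rel_iff using h1(1-5) h2(1-5)
      by (intro conjI exI[of _ "c * a"] exI[of _ "b * d"] OK_closed(3) no_zero_divisors)
  qed
qed

end

section \<open>The ideals in a class\<close>

locale ideal_class_param = prime_3_mod_4 +
  fixes n :: nat and x c :: int
  assumes p_gt_3: "p > 3" and n_pos: "n > 0" and x_range: "0 \<le> x" "x < int n"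
    and c: "x\<^sup>2 + x + q = int n * c"
begin

lemma triple: "(1, n, x) \<in> triples"
  using n_pos x_range c by (simp add: triples_def roots_def)

text \<open>As \<open>(v, k)\<close> runs through the nonzero pairs, \<open>mu v k\<close> runs through the conjugates of the elements
  of \<open>J\<close>, so the \<open>Phi v k\<close> are the ideals in the class of \<open>J\<close>, each obtained twice as the units are
  \<open>1\<close> and \<open>-1\<close>.\<close>

definition J :: "complex set" where "J = ideal_of (1, n, x)"
definition mu :: "int \<Rightarrow> int \<Rightarrow> complex" where "mu v k = emb (int n * k + v * (x + 1)) (- v)"
definition Phi :: "int \<Rightarrow> int \<Rightarrow> complex set" where "Phi v k = (\<lambda>y. mu v k / of_nat n * y) ` J"
text \<open>The norm of \<open>mu v k\<close> divided by n: the binary quadratic form of the class,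
  of discriminant (2x + 1)^2 - 4 n c = -p.\<close>

definition form :: "int \<Rightarrow> int \<Rightarrow> int" where "form v k = int n * k\<^sup>2 + (2 * x + 1) * k * v + c * v\<^sup>2"

lemma q_eq: "q = int n * c - x * x - x" using c by (simp add: power2_eq_square)

lemma J_lattice: "J = lattice (of_nat n) (of_int x + omega)"
  by (simp add: J_def ideal_of_lattice)

lemma J_mem: "y \<in> J \<longleftrightarrow> (\<exists>k v. y = emb (k * int n + v * x) v)"
  by (auto simp: J_def ideal_of_def)

lemma J_gen: "of_nat n \<in> J" "of_int x + omega \<in> J"
proof -
  have "of_nat n = emb (1 * int n + 0 * x) 0" "of_int x + omega = emb (0 * int n + 1 * x) 1" by (simp_all add: emb_def)
  then show "of_nat n \<in> J" "of_int x + omega \<in> J" unfolding J_mem by blast+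
qed

lemma J_ideal: "J \<in> nonzero_ideals R" unfolding J_def by (rule ideal_of_ideal[OF triple])

lemma lattice_scale: "(\<lambda>y. z * y) ` lattice \<alpha> \<beta> = lattice (z * \<alpha>) (z * \<beta>)"
proof -
  have "z * (of_int k * \<alpha> + of_int v * \<beta>) = of_int k * (z * \<alpha>) + of_int v * (z * \<beta>)" for k v
    by (simp add: algebra_simps)
  then show ?thesis unfolding lattice_def by (auto simp: image_iff) metis+
qed

lemma ideal_norm_scale:
  assumes "z \<noteq> 0" shows "ideal_norm ((\<lambda>y. z * y) ` J) = (cmod z)\<^sup>2 * real n"
proof -
  have "cnj (z * of_nat n) * (z * (of_int x + omega)) = of_nat n * (z * cnj z) * (of_int x + omega)" by (simp add: mult_ac)
  also have "z * cnj z = complex_of_real ((cmod z)\<^sup>2)" by (rule complex_norm_square[symmetric])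
  also have "Im (of_nat n * complex_of_real ((cmod z)\<^sup>2) * (of_int x + omega)) = (cmod z)\<^sup>2 * real n * sqrt (real p) / 2"
    by (simp del: of_real_power)
  finally have Im: "Im (cnj (z * of_nat n) * (z * (of_int x + omega))) = (cmod z)\<^sup>2 * real n * sqrt (real p) / 2" .
  have pos: "(cmod z)\<^sup>2 * real n * sqrt (real p) / 2 > 0" using assms n_pos sqrt_p(1) by simp
  have "covolume ((\<lambda>y. z * y) ` J) = \<bar>Im (cnj (z * of_nat n) * (z * (of_int x + omega)))\<bar>"
    unfolding J_lattice lattice_scale by (rule covolume_lattice) (use pos in \<open>simp only: Im; simp\<close>)
  then have cov: "covolume ((\<lambda>y. z * y) ` J) = (cmod z)\<^sup>2 * real n * sqrt (real p) / 2" unfolding Im using pos by linarith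
  show ?thesis unfolding ideal_norm_def cov using p_gt_2 by simp
qed

lemma mu_norm: "(cmod (mu v k))\<^sup>2 = of_int (int n * form v k)"
proof -
  have "(int n * k + v * (x + 1))\<^sup>2 + (int n * k + v * (x + 1)) * (- v) + q * (- v)\<^sup>2 = int n * form v k"
    unfolding q_eq form_def by (simp add: power2_eq_square algebra_simps)
  then show ?thesis unfolding mu_def emb_norm by simp
qed

lemma mu_eq_0_iff: "mu v k = 0 \<longleftrightarrow> v = 0 \<and> k = 0"
  using n_pos by (auto simp: mu_def)

lemma mu_inject: "mu v k = mu v' k' \<longleftrightarrow> v = v' \<and> k = k'"
  using n_pos by (auto simp: mu_def)

lemma mu_minus: "mu (- v) (- k) = - mu v k"
  by (simp add: mu_def emb_minus algebra_simps)

lemma Phi_norm: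
  assumes "(v, k) \<noteq> (0, 0)" shows "ideal_norm (Phi v k) = of_int (form v k)"
proof -
  have "mu v k / of_nat n \<noteq> 0" using assms n_pos by (simp add: mu_eq_0_iff)
  then have "ideal_norm (Phi v k) = (cmod (mu v k / of_nat n))\<^sup>2 * real n"
    unfolding Phi_def by (rule ideal_norm_scale)
  also have "\<dots> = (cmod (mu v k))\<^sup>2 / real n"
    using n_pos by (simp add: norm_divide power_divide power2_eq_square)
  also have "\<dots> = of_int (form v k)" unfolding mu_norm using n_pos by simp
  finally show ?thesis .
qed

text \<open>The conjugate of an element of \<open>J\<close> times an element of \<open>J\<close> is
  divisible by n; here the quotient is explicit for the second generator. It makes
  \<open>Phi v k\<close> integral.\<close>

lemma mu_times_J: "mu v k * (of_int x + omega) = of_nat n * emb (k * x + v * c) k"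
proof -
  have 1: "of_int x + omega = emb x 1" "of_nat n = emb (int n) 0" by (simp_all add: emb_def)
  show ?thesis unfolding mu_def 1 emb_mult emb_inject q_eq by (simp add: algebra_simps)
qed

lemma Phi_lattice: "Phi v k = lattice (mu v k) (emb (k * x + v * c) k)"
proof -
  have "mu v k / of_nat n * of_nat n = mu v k" using n_pos by simp
  moreover have "mu v k / of_nat n * (of_int x + omega) = emb (k * x + v * c) k"
    using mu_times_J[of v k] n_pos by (simp add: field_simps)
  ultimately show ?thesis unfolding Phi_def J_lattice lattice_scale by simp
qed

lemma Phi_ideal:
  assumes "(v, k) \<noteq> (0, 0)" shows "Phi v k \<in> nonzero_ideals R"
proof -
  let ?l = "mu v k / of_nat n"
  have J: "J \<subseteq> OK" "0 \<in> J" "\<And>y z. y \<in> J \<Longrightarrow> z \<in> J \<Longrightarrow> y + z \<in> J" "\<And>y r. y \<in> J \<Longrightarrow> r \<in> OK \<Longrightarrow> r * y \<in> J"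
    using J_ideal unfolding nonzero_ideals_def ideal_R_iff by auto
  have "mu v k \<in> OK" unfolding mu_def by (rule OK_closed)
  then have sub: "Phi v k \<subseteq> OK" unfolding Phi_lattice lattice_def by (auto intro!: OK_closed)
  have "ideal (Phi v k) R"
    unfolding ideal_R_iff
  proof (intro conjI ballI)
    show "0 \<in> Phi v k" unfolding Phi_def by (rule image_eqI[OF _ J(2)]) simp
    fix y assume "y \<in> Phi v k"
    then obtain y' where y': "y' \<in> J" "y = ?l * y'" by (auto simp: Phi_def)
    { fix z assume "z \<in> Phi v k"
      then obtain z' where z': "z' \<in> J" "z = ?l * z'" by (auto simp: Phi_def)
      show "y + z \<in> Phi v k" unfolding Phi_def y'(2) z'(2)
        by (rule image_eqI[OF _ J(3)[OF y'(1) z'(1)]]) (simp only: distrib_left)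
    next
      fix r assume "r \<in> OK"
      then show "r * y \<in> Phi v k" unfolding Phi_def y'(2)
        by (intro image_eqI[OF _ J(4)[OF y'(1)]]) (rule mult.left_commute)
    }
  qed (rule sub)
  moreover have "mu v k \<in> Phi v k" unfolding Phi_def
    by (rule image_eqI[OF _ J_gen(1)]) (use n_pos in simp)
  moreover have "mu v k \<noteq> 0" using assms by (simp add: mu_eq_0_iff)
  ultimately have "ideal (Phi v k) R" "Phi v k \<noteq> {0}" by blast+
  then show ?thesis by (simp add: nonzero_ideals_def)
qed

lemma Phi_class:
  assumes "(v, k) \<noteq> (0, 0)" shows "(J, Phi v k) \<in> ideal_class_rel R"
proof -
  have "(\<lambda>y. mu v k * y) ` J = (\<lambda>y. of_nat n * y) ` Phi v k"
    unfolding Phi_def image_image using n_pos by simp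
  moreover have "mu v k \<in> OK" "mu v k \<noteq> 0" "of_nat n \<in> OK" "of_nat n \<noteq> (0::complex)"
    using assms n_pos OK_closed(6)[of "int n"] by (auto simp: mu_def mu_eq_0_iff intro: OK_closed)
  ultimately show ?thesis using J_ideal Phi_ideal[OF assms] unfolding class_rel_iff by blast
qed

text \<open>Write I = l J and l n = s + t \<omega>. Integrality of l (x + \<omega>) yields s + t (x
  + 1) \<equiv> 0 modulo n, which says that l n is one of the numbers \<open>mu\<close>.\<close>

lemma Phi_surj:
  assumes "(J, I) \<in> ideal_class_rel R"
  shows "\<exists>v k. (v, k) \<noteq> (0, 0) \<and> I = Phi v k"
proof -
  obtain a b where ab: "a \<in> OK" "a \<noteq> 0" "b \<in> OK" "b \<noteq> 0" "(\<lambda>y. a * y) ` J = (\<lambda>y. b * y) ` I"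
    and I: "I \<in> nonzero_ideals R" using assms unfolding class_rel_iff by blast
  define l where "l = a / b"
  have l0: "l \<noteq> 0" using ab by (simp add: l_def)
  have "(\<lambda>y. l * y) ` J = (\<lambda>y. y / b) ` ((\<lambda>y. a * y) ` J)" by (simp add: image_image l_def)
  also have "\<dots> = I" unfolding ab(5) image_image using ab(4) by simp
  finally have Il: "I = (\<lambda>y. l * y) ` J" by simp
  have sub: "I \<subseteq> OK" using I unfolding nonzero_ideals_def ideal_R_iff by auto
  have "l * of_nat n \<in> OK" "l * (of_int x + omega) \<in> OK" using sub J_gen unfolding Il by auto
  then obtain s t s' t' where st: "l * of_nat n = emb s t" and st': "l * (of_int x + omega) = emb s' t'"
    unfolding OK_def by auto
  have 1: "of_int x + omega = emb x 1" "of_nat n = emb (int n) 0" by (simp_all add: emb_def)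
  have "emb s t * emb x 1 = emb (int n) 0 * emb s' t'"
    unfolding st[symmetric] st'[symmetric] 1[symmetric] by (simp add: mult_ac)
  then have "s + t * x + t = int n * t'" unfolding emb_mult emb_inject by simp
  then have "emb s t = mu (- t) t'" unfolding mu_def emb_inject by (simp add: algebra_simps)
  then have "l = mu (- t) t' / of_nat n" using st n_pos by (simp add: field_simps)
  moreover from this have "(- t, t') \<noteq> (0, 0)" using l0 by (auto simp: mu_eq_0_iff)
  ultimately show ?thesis unfolding Il Phi_def by blast
qed

text \<open>Comparing covolumes gives |z| = 1. In the basis of \<open>J\<close>, z acts by an
  integral matrix, and the discriminant relation shows that it lies in the ring of integers. Norm 1
  then means (2a + u)^2 + p u^2 = 4, and p > 4 leaves u = 0.\<close>

lemma unit_stabilizer: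
  assumes "z \<noteq> 0" "(\<lambda>y. z * y) ` J = J" shows "z = 1 \<or> z = -1"
proof -
  have norm: "(cmod z)\<^sup>2 = 1"
    using ideal_norm_scale[OF assms(1)] ideal_norm_scale[of 1] n_pos by (simp add: assms(2))
  have 1: "of_int x + omega = emb x 1" "of_nat n = emb (int n) 0" by (simp_all add: emb_def)
  obtain k w where kw: "z * of_nat n = emb (k * int n + w * x) w" using J_gen(1) assms(2) J_mem by blast
  obtain k2 w2 where kw2: "z * (of_int x + omega) = emb (k2 * int n + w2 * x) w2" using J_gen(2) assms(2) J_mem by blast
  have "emb (k * int n + w * x) w * emb x 1 = emb (int n) 0 * emb (k2 * int n + w2 * x) w2"
    unfolding kw[symmetric] kw2[symmetric] 1[symmetric] by (simp add: mult_ac)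
  then have e: "(k * int n + w * x) * x - q * w = int n * (k2 * int n + w2 * x)" "k * int n + w * x + w * x + w = int n * w2"
    unfolding emb_mult emb_inject by (simp_all add: algebra_simps)
  have e2: "w * (2 * x + 1) = int n * (w2 - k)" using e(2) by (simp add: algebra_simps)
  have "int n * (int n * k2) = (k * int n + w * x) * x - q * w - (int n * w2) * x" using e(1) by (simp add: algebra_simps)
  also have "\<dots> = int n * (- (w * c))" unfolding e(2)[symmetric] q_eq by (simp add: algebra_simps)
  finally have "int n * (w * c) = int n * (- int n * k2)" by (simp add: algebra_simps)
  then have e3: "w * c = - int n * k2" using n_pos by (simp only: mult_cancel_left) simp
  have disc: "P = 4 * int n * c - (2 * x + 1)\<^sup>2"
    using root_disc[of x] unfolding c by simp
  \<comment> \<open>Once the two linear relations are inserted, the right-hand side is divisible by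
    n^2; as p is prime, n divides w.\<close>
  have "P * w\<^sup>2 = 4 * int n * w * (w * c) - (w * (2 * x + 1))\<^sup>2"
    unfolding disc by (simp add: power2_eq_square algebra_simps)
  also have "\<dots> = (int n)\<^sup>2 * (- 4 * w * k2 - (w2 - k)\<^sup>2)"
    unfolding e2 e3 by (simp add: power2_eq_square algebra_simps)
  finally have "(int n)\<^sup>2 dvd P * w\<^sup>2" by simp
  then have "int n dvd w" by (rule prime_square_dvd[OF prime_P]) (use n_pos in simp)
  then obtain u where u: "w = int n * u" by blast
  have "emb (k * int n + w * x) w = emb (k + u * x) u * of_nat n" unfolding u 1 emb_mult by (simp add: algebra_simps)
  then have z: "z = emb (k + u * x) u" using kw n_pos by simp
  define a where "a = k + u * x"
  have "real_of_int (a\<^sup>2 + a * u + q * u\<^sup>2) = of_int 1" using norm unfolding z emb_norm a_def by simp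
  then have N: "a\<^sup>2 + a * u + q * u\<^sup>2 = 1" by (simp only: of_int_eq_iff)
  have N4: "(2 * a + u)\<^sup>2 + P * u\<^sup>2 = 4"
  proof -
    have "(2 * a + u)\<^sup>2 + P * u\<^sup>2 = 4 * a\<^sup>2 + 4 * a * u + (P + 1) * u\<^sup>2" by (simp add: power2_eq_square algebra_simps)
    also have "\<dots> = 4 * (a\<^sup>2 + a * u + q * u\<^sup>2)" unfolding four_q[symmetric] by (simp add: algebra_simps)
    finally show ?thesis using N by simp
  qed
  have "u = 0"
  proof (rule ccontr)
    assume "u \<noteq> 0"
    then have "1 \<le> u\<^sup>2" by (simp add: int_one_le_iff_zero_less)
    then have "P * 1 \<le> P * u\<^sup>2" by (intro mult_left_mono) auto
    moreover have "P > 4" using p_gt_3 p_mod_4 by presburger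
    moreover have "(2 * a + u)\<^sup>2 \<ge> 0" by simp
    ultimately show False using N4 by linarith
  qed
  then have "a\<^sup>2 = 1" "z = of_int a" using N by (simp_all add: z a_def emb_of_int)
  then show ?thesis by (auto simp: power2_eq_1_iff)
qed

lemma Phi_eq:
  assumes "(v, k) \<noteq> (0, 0)" "(v', k') \<noteq> (0, 0)" "Phi v k = Phi v' k'"
  shows "(v', k') = (v, k) \<or> (v', k') = (- v, - k)"
proof -
  define z where "z = mu v' k' / mu v k"
  have nz: "mu v k \<noteq> 0" "mu v' k' \<noteq> 0" using assms by (auto simp: mu_eq_0_iff)
  have "(\<lambda>y. of_nat n / mu v k * y) ` Phi v k = J" unfolding Phi_def image_image using nz n_pos by simp
  moreover have "(\<lambda>y. of_nat n / mu v k * y) ` Phi v' k' = (\<lambda>y. z * y) ` J"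
    unfolding Phi_def image_image z_def using nz n_pos by simp
  ultimately have "(\<lambda>y. z * y) ` J = J" using assms(3) by simp
  moreover have "z \<noteq> 0" using nz by (simp add: z_def)
  ultimately have "z = 1 \<or> z = -1" by (intro unit_stabilizer)
  then have "mu v' k' = mu v k \<or> mu v' k' = mu (- v) (- k)"
    using nz by (auto simp: z_def mu_minus field_simps)
  then show ?thesis by (simp add: mu_inject)
qed

definition half_plane :: "(int \<times> int) set" where "half_plane = {(v, k). v > 0 \<or> v = 0 \<and> k > 0}"

lemma Phi_minus: "Phi (- v) (- k) = Phi v k"
proof -
  have "ideal J R" using J_ideal by (simp add: nonzero_ideals_def)
  then have neg: "- y \<in> J" if "y \<in> J" for y
    using that OK_closed(2)[OF OK_closed(5)] unfolding ideal_R_iff by (metis mult_minus1)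
  have "Phi v k \<subseteq> Phi (- v) (- k)" for v k
  proof
    fix y assume "y \<in> Phi v k"
    then obtain z where "z \<in> J" "y = mu v k / of_nat n * z" by (auto simp: Phi_def)
    then have "y = mu (- v) (- k) / of_nat n * (- z)" "- z \<in> J" using neg by (auto simp: mu_minus)
    then show "y \<in> Phi (- v) (- k)" unfolding Phi_def by blast
  qed
  from this[of v k] this[of "- v" "- k"] show ?thesis by auto
qed

lemma Phi_bij: "bij_betw (\<lambda>(v, k). Phi v k) half_plane (ideal_class_rel R `` {J})"
proof (rule bij_betw_imageI)
  show "inj_on (\<lambda>(v, k). Phi v k) half_plane"
    by (rule inj_onI) (auto simp: half_plane_def dest!: Phi_eq[rotated 2])
  show "(\<lambda>(v, k). Phi v k) ` half_plane = ideal_class_rel R `` {J}"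
  proof (intro Set.equalityI subsetI)
    fix I assume "I \<in> (\<lambda>(v, k). Phi v k) ` half_plane"
    then show "I \<in> ideal_class_rel R `` {J}" using Phi_class by (auto simp: half_plane_def)
  next
    fix I assume "I \<in> ideal_class_rel R `` {J}"
    then obtain v k where vk: "(v, k) \<noteq> (0, 0)" "I = Phi v k" using Phi_surj by blast
    have "(v, k) \<in> half_plane \<or> (- v, - k) \<in> half_plane" using vk(1) by (auto simp: half_plane_def)
    then show "I \<in> (\<lambda>(v, k). Phi v k) ` half_plane"
      using vk(2) Phi_minus[of v k] by (auto intro: image_eqI[of _ _ "(v, k)"] image_eqI[of _ _ "(- v, - k)"])
  qed
qed

lemma has_sum_half_plane:
  fixes f :: "int \<times> int \<Rightarrow> real"
  assumes sum: "(f has_sum S) UNIV" and even: "\<And>v k. f (- v, - k) = f (v, k)"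
  shows "(f has_sum (S - f (0, 0)) / 2) half_plane"
proof -
  define s where "s = infsum f half_plane"
  have "f summable_on half_plane"
    by (rule summable_on_subset[OF has_sum_imp_summable[OF sum]]) simp
  then have s: "(f has_sum s) half_plane" by (simp add: s_def)
  let ?H' = "(\<lambda>(v, k). (- v, - k)) ` half_plane"
  have "(f has_sum s) ?H'"
  proof (subst has_sum_reindex)
    show "inj_on (\<lambda>(v, k). (- v, - k)) half_plane" by (auto simp: inj_on_def)
    have "f \<circ> (\<lambda>(v, k). (- v, - k)) = f" using even by (auto simp: fun_eq_iff)
    then show "(f \<circ> (\<lambda>(v, k). (- v, - k)) has_sum s) half_plane" using s by simp
  qed
  then have "(f has_sum (s + s)) (half_plane \<union> ?H')"
    by (intro has_sum_Un_disjoint s) (auto simp: half_plane_def)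
  then have "(f has_sum (s + s + f (0, 0))) ((half_plane \<union> ?H') \<union> {(0, 0)})"
    by (rule has_sum_Un_disjoint) (auto simp: half_plane_def intro: has_sum_finiteI)
  also have "(half_plane \<union> ?H') \<union> {(0, 0)} = UNIV"
  proof -
    have "y \<in> (half_plane \<union> ?H') \<union> {(0, 0)}" for y
    proof (cases y)
      case (Pair v k)
      have "(v, k) \<in> half_plane \<or> (- v, - k) \<in> half_plane \<or> (v, k) = (0, 0)" by (auto simp: half_plane_def)
      moreover have "(v, k) \<in> ?H'" if "(- v, - k) \<in> half_plane" using image_eqI[OF _ that, of "(v, k)" "\<lambda>(v, k). (- v, - k)"] by simp
      ultimately show ?thesis unfolding Pair by blast
    qed
    then show ?thesis by blast
  qed
  finally have "s + s + f (0, 0) = S" using sum has_sum_unique by blast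
  then have "s = (S - f (0, 0)) / 2" by simp
  then show ?thesis using s by (simp only:)
qed

text \<open>Half the sum over the values of the form, without the term 1 at (0, 0). That term
  changes the result by t / 2, at most sqrt t / 2 for t \<le> 1, whence the constant (C +
  1)/2.\<close>

lemma class_sum:
  "\<exists>B. \<forall>t. 0 < t \<and> t \<le> 1 \<longrightarrow> (\<exists>s. ((\<lambda>I. exp (- t * ideal_norm I)) has_sum s) (ideal_class_rel R `` {J}) \<and>
     \<bar>t * s - pi / sqrt (real p)\<bar> \<le> B * sqrt t)"
proof -
  have disc: "real p = 4 * real n * of_int c - (2 * of_int x + 1)\<^sup>2"
  proof -
    have "P = 4 * int n * c - (2 * x + 1)\<^sup>2" using root_disc[of x] unfolding c by simp
    then have "real_of_int P = of_int (4 * int n * c - (2 * x + 1)\<^sup>2)" by (rule arg_cong)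
    then show ?thesis by simp
  qed
  have "real p > 0" using p_gt_2 by simp
  from binary_form_theta_sum[OF _ disc this] obtain C where C: "\<And>t. 0 < t \<and> t \<le> 1 \<Longrightarrow> \<exists>S.
     ((\<lambda>(v, k). exp (- t * (real n * of_int k ^ 2 + (2 * of_int x + 1) * of_int k * of_int v + of_int c * of_int v ^ 2)))
        has_sum S) (UNIV :: (int \<times> int) set) \<and> \<bar>t * S - 2 * pi / sqrt (real p)\<bar> \<le> C * sqrt t"
    using n_pos by auto
  have "\<exists>s. ((\<lambda>I. exp (- t * ideal_norm I)) has_sum s) (ideal_class_rel R `` {J}) \<and>
     \<bar>t * s - pi / sqrt (real p)\<bar> \<le> ((C + 1) / 2) * sqrt t" if t: "0 < t \<and> t \<le> 1" for t
  proof -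
    define f :: "int \<times> int \<Rightarrow> real" where "f = (\<lambda>(v, k). exp (- t * of_int (form v k)))"
    obtain S where S: "(f has_sum S) UNIV" "\<bar>t * S - 2 * pi / sqrt (real p)\<bar> \<le> C * sqrt t"
      using C[OF t] by (auto simp: f_def form_def)
    have "(f has_sum (S - f (0, 0)) / 2) half_plane"
      by (rule has_sum_half_plane[OF S(1)]) (simp add: f_def form_def)
    also have "f (0, 0) = 1" by (simp add: f_def form_def)
    also have "(f has_sum (S - 1) / 2) half_plane
        \<longleftrightarrow> ((\<lambda>vk. exp (- t * ideal_norm ((\<lambda>(v, k). Phi v k) vk))) has_sum (S - 1) / 2) half_plane"
      by (rule has_sum_cong) (auto simp: f_def half_plane_def Phi_norm)
    also have "\<dots> \<longleftrightarrow> ((\<lambda>I. exp (- t * ideal_norm I)) has_sum (S - 1) / 2) (ideal_class_rel R `` {J})"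
      by (rule has_sum_reindex_bij_betw[OF Phi_bij])
    finally have s: "((\<lambda>I. exp (- t * ideal_norm I)) has_sum (S - 1) / 2) (ideal_class_rel R `` {J})" .
    have tri: "\<bar>y\<bar> \<le> b / 2 + r / 2" if "0 < t" "t \<le> r" "y = z / 2 - t / 2" "\<bar>z\<bar> \<le> b" for y z b r :: real
      using that by linarith
    have "t \<le> sqrt t" using t by (metis abs_of_pos power2_eq_square real_sqrt_abs real_sqrt_le_mono mult_left_le less_imp_le)
    moreover have "t * ((S - 1) / 2) - pi / sqrt (real p) = (t * S - 2 * pi / sqrt (real p)) / 2 - t / 2"
      by (simp add: field_simps)
    ultimately have "\<bar>t * ((S - 1) / 2) - pi / sqrt (real p)\<bar> \<le> C * sqrt t / 2 + sqrt t / 2"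
      using S(2) t by (intro tri) auto
    then show ?thesis using s by (intro exI[of _ "(S - 1) / 2"]) (simp add: field_simps)
  qed
  then show ?thesis by blast
qed

end

context prime_3_mod_4
begin

text \<open>The factor g of a representative is principal, so it may be divided out without leaving
  the class.\<close>

lemma class_sum_quotient:
  assumes p3: "p > 3" and C: "C \<in> nonzero_ideals R // ideal_class_rel R"
  shows "\<exists>B. \<forall>t. 0 < t \<and> t \<le> 1 \<longrightarrow> (\<exists>s. ((\<lambda>I. exp (- t * ideal_norm I)) has_sum s) C \<and>
     \<bar>t * s - pi / sqrt (real p)\<bar> \<le> B * sqrt t)"
proof -
  obtain I where I: "I \<in> nonzero_ideals R" "C = ideal_class_rel R `` {I}" using C by (elim quotientE)
  obtain g n x where gnx: "(g, n, x) \<in> triples" "I = ideal_of (g, n, x)" using ideal_of_surj[OF I(1)] by auto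
  then have h: "g > 0" "n > 0" "0 \<le> x" "x < int n" "int n dvd x\<^sup>2 + x + q" by (auto simp: triples_def roots_def)
  then obtain c where c: "x\<^sup>2 + x + q = int n * c" by blast
  interpret ideal_class_param p n x c by standard (use p3 h c in auto)
  have "I = (\<lambda>y. of_nat g * y) ` J"
    unfolding gnx(2) J_lattice ideal_of_lattice lattice_scale by (simp add: mult_ac)
  then have "(\<lambda>y. 1 * y) ` I = (\<lambda>y. of_nat g * y) ` J" by simp
  moreover have "of_nat g \<in> OK" "of_nat g \<noteq> (0::complex)" using OK_closed(6)[of "int g"] h(1) by auto
  ultimately have "(I, J) \<in> ideal_class_rel R"
    unfolding class_rel_iff using I(1) J_ideal OK_closed(5) by (metis zero_neq_one)
  then have "C = ideal_class_rel R `` {J}" unfolding I(2) using equiv_class_eq[OF equiv_class_rel] by blast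
  then show ?thesis using class_sum by simp
qed

section \<open>The sum over all ideals\<close>

definition triples_of_norm :: "nat \<Rightarrow> (nat \<times> nat \<times> int) set" where
  "triples_of_norm N = {(g, n, x). (g, n, x) \<in> triples \<and> g\<^sup>2 * n = N}"

lemma card_triples_of_norm:
  assumes "N > 0"
  shows "finite (triples_of_norm N)" "int (card (triples_of_norm N)) = ideal_count N"
proof -
  let ?S = "SIGMA g:{g. g\<^sup>2 dvd N}. roots (int (N div g\<^sup>2))"
  let ?f = "\<lambda>(g, x). (g, N div g\<^sup>2, x)"
  have fin: "finite {g. g\<^sup>2 dvd N}" by (rule finite_square_divisors[OF assms])
  have eq: "triples_of_norm N = ?f ` ?S"
  proof (intro Set.equalityI subsetI)
    fix s assume "s \<in> triples_of_norm N"
    then obtain g n x where s: "s = (g, n, x)" "g > 0" "n > 0" "x \<in> roots (int n)" "N = g\<^sup>2 * n"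
      by (auto simp: triples_of_norm_def triples_def)
    then have "N div g\<^sup>2 = n" "g\<^sup>2 dvd N" by auto
    then have "(g, x) \<in> ?S" "s = ?f (g, x)" using s by auto
    then show "s \<in> ?f ` ?S" by blast
  next
    fix s assume "s \<in> ?f ` ?S"
    then obtain g x where s: "s = (g, N div g\<^sup>2, x)" "g\<^sup>2 dvd N" "x \<in> roots (int (N div g\<^sup>2))" by auto
    have "g > 0" using s(2) assms by (auto intro: gr0I)
    moreover have "N div g\<^sup>2 > 0" using s(2) assms by (auto elim!: dvdE intro: gr0I)
    ultimately show "s \<in> triples_of_norm N" using s by (simp add: triples_of_norm_def triples_def)
  qed
  have inj: "inj_on ?f ?S" by (auto simp: inj_on_def)
  show "finite (triples_of_norm N)" unfolding eq by (intro finite_imageI finite_SigmaI fin finite_roots)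
  have "card (triples_of_norm N) = (\<Sum>g | g\<^sup>2 dvd N. card (roots (int (N div g\<^sup>2))))"
    unfolding eq card_image[OF inj] by (rule card_SigmaI[OF fin]) simp
  then show "int (card (triples_of_norm N)) = ideal_count N" by (simp add: ideal_count_def)
qed

lemma chi_double_summable:
  assumes "t > 0"
  shows "(\<lambda>(j::nat, d::nat). real_of_int (chi (int d)) * exp (- t * real j * real d)) summable_on ({1..} \<times> {1..})"
proof -
  have le: "\<bar>real_of_int (chi a)\<bar> \<le> 1" for a using chi_values[of a] by auto
  have "(\<lambda>x. norm (case x of (j::nat, d::nat) \<Rightarrow> real_of_int (chi (int d)) * exp (- t * real j * real d))) summable_on ({1..} \<times> {1..})"
    by (rule Infinite_Sum.abs_summable_on_comparison_test'[OF double_exp_summable[OF assms]])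
      (auto simp: abs_mult mult_left_le_one_le le)
  then show ?thesis by (rule abs_summable_summable)
qed

text \<open>Putting N = j d groups the double sum by N with coefficients \<open>chi_sum N\<close>.
  These count the triples of norm N, so the sum spreads out over triples and hence over ideals. Its
  terms are now nonnegative, and summability passes from the grouped sum to the sum over
  triples.\<close>

lemma ideals_sum:
  assumes t: "t > 0"
    and Z: "((\<lambda>(j::nat, d::nat). real_of_int (chi (int d)) * exp (- t * real j * real d)) has_sum Z) ({1..} \<times> {1..})"
  shows "((\<lambda>I. exp (- t * ideal_norm I)) has_sum Z) (nonzero_ideals R)"
proof -
  have "((\<lambda>(N::nat, d::nat). real_of_int (chi (int d)) * exp (- t * real N)) has_sum Z) (Sigma {1..} (\<lambda>N. {d. d dvd N}))"
  proof (subst has_sum_reindex_bij_witness[of _ "\<lambda>(j, d). (j * d, d)" "\<lambda>(N, d). (N div d, d)" "{1..} \<times> {1..}"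
        "\<lambda>(j, d). real_of_int (chi (int d)) * exp (- t * real j * real d)"])
    fix a :: "nat \<times> nat" assume "a \<in> Sigma {1..} (\<lambda>N. {d. d dvd N})"
    then obtain N d where a: "a = (N, d)" "N \<ge> 1" "d dvd N" by auto
    then obtain k where k: "N = d * k" by blast
    have pos: "d > 0" "k > 0" using a k by (auto intro: gr0I)
    show "(case case a of (N, d) \<Rightarrow> (N div d, d) of (j, d) \<Rightarrow> (j * d, d)) = a" using a by simp
    show "(case a of (N, d) \<Rightarrow> (N div d, d)) \<in> {1..} \<times> {1..}" using a(1) k pos by simp
    show "(case case a of (N, d) \<Rightarrow> (N div d, d) of (j, d) \<Rightarrow> real_of_int (chi (int d)) * exp (- t * real j * real d))
        = (case a of (N, d) \<Rightarrow> real_of_int (chi (int d)) * exp (- t * real N))"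
      using a(1) k pos by (simp add: mult_ac)
  qed (use Z in auto)
  then have base: "((\<lambda>N. real_of_int (chi_sum N) * exp (- t * real N)) has_sum Z) {1..}"
  proof (rule has_sum_Sigma')
    fix N :: nat assume "N \<in> {1..}"
    then have "finite {d. d dvd N}" by simp
    then show "((\<lambda>d. case (N, d) of (N, d) \<Rightarrow> real_of_int (chi (int d)) * exp (- t * real N)) has_sum
        real_of_int (chi_sum N) * exp (- t * real N)) {d. d dvd N}"
      by (intro has_sum_finiteI) (simp_all add: chi_sum_def sum_distrib_right)
  qed
  have inner: "((\<lambda>s. case (N, s) of (N, s) \<Rightarrow> exp (- t * real N)) has_sum
      real_of_int (chi_sum N) * exp (- t * real N)) (triples_of_norm N)" if "N \<in> {1..}" for N
  proof -
    have N: "N > 0" using that by simp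
    have "real (card (triples_of_norm N)) = real_of_int (chi_sum N)"
      using card_triples_of_norm(2)[OF N] ideal_count_eq_chi_sum[OF N] by (metis of_int_of_nat_eq)
    then show ?thesis by (intro has_sum_finiteI card_triples_of_norm(1)[OF N]) simp
  qed
  have summ: "(\<lambda>(N, s). exp (- t * real N)) summable_on (Sigma {1..} triples_of_norm)"
    using inner has_sum_imp_summable[OF base] by (rule summable_on_SigmaI) auto
  have "((\<lambda>(N, s). exp (- t * real N)) has_sum Z) (Sigma {1..} triples_of_norm)"
    by (rule has_sum_SigmaI[OF _ base summ]) (rule inner)
  then have "((\<lambda>s. exp (- t * ideal_norm (ideal_of s))) has_sum Z) triples"
  proof (subst has_sum_reindex_bij_witness[of _ snd "\<lambda>(g, n, x). (g\<^sup>2 * n, (g, n, x))" "Sigma {1..} triples_of_norm"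
        "\<lambda>(N, s). exp (- t * real N)"])
    fix s :: "nat \<times> nat \<times> int" assume s: "s \<in> triples"
    obtain g n x where gnx: "s = (g, n, x)" by (metis prod_cases3)
    show "(case s of (g, n, x) \<Rightarrow> (g\<^sup>2 * n, (g, n, x))) \<in> Sigma {1..} triples_of_norm"
      using s by (auto simp: gnx triples_of_norm_def triples_def Suc_le_eq)
    show "(case case s of (g, n, x) \<Rightarrow> (g\<^sup>2 * n, (g, n, x)) of (N, s) \<Rightarrow> exp (- t * real N)) = exp (- t * ideal_norm (ideal_of s))"
      using ideal_norm_ideal_of[of g n x] s by (simp add: gnx)
  qed (auto simp: triples_of_norm_def)
  then show ?thesis by (subst has_sum_reindex_bij_betw[OF ideal_of_bij, symmetric])
qed

section \<open>The sign of the quadratic Gauss sum\<close>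

definition cis_p :: "int \<Rightarrow> complex" where "cis_p k = cis (2 * pi * of_int k / of_nat p)"

lemma cis_p_add: "cis_p (a + b) = cis_p a * cis_p b"
  by (simp add: cis_p_def cis_mult add_divide_distrib distrib_left)

lemma cis_p_0 [simp]: "cis_p 0 = 1" by (simp add: cis_p_def)
lemma cis_p_minus: "cis_p (- a) = cnj (cis_p a)" by (simp add: cis_p_def cis_cnj)
lemma cis_p_diff: "cis_p (a - b) = cis_p a * cnj (cis_p b)" using cis_p_add[of a "- b"] by (simp add: cis_p_minus)
lemma cis_p_norm [simp]: "cmod (cis_p a) = 1" by (simp add: cis_p_def)
lemma cis_p_nonzero [simp]: "cis_p a \<noteq> 0" using cis_p_norm[of a] by (metis norm_zero zero_neq_one)
lemma cis_p_inverse: "cis_p a * cnj (cis_p a) = 1" using cis_p_diff[of a a] by simp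
lemma cis_p_mult_nat: "cis_p (a * int k) = cis_p a ^ k"
  by (induction k) (auto simp: distrib_left cis_p_add)

lemma cis_p_sum: "finite A \<Longrightarrow> cis_p (\<Sum>x\<in>A. f x) = (\<Prod>x\<in>A. cis_p (f x))"
  by (induction A rule: finite_induct) (auto simp: cis_p_add)

lemma cis_p_P: "cis_p (P * k) = 1"
proof -
  have "2 * pi * of_int (P * k) / of_nat p = 2 * pi * real_of_int k" using p_gt_2 by simp
  then show ?thesis unfolding cis_p_def by (simp only: cis_multiple_2pi Ints_of_int)
qed

lemma cis_p_mod: "cis_p (a mod P) = cis_p a"
proof -
  have "cis_p a = cis_p (a mod P + P * (a div P))" by (simp add: mult.commute)
  then show ?thesis unfolding cis_p_add cis_p_P by simp
qed

lemma cis_p_cong: "[a = b] (mod P) \<Longrightarrow> cis_p a = cis_p b"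
  by (metis cong_iff_mod_eq cis_p_mod)

lemma cis_p_eq_1_iff: "cis_p a = 1 \<longleftrightarrow> P dvd a"
proof
  assume "cis_p a = 1"
  then have "cos (2 * pi * of_int a / of_nat p) = 1" by (simp add: cis_p_def complex_eq_iff)
  then obtain k where "2 * pi * of_int a / of_nat p = of_int k * 2 * pi" using cos_one_2pi_int by blast
  then have "real_of_int a = of_int (P * k)" using p_gt_2 by (simp add: field_simps)
  then have "a = P * k" by (simp only: of_int_eq_iff)
  then show "P dvd a" by simp
qed (auto simp: cis_p_P)

lemma sum_cis_p: "(\<Sum>k\<in>{0..<P}. cis_p (k * r)) = (if P dvd r then of_nat p else 0)"
proof -
  have "(\<Sum>k\<in>{0..<P}. cis_p (k * r)) = (\<Sum>k<p. cis_p (r * int k))"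
    by (rule sum.reindex_bij_witness[of _ int nat]) (auto simp: mult.commute)
  also have "\<dots> = (\<Sum>k<p. cis_p r ^ k)" by (simp add: cis_p_mult_nat)
  also have "\<dots> = (if P dvd r then of_nat p else 0)"
  proof (cases "P dvd r")
    case True
    then show ?thesis using cis_p_eq_1_iff[of r] by simp
  next
    case False
    then have "cis_p r \<noteq> 1" using cis_p_eq_1_iff by simp
    moreover have "cis_p r ^ p = 1" using cis_p_P[of r] by (simp add: cis_p_mult_nat[symmetric] mult.commute)
    ultimately show ?thesis using False by (simp add: geometric_sum)
  qed
  finally show ?thesis .
qed

definition gauss_sum :: complex where "gauss_sum = (\<Sum>a\<in>{0..<P}. of_int (chi a) * cis_p a)"

lemma gauss_sum_twist: "(\<Sum>a\<in>{0..<P}. of_int (chi a) * cis_p (a * d)) = of_int (chi d) * gauss_sum"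
proof (cases "P dvd d")
  case True
  then have "cis_p (a * d) = 1" for a by (simp add: cis_p_eq_1_iff)
  moreover have "(\<Sum>a\<in>{0..<P}. of_int (chi a)) = (of_int (\<Sum>a\<in>{0..<P}. chi a) :: complex)" by simp
  ultimately show ?thesis using True sum_chi(2) chi_eq_0_iff[of d] by simp
next
  case False
  have "of_int (chi d) * gauss_sum = (\<Sum>a\<in>{0..<P}. of_int (chi d) * (of_int (chi ((a * d) mod P)) * cis_p ((a * d) mod P)))"
    unfolding gauss_sum_def sum_distrib_left by (rule sum.reindex_bij_betw[OF bij_mult(1)[OF False], symmetric])
  also have "\<dots> = (\<Sum>a\<in>{0..<P}. of_int (chi a) * cis_p (a * d))"
  proof (rule sum.cong)
    fix a
    have "chi d * chi (a * d) = chi a" using chi_square[OF False] by (simp add: chi_mult mult_ac)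
    then have "(of_int (chi d) * of_int (chi (a * d)) :: complex) = of_int (chi a)" by (metis of_int_mult)
    then show "of_int (chi d) * (of_int (chi ((a * d) mod P)) * cis_p ((a * d) mod P)) = of_int (chi a) * cis_p (a * d)"
      by (simp add: cis_p_mod mult.assoc[symmetric])
  qed simp
  finally show ?thesis by simp
qed

definition G :: real where "G = Im gauss_sum"

lemma gauss_sum_eq: "gauss_sum = \<i> * complex_of_real G"
proof -
  have "cnj gauss_sum = (\<Sum>a\<in>{0..<P}. of_int (chi a) * cis_p (a * (- 1)))"
    unfolding gauss_sum_def by (simp add: cis_p_minus)
  also have "\<dots> = - gauss_sum" unfolding gauss_sum_twist chi_m1 by simp
  finally have "Re gauss_sum = - Re gauss_sum" by (metis complex_cnj(1) cnj.simps(1) uminus_complex.simps(1))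
  then show ?thesis by (simp add: G_def complex_eq_iff)
qed

lemma sine_sum: "(\<Sum>a\<in>{0..<P}. of_int (chi a) * sin (2 * pi * of_int a / of_nat p * of_int d)) = of_int (chi d) * G"
proof -
  have "Im (\<Sum>a\<in>{0..<P}. of_int (chi a) * cis_p (a * d)) = of_int (chi d) * G"
    unfolding gauss_sum_twist gauss_sum_eq by simp
  then show ?thesis by (simp add: cis_p_def mult.assoc)
qed

text \<open>Sum the absolute squares of the twisted Gauss sums over d. Each d prime to p contributes
  the absolute square of the Gauss sum, p - 1 times in all, while orthogonality of the characters
  gives p (p - 1). The Gauss sum is purely imaginary, hence the minus sign.\<close>

lemma gauss_sum_square: "gauss_sum * gauss_sum = - of_nat p"
proof -
  have 1: "of_int (chi d) * of_int (chi d) * (gauss_sum * cnj gauss_sum)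
      = (\<Sum>a\<in>{0..<P}. \<Sum>b\<in>{0..<P}. of_int (chi a * chi b) * cis_p (d * (a - b)))" for d
  proof -
    have "of_int (chi d) * of_int (chi d) * (gauss_sum * cnj gauss_sum)
      = (of_int (chi d) * gauss_sum) * cnj (of_int (chi d) * gauss_sum)" by simp
    also have "\<dots> = (\<Sum>a\<in>{0..<P}. of_int (chi a) * cis_p (a * d)) * (\<Sum>b\<in>{0..<P}. of_int (chi b) * cnj (cis_p (b * d)))"
      unfolding gauss_sum_twist[symmetric] by simp
    also have "\<dots> = (\<Sum>a\<in>{0..<P}. \<Sum>b\<in>{0..<P}. of_int (chi a * chi b) * cis_p (d * (a - b)))"
      unfolding sum_product by (intro sum.cong refl) (simp add: right_diff_distrib cis_p_diff mult_ac)
    finally show ?thesis .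
  qed
  have sq: "(\<Sum>d\<in>{0..<P}. chi d * chi d) = int (p - 1)"
  proof -
    have "{0..<P} = insert 0 {1..<P}" using p_gt_2 by auto
    then have "(\<Sum>d\<in>{0..<P}. chi d * chi d) = (\<Sum>d\<in>{1..<P}. chi d * chi d)" by simp
    also have "\<dots> = (\<Sum>d\<in>{1..<P}. 1)"
    proof (rule sum.cong)
      fix d assume "d \<in> {1..<P}"
      then have "\<not> P dvd d" by (intro not_P_dvd_range) auto
      then show "chi d * chi d = 1" by (rule chi_square)
    qed simp
    finally show ?thesis using p_gt_2 by simp
  qed
  have "of_int (\<Sum>d\<in>{0..<P}. chi d * chi d) * (gauss_sum * cnj gauss_sum)
      = (\<Sum>d\<in>{0..<P}. \<Sum>a\<in>{0..<P}. \<Sum>b\<in>{0..<P}. of_int (chi a * chi b) * cis_p (d * (a - b)))"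
    unfolding 1[symmetric] by (simp add: sum_distrib_right)
  also have "\<dots> = (\<Sum>a\<in>{0..<P}. \<Sum>b\<in>{0..<P}. \<Sum>d\<in>{0..<P}. of_int (chi a * chi b) * cis_p (d * (a - b)))"
  proof -
    have "(\<Sum>d\<in>{0..<P}. \<Sum>a\<in>{0..<P}. \<Sum>b\<in>{0..<P}. of_int (chi a * chi b) * cis_p (d * (a - b)))
      = (\<Sum>a\<in>{0..<P}. \<Sum>d\<in>{0..<P}. \<Sum>b\<in>{0..<P}. of_int (chi a * chi b) * cis_p (d * (a - b)))" by (rule sum.swap)
    also have "\<dots> = (\<Sum>a\<in>{0..<P}. \<Sum>b\<in>{0..<P}. \<Sum>d\<in>{0..<P}. of_int (chi a * chi b) * cis_p (d * (a - b)))"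
      by (rule sum.cong[OF refl], rule sum.swap)
    finally show ?thesis .
  qed
  also have "\<dots> = (\<Sum>a\<in>{0..<P}. \<Sum>b\<in>{0..<P}. of_int (chi a * chi b) * (if a = b then of_nat p else 0))"
  proof (intro sum.cong refl)
    fix a b assume ab: "a \<in> {0..<P}" "b \<in> {0..<P}"
    have "P dvd a - b \<longleftrightarrow> a = b"
      using ab dvd_imp_le_int[of "a - b" P] by fastforce
    then show "(\<Sum>d\<in>{0..<P}. of_int (chi a * chi b) * cis_p (d * (a - b))) = of_int (chi a * chi b) * (if a = b then of_nat p else 0)"
      unfolding sum_distrib_left[symmetric] sum_cis_p by simp
  qed
  also have "\<dots> = of_int (\<Sum>a\<in>{0..<P}. chi a * chi a) * of_nat p"
    by (simp add: sum_distrib_right if_distrib[of "\<lambda>x. _ * x"] cong: if_cong)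
  finally have "of_nat (p - 1) * (gauss_sum * cnj gauss_sum) = of_nat (p - 1) * of_nat p"
    unfolding sq of_int_of_nat_eq .
  moreover have "of_nat (p - 1) \<noteq> (0::complex)" using p_gt_2 by (simp only: of_nat_eq_0_iff; simp)
  ultimately have "gauss_sum * cnj gauss_sum = of_nat p" by (simp only: mult_cancel_left; auto)
  moreover have "cnj gauss_sum = - gauss_sum" unfolding gauss_sum_eq by simp
  ultimately show ?thesis by (metis minus_minus mult_minus_right)
qed

lemma G_square: "G * G = real p"
proof -
  have "complex_of_real (G * G) = complex_of_real (real p)"
    using gauss_sum_square unfolding gauss_sum_eq by (simp add: algebra_simps)
  then show ?thesis by (simp only: of_real_eq_iff)
qed

text \<open>The sign of \<open>G\<close> is read off from the product \<open>Q\<close>, which is a rational integer multiple \<open>c\<close> of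
  the Gauss sum: \<open>c\<^sup>2 = 1\<close> because \<open>Q\<^sup>2 = -p\<close>, and \<open>c\<close> modulo \<open>p\<close> is a coefficient of the
  power series obtained from \<open>Q\<close> by replacing \<open>exp (2\<pi>i/p)\<close> with \<open>exp x\<close>.\<close>

definition Q :: "int \<Rightarrow> complex" where "Q d = (\<Prod>r\<in>quad_res. cis_p (r * d) - cis_p (- r * d))"

lemma quad_res_bij:
  assumes "chi d = 1" shows "bij_betw (\<lambda>r. (r * d) mod P) quad_res quad_res"
proof -
  have nd: "\<not> P dvd d" using assms chi_eq_0_iff[of d] by auto
  have res: "quad_res = {r \<in> {1..<P}. chi r = 1}" by (auto simp: quad_res_def)
  show ?thesis unfolding res
    by (rule bij_betw_Collect[OF bij_mult(2)[OF nd]]) (simp add: chi_mult assms)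
qed

text \<open>A residue d only permutes the factors of \<open>Q\<close>; -1 changes the sign of all m
  of them, and m is odd.\<close>

lemma Q_twist: "Q d = of_int (chi d) * Q 1"
proof -
  have res: "Q (e * d) = Q e" if "chi d = 1" for d e
  proof -
    have "Q e = (\<Prod>r\<in>quad_res. cis_p (((r * d) mod P) * e) - cis_p (- ((r * d) mod P) * e))"
      unfolding Q_def by (rule prod.reindex_bij_betw[OF quad_res_bij[OF that], symmetric])
    also have "\<dots> = Q (e * d)" unfolding Q_def
    proof (intro prod.cong refl arg_cong2[of _ _ _ _ minus])
      fix r
      have c: "[(r * d) mod P = r * d] (mod P)" by simp
      show "cis_p (((r * d) mod P) * e) = cis_p (r * (e * d))"
        using cis_p_cong[OF cong_scalar_right[OF c, of e]] by (simp add: mult_ac)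
      have "[- ((r * d) mod P) = - (r * d)] (mod P)" using c by (simp only: cong_minus_minus_iff)
      then show "cis_p (- ((r * d) mod P) * e) = cis_p (- r * (e * d))"
        using cis_p_cong[OF cong_scalar_right[of "- ((r * d) mod P)" "- (r * d)" P e]] by (simp add: mult_ac)
    qed
    finally show ?thesis by simp
  qed
  have neg: "Q (- d) = - Q d" for d
  proof -
    have "Q (- d) = (\<Prod>r\<in>quad_res. - (cis_p (r * d) - cis_p (- r * d)))" unfolding Q_def by simp
    also have "\<dots> = (- 1) ^ card quad_res * Q d" unfolding Q_def by (rule prod_uminus)
    finally show ?thesis using odd_m by (simp add: card_quad_res)
  qed
  consider "chi d = 1" | "chi d = -1" | "chi d = 0" using chi_values by blast
  then show ?thesis
  proof cases
    case 1
    then show ?thesis using res[of d 1] by simp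
  next
    case 2
    then have "Q (1 * - d) = Q 1" by (intro res) simp
    then have "Q d = - Q 1" using neg[of d] by (metis minus_minus mult_1)
    then show ?thesis using 2 by simp
  next
    case 3
    then have "P dvd d" by (simp add: chi_eq_0_iff)
    then have "cis_p (r * d) - cis_p (- r * d) = 0" for r using cis_p_eq_1_iff[of "r * d"] cis_p_eq_1_iff[of "- r * d"] by simp
    moreover have "card quad_res > 0" using card_quad_res m_pos by simp
    then have "quad_res \<noteq> {}" by auto
    ultimately show ?thesis using 3 unfolding Q_def by (auto simp: prod_zero_iff)
  qed
qed

text \<open>The exponent of the term in the expansion of the product in which exactly the factors
  indexed by X contribute their second summand.\<close>

definition signed_sum :: "int set \<Rightarrow> int" where "signed_sum X = (\<Sum>r\<in>quad_res - X. r) - (\<Sum>r\<in>X. r)"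

text \<open>Stated for an arbitrary exponential in a commutative ring, since the same expansion
  serves for roots of unity and for formal exponential series.\<close>

lemma prod_exponential:
  fixes f :: "int \<Rightarrow> 'a :: comm_ring_1"
  assumes "\<And>a b. f (a + b) = f a * f b" "f 0 = 1"
  shows "(\<Prod>r\<in>quad_res. f r - f (- r)) = (\<Sum>X\<in>Pow quad_res. (-1) ^ card X * f (signed_sum X))"
proof -
  have fsum: "f (\<Sum>x\<in>A. g x) = (\<Prod>x\<in>A. f (g x))" if "finite A" for A and g :: "int \<Rightarrow> int"
    using that by (induction A rule: finite_induct) (auto simp: assms)
  have "(\<Prod>r\<in>quad_res. f r - f (- r)) = (\<Sum>X\<in>Pow quad_res. (-1) ^ card X * (\<Prod>r\<in>X. f (- r)) * (\<Prod>r\<in>quad_res - X. f r))"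
    by (rule prod_diff_conv_sum) simp
  also have "\<dots> = (\<Sum>X\<in>Pow quad_res. (-1) ^ card X * f (signed_sum X))"
  proof (rule sum.cong)
    fix X assume "X \<in> Pow quad_res"
    then have "finite X" by (auto intro: finite_subset)
    have "f (signed_sum X) = f ((\<Sum>r\<in>X. - r) + (\<Sum>r\<in>quad_res - X. r))" by (simp add: signed_sum_def sum_negf)
    also have "\<dots> = (\<Prod>r\<in>X. f (- r)) * (\<Prod>r\<in>quad_res - X. f r)"
      using \<open>finite X\<close> by (simp add: assms(1) fsum)
    finally show "(-1) ^ card X * (\<Prod>r\<in>X. f (- r)) * (\<Prod>r\<in>quad_res - X. f r) = (-1) ^ card X * f (signed_sum X)"
      by (simp add: mult.assoc)
  qed simp
  finally show ?thesis .
qed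

text \<open>The coefficient of \<open>cis_p r\<close> when the expansion of \<open>Q 1\<close> is
  grouped by exponents modulo p.\<close>

definition Q_coeff :: "int \<Rightarrow> int" where "Q_coeff r = (\<Sum>X\<in>{X \<in> Pow quad_res. signed_sum X mod P = r}. (-1) ^ card X)"

text \<open>Fourier inversion modulo p: the transform of d \<mapsto> Q d isolates one class of
  exponents, and by \<open>Q_twist\<close> it is also \<open>Q 1\<close> times the transform of
  \<open>chi\<close>, a twisted Gauss sum.\<close>

lemma Q_coeff_eq: "r \<in> {0..<P} \<Longrightarrow> of_nat p * of_int (Q_coeff r) = - (of_int (chi r) * Q 1 * gauss_sum)"
proof -
  assume r: "r \<in> {0..<P}"
  have Qd: "Q d = (\<Sum>X\<in>Pow quad_res. (-1) ^ card X * cis_p (signed_sum X * d))" for d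
  proof -
    have "Q d = (\<Prod>r\<in>quad_res. cis_p (r * d) - cis_p (- r * d))" by (simp add: Q_def)
    also have "\<dots> = (\<Sum>X\<in>Pow quad_res. (-1) ^ card X * cis_p (signed_sum X * d))"
      by (rule prod_exponential[of "\<lambda>r. cis_p (r * d)"]) (auto simp: distrib_right cis_p_add)
    finally show ?thesis .
  qed
  have "(\<Sum>d\<in>{0..<P}. Q d * cis_p (d * (- r))) = (\<Sum>d\<in>{0..<P}. Q 1 * (of_int (chi d) * cis_p (d * (- r))))"
    by (intro sum.cong refl) (subst Q_twist, simp add: mult_ac)
  also have "\<dots> = Q 1 * (of_int (chi (- r)) * gauss_sum)"
    unfolding sum_distrib_left[symmetric] gauss_sum_twist ..
  finally have 1: "(\<Sum>d\<in>{0..<P}. Q d * cis_p (d * (- r))) = - (of_int (chi r) * Q 1 * gauss_sum)" by simp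
  have "(\<Sum>d\<in>{0..<P}. Q d * cis_p (d * (- r)))
      = (\<Sum>d\<in>{0..<P}. \<Sum>X\<in>Pow quad_res. (-1) ^ card X * cis_p (d * (signed_sum X - r)))"
    unfolding Qd sum_distrib_right
    by (intro sum.cong refl) (simp add: right_diff_distrib cis_p_diff cis_p_minus mult_ac)
  also have "\<dots> = (\<Sum>X\<in>Pow quad_res. (-1) ^ card X * (\<Sum>d\<in>{0..<P}. cis_p (d * (signed_sum X - r))))"
    unfolding sum_distrib_left by (rule sum.swap)
  also have "\<dots> = (\<Sum>X\<in>Pow quad_res. if signed_sum X mod P = r then of_nat p * (-1) ^ card X else 0)"
  proof (rule sum.cong)
    fix X
    have "P dvd signed_sum X - r \<longleftrightarrow> signed_sum X mod P = r mod P" by (metis mod_eq_dvd_iff)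
    then have "P dvd signed_sum X - r \<longleftrightarrow> signed_sum X mod P = r" using r by simp
    then show "(-1) ^ card X * (\<Sum>d\<in>{0..<P}. cis_p (d * (signed_sum X - r))) = (if signed_sum X mod P = r then of_nat p * (-1) ^ card X else 0)"
      unfolding sum_cis_p by simp
  qed simp
  also have "\<dots> = (\<Sum>X\<in>{X \<in> Pow quad_res. signed_sum X mod P = r}. of_nat p * (-1) ^ card X)"
    by (rule sum.inter_filter[symmetric]) simp
  also have "\<dots> = of_nat p * of_int (Q_coeff r)" unfolding Q_coeff_def by (simp add: sum_distrib_left)
  finally show ?thesis using 1 by simp
qed

lemma Q_coeff_chi: "r \<in> {0..<P} \<Longrightarrow> Q_coeff r = chi r * Q_coeff 1"
proof -
  assume r: "r \<in> {0..<P}"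
  have "of_nat p * of_int (Q_coeff 1) = - (Q 1 * gauss_sum)" using Q_coeff_eq[of 1] p_gt_2 by simp
  then have "of_int (chi r) * (of_nat p * of_int (Q_coeff 1)) = of_int (chi r) * (- (Q 1 * gauss_sum))" by (rule arg_cong)
  also have "\<dots> = of_nat p * of_int (Q_coeff r)" using Q_coeff_eq[OF r] by (simp add: mult_ac)
  finally have "of_nat p * of_int (Q_coeff r) = of_nat p * (of_int (chi r * Q_coeff 1) :: complex)"
    by (metis mult.left_commute of_int_mult)
  moreover have "of_nat p \<noteq> (0 :: complex)" using p_gt_2 by simp
  ultimately have "of_int (Q_coeff r) = (of_int (chi r * Q_coeff 1) :: complex)" by (simp only: mult_cancel_left) blast
  then show ?thesis by (simp only: of_int_eq_iff)
qed

lemma Q_gauss: "Q 1 = of_int (Q_coeff 1) * gauss_sum"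
proof -
  have "of_nat p * of_int (Q_coeff 1) * gauss_sum = - (Q 1 * (gauss_sum * gauss_sum))" using Q_coeff_eq[of 1] p_gt_2 by simp
  then have "of_nat p * (of_int (Q_coeff 1) * gauss_sum) = of_nat p * Q 1" unfolding gauss_sum_square by (simp add: mult_ac)
  moreover have "of_nat p \<noteq> (0 :: complex)" using p_gt_2 by simp
  ultimately show ?thesis by (simp only: mult_cancel_left) simp
qed

text \<open>Compare coefficients of X^m in the product of exp (r X) - exp (- r X): each of the m
  factors is 2 r X plus higher terms, so only the leading terms contribute.\<close>

lemma power_sum_eq: "(\<Sum>X\<in>Pow quad_res. (-1) ^ card X * signed_sum X ^ m) = fact m * (\<Prod>r\<in>quad_res. 2 * r)"
proof -
  define h :: "int \<Rightarrow> real fps" where "h r = fps_shift 1 (fps_exp (of_int r) - fps_exp (of_int (- r)))" for r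
  have h: "fps_exp (of_int r) - fps_exp (of_int (- r)) = fps_X * h r" for r
    unfolding h_def by (rule fps_ext) simp
  have h0: "fps_nth (h r) 0 = of_int (2 * r)" for r by (simp add: h_def)
  have "(\<Prod>r\<in>quad_res. fps_exp (of_int r) - fps_exp (of_int (- r)) :: real fps)
      = (\<Sum>X\<in>Pow quad_res. (-1) ^ card X * fps_exp (of_int (signed_sum X)))"
    by (rule prod_exponential) (auto simp: fps_exp_add_mult)
  then have "fps_nth (\<Prod>r\<in>quad_res. fps_X * h r) m = fps_nth (\<Sum>X\<in>Pow quad_res. (-1) ^ card X * fps_exp (real_of_int (signed_sum X))) m"
    unfolding h by simp
  also have "(\<Prod>r\<in>quad_res. fps_X * h r) = fps_X ^ m * (\<Prod>r\<in>quad_res. h r)"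
    by (simp add: prod.distrib card_quad_res)
  also have "fps_nth \<dots> m = (\<Prod>r\<in>quad_res. of_int (2 * r))"
  proof -
    have "fps_nth (prod h A) 0 = (\<Prod>r\<in>A. fps_nth (h r) 0)" for A
      by (induction A rule: infinite_finite_induct) auto
    then show ?thesis by (simp add: fps_X_power_mult_nth h0)
  qed
  also have "fps_nth (\<Sum>X\<in>Pow quad_res. (-1) ^ card X * fps_exp (real_of_int (signed_sum X))) m
      = (\<Sum>X\<in>Pow quad_res. (-1) ^ card X * (of_int (signed_sum X) ^ m / fact m))"
  proof -
    have "fps_nth ((-1) ^ k * f) j = (-1) ^ k * fps_nth f j" for k j and f :: "real fps"
      by (cases "even k") auto
    then show ?thesis by (simp add: fps_sum_nth)
  qed
  finally have "of_int (\<Prod>r\<in>quad_res. 2 * r) = (\<Sum>X\<in>Pow quad_res. (-1) ^ card X * (of_int (signed_sum X) ^ m / fact m) :: real)" by simp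
  then have "fact m * real_of_int (\<Prod>r\<in>quad_res. 2 * r) = (\<Sum>X\<in>Pow quad_res. (-1) ^ card X * of_int (signed_sum X) ^ m)"
    by (simp add: sum_distrib_left)
  then have "real_of_int (fact m * (\<Prod>r\<in>quad_res. 2 * r)) = of_int (\<Sum>X\<in>Pow quad_res. (-1) ^ card X * signed_sum X ^ m)" by simp
  then show ?thesis by (simp only: of_int_eq_iff)
qed

text \<open>Modulo P a power depends only on the class r of its base, and the coefficients of that
  class add up to \<open>chi r * Q_coeff 1\<close>. As r^m is \<open>chi r\<close> modulo P, each of
  the P - 1 nonzero classes contributes \<open>Q_coeff 1\<close>.\<close>

lemma power_sum_cong: "[(\<Sum>X\<in>Pow quad_res. (-1) ^ card X * signed_sum X ^ m) = - Q_coeff 1] (mod P)"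
proof -
  have P0: "P > 0" using p_gt_2 by simp
  have "[(\<Sum>X\<in>Pow quad_res. (-1) ^ card X * signed_sum X ^ m) = (\<Sum>X\<in>Pow quad_res. (-1) ^ card X * (signed_sum X mod P) ^ m)] (mod P)"
    by (intro cong_sum cong_mult cong_pow cong_refl) (simp add: cong_iff_mod_eq)
  also have "(\<Sum>X\<in>Pow quad_res. (-1) ^ card X * (signed_sum X mod P) ^ m)
      = (\<Sum>r\<in>{0..<P}. \<Sum>X\<in>{X \<in> Pow quad_res. signed_sum X mod P = r}. (-1) ^ card X * (signed_sum X mod P) ^ m)"
    by (rule sum.group[symmetric]) (use P0 in auto)
  also have "\<dots> = (\<Sum>r\<in>{0..<P}. Q_coeff r * r ^ m)"
    unfolding Q_coeff_def sum_distrib_right by (intro sum.cong refl) auto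
  also have "\<dots> = (\<Sum>r\<in>{0..<P}. chi r * Q_coeff 1 * r ^ m)" by (intro sum.cong refl) (simp add: Q_coeff_chi)
  also have "\<dots> = (\<Sum>r\<in>{1..<P}. chi r * Q_coeff 1 * r ^ m)"
  proof -
    have "{0..<P} = insert 0 {1..<P}" using P0 by auto
    then show ?thesis by simp
  qed
  also have "[\<dots> = (\<Sum>r\<in>{1..<P}. Q_coeff 1)] (mod P)"
  proof (rule cong_sum)
    fix r assume r: "r \<in> {1..<P}"
    have "[chi r * Q_coeff 1 * r ^ m = chi r * Q_coeff 1 * chi r] (mod P)"
      by (intro cong_mult cong_refl cong_sym[OF chi_euler])
    moreover have "chi r * chi r = 1" using r by (intro chi_square not_P_dvd_range) auto
    ultimately show "[chi r * Q_coeff 1 * r ^ m = Q_coeff 1] (mod P)" by (metis mult.assoc mult.commute mult_1)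
  qed
  also have "(\<Sum>r\<in>{1..<P}. Q_coeff 1) = (P - 1) * Q_coeff 1" using P0 by simp
  also have "[(P - 1) * Q_coeff 1 = - Q_coeff 1] (mod P)" by (simp add: cong_iff_dvd_diff algebra_simps)
  finally show ?thesis .
qed

text \<open>Wilson's theorem with the upper half of the factors reflected to the lower half; the
  sign (-1)^m is -1.\<close>

lemma fact_m_square: "[fact m * fact m = 1] (mod P)"
proof -
  have "fact (p - 1) = (\<Prod>j\<in>{1..m}. int j) * (\<Prod>j\<in>{m+1..p-1}. int j)"
  proof -
    have "{1..p-1} = {1..m} \<union> {m+1..p-1}" using p_eq(1) by auto
    then have "(\<Prod>j\<in>{1..p-1}. int j) = (\<Prod>j\<in>{1..m}. int j) * (\<Prod>j\<in>{m+1..p-1}. int j)"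
      by (simp add: prod.union_disjoint)
    then show ?thesis by (simp add: fact_prod)
  qed
  also have "(\<Prod>j\<in>{m+1..p-1}. int j) = (\<Prod>j\<in>{1..m}. P - int j)"
    by (rule prod.reindex_bij_witness[of _ "\<lambda>j. p - j" "\<lambda>j. p - j"]) (use p_eq(1) in auto)
  finally have "(fact (p - 1) :: int) = fact m * (\<Prod>j\<in>{1..m}. P - int j)" by (simp add: fact_prod)
  also have "[fact m * (\<Prod>j\<in>{1..m}. P - int j) = fact m * (\<Prod>j\<in>{1..m}. - int j)] (mod P)"
    by (intro cong_mult cong_prod cong_refl) (simp add: cong_iff_dvd_diff)
  also have "(\<Prod>j\<in>{1..m}. - int j) = - fact m" using odd_m by (simp add: prod_uminus fact_prod)
  finally have "[fact (p - 1) = - (fact m * fact m)] (mod P)" by simp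
  moreover have "[fact (p - 1) = - 1] (mod P)" using wilson_theorem[OF prime_p] by simp
  ultimately have "[- (fact m * fact m) = - 1] (mod P)" using cong_sym cong_trans by blast
  then show ?thesis by (simp only: cong_minus_minus_iff)
qed

text \<open>Modulo P the factorial is 1 or -1, and \<open>chi\<close> fixes both numbers. So the
  sign is the character of m!, the product of \<open>chi j\<close> over j \<le> m.\<close>

lemma fact_m_cong: "[fact m = (-1) ^ nu] (mod P)"
proof -
  have "P dvd (fact m - 1) * (fact m + 1)"
    using fact_m_square by (simp add: cong_iff_dvd_diff algebra_simps)
  then have "P dvd fact m - 1 \<or> P dvd fact m + 1" using prime_P prime_dvd_mult_iff by blast
  then obtain e where e: "[fact m = e] (mod P)" "e = 1 \<or> e = (-1 :: int)"
    by (metis cong_iff_dvd_diff diff_minus_eq_add)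
  have "chi e = e" using e(2) chi_m1 by auto
  then have "e = chi (fact m)" using chi_cong[OF e(1)] by simp
  also have "\<dots> = (\<Prod>j\<in>{1..int m}. chi j)"
  proof -
    have "(fact m :: int) = (\<Prod>j\<in>{1..m}. int j)" by (simp add: fact_prod)
    also have "\<dots> = (\<Prod>j\<in>{1..int m}. j)" by (rule prod.reindex_bij_witness[of _ nat int]) auto
    finally show ?thesis by (simp add: chi_prod)
  qed
  also have "\<dots> = (\<Prod>j\<in>{1..int m}. if chi j = -1 then -1 else 1)"
  proof (rule prod.cong)
    fix j assume "j \<in> {1..int m}"
    then have "0 < j" "j < P" using p_eq(2) by auto
    then show "chi j = (if chi j = -1 then -1 else 1)" using chi_nonzero_range by auto
  qed simp
  also have "\<dots> = (-1) ^ card {j \<in> {1..int m}. chi j = -1}"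
    by (simp add: prod.If_cases Int_def)
  also have "{j \<in> {1..int m}. chi j = -1} = {a. 0 < a \<and> a \<le> int m \<and> chi a = -1}" by auto
  finally show ?thesis using e(1) by (simp add: nu_def)
qed

text \<open>The residues are the squares of 1, ..., m, so their product is the square of m! modulo
  P.\<close>

lemma prod_quad_res: "[(\<Prod>r\<in>quad_res. r) = 1] (mod P)"
proof -
  have sub: "(\<lambda>k. (int k)\<^sup>2 mod P) ` {1..m} \<subseteq> quad_res"
  proof
    fix r assume "r \<in> (\<lambda>k. (int k)\<^sup>2 mod P) ` {1..m}"
    then obtain k where k: "k \<in> {1..m}" "r = (int k)\<^sup>2 mod P" by auto
    have nk: "\<not> P dvd int k" by (rule not_P_dvd_range) (use k p_eq(2) in auto)
    have c: "chi r = 1" unfolding k(2) using chi_square[OF nk] by (simp add: power2_eq_square chi_mult)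
    then have "r \<noteq> 0" by auto
    moreover have "0 \<le> r" "r < P" using k(2) p_gt_2 by auto
    ultimately show "r \<in> quad_res" using c by (simp add: quad_res_def)
  qed
  have inj: "inj_on (\<lambda>k. (int k)\<^sup>2 mod P) {1..m}"
  proof (rule inj_onI)
    fix j k assume jk: "j \<in> {1..m}" "k \<in> {1..m}" "(int j)\<^sup>2 mod P = (int k)\<^sup>2 mod P"
    then have "P dvd (int j)\<^sup>2 - (int k)\<^sup>2" by (simp add: mod_eq_dvd_iff)
    also have "(int j)\<^sup>2 - (int k)\<^sup>2 = (int j - int k) * (int j + int k)" by (simp add: power2_eq_square algebra_simps)
    finally have "P dvd int j - int k \<or> P dvd int j + int k" using prime_P prime_dvd_mult_iff by blast
    moreover have "\<not> P dvd int j + int k" by (rule not_P_dvd_range) (use jk p_eq(2) in auto)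
    moreover have "P dvd int j - int k \<Longrightarrow> j = k"
      using dvd_imp_le_int[of "int j - int k" P] jk p_eq(2) by fastforce
    ultimately show "j = k" by blast
  qed
  have "(\<lambda>k. (int k)\<^sup>2 mod P) ` {1..m} = quad_res"
    by (rule card_subset_eq[OF finite_quad_res sub]) (use inj card_quad_res in \<open>simp add: card_image\<close>)
  then have "(\<Prod>r\<in>quad_res. r) = (\<Prod>k\<in>{1..m}. (int k)\<^sup>2 mod P)" using prod.reindex[OF inj, of "\<lambda>r. r"] by simp
  also have "[\<dots> = (\<Prod>k\<in>{1..m}. (int k)\<^sup>2)] (mod P)" by (rule cong_prod) (simp add: cong_iff_mod_eq)
  also have "(\<Prod>k\<in>{1..m}. (int k)\<^sup>2) = fact m * fact m"
    by (simp add: power2_eq_square prod.distrib fact_prod)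
  also have "[\<dots> = 1] (mod P)" by (rule fact_m_square)
  finally show ?thesis .
qed

lemma Q_coeff_cong: "[Q_coeff 1 = - ((-1) ^ nu * chi 2)] (mod P)"
proof -
  have "[- Q_coeff 1 = (\<Sum>X\<in>Pow quad_res. (-1) ^ card X * signed_sum X ^ m)] (mod P)" by (rule cong_sym[OF power_sum_cong])
  also have "(\<Sum>X\<in>Pow quad_res. (-1) ^ card X * signed_sum X ^ m) = fact m * (2 ^ m * (\<Prod>r\<in>quad_res. r))"
    unfolding power_sum_eq by (simp add: prod.distrib card_quad_res)
  also have "[\<dots> = (-1) ^ nu * (chi 2 * 1)] (mod P)"
    by (intro cong_mult fact_m_cong prod_quad_res cong_sym[OF chi_euler])
  finally have "[- Q_coeff 1 = - (- ((-1) ^ nu * chi 2))] (mod P)" by simp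
  then show ?thesis by (simp only: cong_minus_minus_iff)
qed

text \<open>The value at 1 of 1 + z + ... + z^(p - 1), whose roots are the p-th roots of unity other
  than 1.\<close>

lemma prod_one_minus_cis_p: "(\<Prod>a\<in>{1..<P}. 1 - cis_p a) = of_nat p"
proof -
  let ?f = "\<Prod>a\<in>{1..<P}. [:- cis_p a, 1:]" and ?g = "\<Sum>i<p. Polynomial.monom (1 :: complex) i"
  have deg: "degree ?f = p - 1"
    by (subst degree_prod_sum_eq) (auto simp: nat_diff_distrib)
  have inj: "inj_on cis_p {1..<P}"
  proof (rule inj_onI)
    fix a b assume ab: "a \<in> {1..<P}" "b \<in> {1..<P}" "cis_p a = cis_p b"
    then have "cis_p (a - b) = 1" by (simp add: cis_p_diff cis_p_inverse)
    then have "P dvd a - b" by (simp add: cis_p_eq_1_iff)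
    then show "a = b" using ab dvd_imp_le_int[of "a - b" P] by fastforce
  qed
  have "?f = ?g"
  proof (rule poly_eqI_degree_lead_coeff[where n = "p - 1" and A = "cis_p ` {1..<P}"])
    have "lead_coeff ?f = 1" by (simp add: lead_coeff_prod)
    then have "poly.coeff ?f (p - 1) = 1" unfolding deg .
    moreover have "poly.coeff ?g (p - 1) = 1" using p_gt_2 by (simp add: coeff_sum)
    ultimately show "poly.coeff ?f (p - 1) = poly.coeff ?g (p - 1)" by simp
    show "p - 1 \<le> card (cis_p ` {1..<P})" by (simp add: card_image[OF inj] nat_diff_distrib)
    show "degree ?f \<le> p - 1" by (simp add: deg)
    show "degree ?g \<le> p - 1" by (rule degree_sum_le) (auto intro: order_trans[OF degree_monom_le])
    fix z assume "z \<in> cis_p ` {1..<P}"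
    then obtain a where a: "a \<in> {1..<P}" "z = cis_p a" by auto
    have "poly ?f z = 0" using a by (simp add: poly_prod prod_zero_iff) (auto intro!: bexI[of _ a])
    moreover have "poly ?g z = 0"
    proof -
      have "poly ?g z = (\<Sum>i<p. cis_p a ^ i)" by (simp add: poly_sum poly_monom a)
      moreover have "cis_p a \<noteq> 1" using a not_P_dvd_range[of a] by (simp add: cis_p_eq_1_iff)
      moreover have "cis_p a ^ p = 1" using cis_p_P[of a] by (simp add: cis_p_mult_nat[symmetric] mult.commute)
      ultimately show ?thesis by (simp add: geometric_sum)
    qed
    ultimately show "poly ?f z = poly ?g z" by simp
  qed
  then have "poly ?f 1 = poly ?g 1" by simp
  then show ?thesis by (simp add: poly_prod poly_sum poly_monom)
qed

text \<open>Over all nonzero classes the product of \<open>cis_p a - cis_p (- a)\<close> is minus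
  the square of \<open>Q 1\<close>, as the nonresidues are the negatives of the residues and m is
  odd. Pulling out \<open>- cis_p (- a)\<close>, whose product is 1, leaves the factors 1 - cis_p
  (2a); doubling permutes the classes, so the product is p.\<close>

lemma Q_square: "Q 1 * Q 1 = - of_nat p"
proof -
  have n2: "\<not> P dvd 2" by (rule not_P_dvd_2)
  have split: "{1..<P} = quad_res \<union> quad_nonres" "quad_res \<inter> quad_nonres = {}"
  proof -
    have "a \<in> {1..<P} \<longleftrightarrow> a \<in> quad_res \<union> quad_nonres" for a
      using chi_nonzero_range[of a] by (auto simp: quad_res_def quad_nonres_def)
    then show "{1..<P} = quad_res \<union> quad_nonres" by blast
  qed (auto simp: quad_res_def quad_nonres_def)
  have "(\<Prod>a\<in>{1..<P}. cis_p a - cis_p (- a)) = Q 1 * (\<Prod>a\<in>quad_nonres. cis_p a - cis_p (- a))"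
    unfolding split(1) using split(2) by (simp add: prod.union_disjoint Q_def)
  also have "(\<Prod>a\<in>quad_nonres. cis_p a - cis_p (- a)) = (\<Prod>r\<in>quad_res. - (cis_p r - cis_p (- r)))"
  proof (rule prod.reindex_bij_witness[of _ "\<lambda>a. P - a" "\<lambda>a. P - a"])
    fix a
    have "cis_p (P - a) = cis_p (- a)" "cis_p (- (P - a)) = cis_p a" by (rule cis_p_cong; simp add: cong_iff_dvd_diff)+
    then show "- (cis_p (P - a) - cis_p (- (P - a))) = cis_p a - cis_p (- a)" by simp
  qed (auto simp: quad_res_def quad_nonres_def)
  also have "\<dots> = (- 1) ^ card quad_res * (\<Prod>r\<in>quad_res. cis_p r - cis_p (- r))" by (rule prod_uminus)
  also have "\<dots> = - Q 1" using odd_m by (simp add: card_quad_res Q_def)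
  finally have 1: "(\<Prod>a\<in>{1..<P}. cis_p a - cis_p (- a)) = - (Q 1 * Q 1)" by simp
  have "(\<Prod>a\<in>{1..<P}. cis_p a - cis_p (- a)) = (\<Prod>a\<in>{1..<P}. - cis_p (- a) * (1 - cis_p (a * 2)))"
  proof (rule prod.cong)
    fix a
    have "cis_p (- a) * cis_p (a * 2) = cis_p a" by (simp add: cis_p_add[symmetric])
    then show "cis_p a - cis_p (- a) = - cis_p (- a) * (1 - cis_p (a * 2))" by (simp add: algebra_simps)
  qed simp
  also have "\<dots> = (\<Prod>a\<in>{1..<P}. - cis_p (- a)) * (\<Prod>a\<in>{1..<P}. 1 - cis_p (a * 2))" by (rule prod.distrib)
  also have "(\<Prod>a\<in>{1..<P}. - cis_p (- a)) = 1"
  proof -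
    have "(\<Prod>a\<in>{1..<P}. - cis_p (- a)) = (-1) ^ card {1..<P} * cis_p (\<Sum>a\<in>{1..<P}. - a)"
      by (simp add: prod_uminus cis_p_sum)
    also have "even (card {1..<P})" using p_eq(2) by (simp add: nat_mult_distrib)
    then have "(-1) ^ card {1..<P} = (1 :: complex)" by simp
    also have "(\<Sum>a\<in>{1..<P}. - a) = - (P * int m)"
    proof -
      have "(\<Sum>a\<in>{1..<P}. a) = (\<Sum>a\<in>{1..<P}. P - a)"
        by (rule sum.reindex_bij_witness[of _ "\<lambda>a. P - a" "\<lambda>a. P - a"]) auto
      also have "\<dots> = P * (P - 1) - (\<Sum>a\<in>{1..<P}. a)" using p_gt_2 by (simp add: sum_subtractf mult.commute)
      finally have "2 * (\<Sum>a\<in>{1..<P}. a) = 2 * (P * int m)" using p_eq(2) by (simp add: algebra_simps)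
      then show ?thesis by (simp add: sum_negf)
    qed
    also have "cis_p (- (P * int m)) = 1" using cis_p_P[of "- int m"] by simp
    finally show ?thesis by simp
  qed
  also have "(\<Prod>a\<in>{1..<P}. 1 - cis_p (a * 2)) = (\<Prod>a\<in>{1..<P}. 1 - cis_p ((a * 2) mod P))" by (simp only: cis_p_mod)
  also have "\<dots> = (\<Prod>a\<in>{1..<P}. 1 - cis_p a)" by (rule prod.reindex_bij_betw[OF bij_mult(2)[OF n2]])
  also have "\<dots> = of_nat p" by (rule prod_one_minus_cis_p)
  finally have "(\<Prod>a\<in>{1..<P}. cis_p a - cis_p (- a)) = of_nat p" by simp
  then have "- (Q 1 * Q 1) = of_nat p" unfolding 1 .
  then show ?thesis by (metis minus_minus)
qed

lemma Q_coeff_1: "Q_coeff 1 = - ((-1) ^ nu * chi 2)"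
proof -
  have "of_int (Q_coeff 1 * Q_coeff 1) * (gauss_sum * gauss_sum) = (of_int (Q_coeff 1) * gauss_sum) * (of_int (Q_coeff 1) * gauss_sum)"
    by (simp only: of_int_mult mult_ac)
  also have "\<dots> = Q 1 * Q 1" by (simp only: Q_gauss)
  also have "\<dots> = of_int 1 * (gauss_sum * gauss_sum)" by (simp only: Q_square gauss_sum_square of_int_1 mult_1)
  finally have "of_int (Q_coeff 1 * Q_coeff 1) * (gauss_sum * gauss_sum) = of_int 1 * (gauss_sum * gauss_sum)" .
  moreover have "gauss_sum * gauss_sum \<noteq> 0" unfolding gauss_sum_square using p_gt_2 by simp
  ultimately have "(of_int (Q_coeff 1 * Q_coeff 1) :: complex) = of_int 1" by (simp only: mult_cancel_right) simp
  then have "Q_coeff 1 * Q_coeff 1 = 1" by (simp only: of_int_eq_iff)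
  then have "Q_coeff 1 \<in> {-1, 0, 1}" by (auto simp: zmult_eq_1_iff)
  moreover have "- ((-1) ^ nu * chi 2) \<in> {-1, 0, 1}"
    using chi_values[of 2] by (auto simp: minus_one_power_iff)
  ultimately show ?thesis using chi_unique[OF Q_coeff_cong] by blast
qed

text \<open>\<open>Q 1\<close> is (2i)^m times the product of sin (2 pi r / p) over the residues r.
  The sine is negative for r > p/2, and these r correspond to the nonresidues P - r below p/2, so
  the product has sign (-1)^nu. The same power occurs in \<open>Q_coeff 1\<close> and cancels; what
  remains is 2^m times a product of absolute values.\<close>

theorem G_pos: "G > 0"
proof -
  have sin_sign: "sin (2 * pi * of_int r / of_nat p) = (if r \<le> int m then 1 else -1) * \<bar>sin (2 * pi * of_int r / of_nat p)\<bar>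
      \<and> sin (2 * pi * of_int r / of_nat p) \<noteq> 0"
    if r: "r \<in> quad_res" for r
  proof (cases "r \<le> int m")
    case True
    have "0 < r" using r by (simp add: quad_res_def)
    moreover have "2 * real_of_int r < real p" using True p_eq(2) by linarith
    ultimately have "0 < 2 * pi * of_int r / of_nat p" "2 * pi * of_int r / of_nat p < pi" using p_gt_2
      by (simp_all add: field_simps)
    then have "sin (2 * pi * of_int r / of_nat p) > 0" by (rule sin_gt_zero)
    then show ?thesis using True by simp
  next
    case False
    have "r < P" using r by (simp add: quad_res_def)
    moreover have "real p < 2 * real_of_int r" using False p_eq(2) by linarith
    ultimately have "pi < 2 * pi * of_int r / of_nat p" "2 * pi * of_int r / of_nat p < 2 * pi" using p_gt_2
      by (simp_all add: field_simps)
    then have "sin (2 * pi * of_int r / of_nat p) < 0" by (rule sin_lt_zero)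
    then show ?thesis using False by simp
  qed
  define A where "A = (\<Prod>r\<in>quad_res. \<bar>sin (2 * pi * of_int r / of_nat p)\<bar>)"
  have A: "A > 0" unfolding A_def using sin_sign by (intro prod_pos) auto
  have "card {r \<in> quad_res. \<not> r \<le> int m} = nu"
  proof -
    have "bij_betw (\<lambda>r. P - r) {r \<in> quad_res. \<not> r \<le> int m} {a. 0 < a \<and> a \<le> int m \<and> chi a = -1}"
      by (rule bij_betwI[of _ _ _ "\<lambda>a. P - a"]) (use p_eq(2)[symmetric] in \<open>auto simp: quad_res_def\<close>)
    then show ?thesis unfolding nu_def by (rule bij_betw_same_card)
  qed
  then have sgn: "(\<Prod>r\<in>quad_res. if r \<le> int m then 1 else -1) = (-1 :: real) ^ nu"
    by (simp add: prod.If_cases Int_def)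
  have "Q 1 = (\<Prod>r\<in>quad_res. 2 * \<i> * complex_of_real (sin (2 * pi * of_int r / of_nat p)))"
    unfolding Q_def by (rule prod.cong) (auto simp: cis_p_def complex_eq_iff)
  also have "\<dots> = (2 * \<i>) ^ m * complex_of_real (\<Prod>r\<in>quad_res. sin (2 * pi * of_int r / of_nat p))"
    by (simp add: prod.distrib card_quad_res power_mult_distrib)
  also have "(\<Prod>r\<in>quad_res. sin (2 * pi * of_int r / of_nat p)) = (-1) ^ nu * A"
    unfolding A_def sgn[symmetric] prod.distrib[symmetric] by (rule prod.cong) (use sin_sign in auto)
  finally have Q1: "Q 1 = 2 ^ m * \<i> ^ m * complex_of_real ((-1) ^ nu * A)" by (simp add: power_mult_distrib)
  obtain k where k: "m = 2 * k + 1" using odd_m by (elim oddE)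
  have im: "\<i> ^ m = \<i> * (-1) ^ k" unfolding k by (simp add: power_mult)
  have c2: "chi 2 = - ((-1) ^ k)"
  proof -
    have "(p + 1) div 4 = k + 1" using p_eq(1) k by simp
    then show ?thesis unfolding chi_2 by simp
  qed
  have "of_int (Q_coeff 1) * (\<i> * complex_of_real G) = \<i> * complex_of_real ((-1) ^ k * 2 ^ m * ((-1) ^ nu * A))"
    using Q_gauss unfolding gauss_sum_eq Q1 im by (simp add: mult_ac)
  then have "of_int (Q_coeff 1) * G = (-1) ^ k * 2 ^ m * ((-1) ^ nu * A)"
    by (simp add: complex_eq_iff)
  moreover have "real_of_int (Q_coeff 1) = (-1) ^ nu * (-1) ^ k" unfolding Q_coeff_1 c2 by simp
  ultimately have "((-1) ^ nu * (-1) ^ k) * G = ((-1) ^ nu * (-1) ^ k) * (2 ^ m * A)" by (simp add: mult_ac)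
  then have "G = 2 ^ m * A" by simp
  then show ?thesis using A by simp
qed

corollary G_eq: "G = sqrt (real p)"
  using G_pos G_square by (metis abs_of_pos power2_eq_square real_sqrt_abs)

end

section \<open>The class number formula\<close>

lemma has_sum_sum_finite:
  fixes f :: "'a \<Rightarrow> 'b \<Rightarrow> real"
  assumes "finite A" "\<And>a. a \<in> A \<Longrightarrow> (f a has_sum S a) B"
  shows "((\<lambda>x. \<Sum>a\<in>A. f a x) has_sum (\<Sum>a\<in>A. S a)) B"
  using assms by (induction A rule: finite_induct) (auto intro: has_sum_add)

lemma tendsto_of_sqrt_bound:
  fixes f :: "real \<Rightarrow> real"
  assumes "\<And>t. 0 < t \<Longrightarrow> t \<le> 1 \<Longrightarrow> \<bar>f t - L\<bar> \<le> C * sqrt t"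
  shows "(f \<longlongrightarrow> L) (at_right 0)"
proof -
  have "((\<lambda>t. f t - L) \<longlongrightarrow> 0) (at_right 0)"
  proof (rule Lim_null_comparison)
    show "\<forall>\<^sub>F t in at_right 0. norm (f t - L) \<le> C * sqrt t"
      using assms by (auto simp: eventually_at_right_field intro!: exI[of _ 1])
    have "((\<lambda>t. C * sqrt t) \<longlongrightarrow> C * sqrt 0) (at_right 0)" by (intro tendsto_intros)
    then show "((\<lambda>t. C * sqrt t) \<longlongrightarrow> 0) (at_right 0)" by simp
  qed
  then show ?thesis by (simp add: LIM_zero_iff)
qed

context prime_3_mod_4
begin

definition chi_moment :: int where "chi_moment = (\<Sum>a\<in>{1..<P}. a * chi a)"

text \<open>The exponential counterpart of the product of the Riemann zeta function and the L-series
  of \<open>chi\<close>, kept as a double sum over the cofactor j and the divisor d.\<close>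

definition zeta_sum :: "real \<Rightarrow> real" where
  "zeta_sum t = (\<Sum>\<^sub>\<infinity>(j::nat, d::nat)\<in>{1..} \<times> {1..}. real_of_int (chi (int d)) * exp (- t * real j * real d))"

lemma zeta_sum: "t > 0 \<Longrightarrow>
  ((\<lambda>(j::nat, d::nat). real_of_int (chi (int d)) * exp (- t * real j * real d)) has_sum zeta_sum t) ({1..} \<times> {1..})"
  unfolding zeta_sum_def using chi_double_summable by simp

text \<open>Multiplication by \<open>G\<close> turns each \<open>chi d\<close> into a combination of
  sines. Of the limits (pi - \<theta>)/2, weighted with \<open>chi a\<close>, only the part linear
  in a survives, because the values of \<open>chi\<close> add up to 0.\<close>

lemma zeta_sum_bound: "\<exists>C. \<forall>t>0. \<bar>t * (G * zeta_sum t) - - (pi * of_int chi_moment / real p)\<bar> \<le> C * t"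
proof -
  define \<theta> :: "int \<Rightarrow> real" where "\<theta> a = 2 * pi * of_int a / of_nat p" for a
  have "\<exists>C. \<forall>t>0. \<exists>S. ((\<lambda>(j::nat, d::nat). sin (real d * \<theta> a) * exp (- t * real j * real d)) has_sum S) ({1..} \<times> {1..})
     \<and> \<bar>t * S - (pi - \<theta> a) / 2\<bar> \<le> C * t" if a: "a \<in> {1..<P}" for a
  proof (rule sine_double_sum)
    have "0 < real_of_int a" "real_of_int a < real p" using a by auto
    then show "0 < \<theta> a" "\<theta> a < 2 * pi" using p_gt_2 by (simp_all add: \<theta>_def field_simps)
    show "\<theta> a \<noteq> pi"
    proof
      assume "\<theta> a = pi"
      then have "real_of_int (2 * a) = of_int P" using p_gt_2 by (simp add: \<theta>_def field_simps)
      then have "2 * a = P" by (simp only: of_int_eq_iff)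
      then show False using p_eq(2) by presburger
    qed
  qed
  then have "\<forall>a\<in>{1..<P}. \<exists>C. \<forall>t>0. \<exists>S. ((\<lambda>(j::nat, d::nat). sin (real d * \<theta> a) * exp (- t * real j * real d)) has_sum S) ({1..} \<times> {1..})
     \<and> \<bar>t * S - (pi - \<theta> a) / 2\<bar> \<le> C * t" by blast
  from bchoice[OF this] obtain C where C: "\<forall>a\<in>{1..<P}. \<forall>t>0.
     \<exists>S. ((\<lambda>(j::nat, d::nat). sin (real d * \<theta> a) * exp (- t * real j * real d)) has_sum S) ({1..} \<times> {1..})
     \<and> \<bar>t * S - (pi - \<theta> a) / 2\<bar> \<le> C a * t" ..
  have "\<bar>t * (G * zeta_sum t) - - (pi * of_int chi_moment / real p)\<bar> \<le> (\<Sum>a\<in>{1..<P}. C a) * t" if t: "t > 0" for t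
  proof -
    have "\<forall>a\<in>{1..<P}. \<exists>S. ((\<lambda>(j::nat, d::nat). sin (real d * \<theta> a) * exp (- t * real j * real d)) has_sum S) ({1..} \<times> {1..})
     \<and> \<bar>t * S - (pi - \<theta> a) / 2\<bar> \<le> C a * t" using C t by blast
    from bchoice[OF this] obtain S where S: "\<And>a. a \<in> {1..<P} \<Longrightarrow> ((\<lambda>(j::nat, d::nat). sin (real d * \<theta> a) * exp (- t * real j * real d)) has_sum S a) ({1..} \<times> {1..})"
      "\<And>a. a \<in> {1..<P} \<Longrightarrow> \<bar>t * S a - (pi - \<theta> a) / 2\<bar> \<le> C a * t"
      by blast
    have "((\<lambda>x. \<Sum>a\<in>{1..<P}. real_of_int (chi a) * (case x of (j::nat, d::nat) \<Rightarrow> sin (real d * \<theta> a) * exp (- t * real j * real d)))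
        has_sum (\<Sum>a\<in>{1..<P}. real_of_int (chi a) * S a)) ({1..} \<times> {1..})"
      by (intro has_sum_sum_finite has_sum_cmult_right S(1)) auto
    also have "(\<lambda>x. \<Sum>a\<in>{1..<P}. real_of_int (chi a) * (case x of (j::nat, d::nat) \<Rightarrow> sin (real d * \<theta> a) * exp (- t * real j * real d)))
        = (\<lambda>x. G * (case x of (j::nat, d::nat) \<Rightarrow> real_of_int (chi (int d)) * exp (- t * real j * real d)))"
    proof (rule ext, safe)
      fix j d :: nat
      have "{0..<P} = insert 0 {1..<P}" using p_gt_2 by auto
      then have "(\<Sum>a\<in>{1..<P}. real_of_int (chi a) * sin (real d * \<theta> a)) = of_int (chi (int d)) * G"
        using sine_sum[of "int d"] by (simp add: \<theta>_def mult_ac)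
      then show "(\<Sum>a\<in>{1..<P}. real_of_int (chi a) * (sin (real d * \<theta> a) * exp (- t * real j * real d)))
        = G * (real_of_int (chi (int d)) * exp (- t * real j * real d))"
        by (simp add: mult.assoc[symmetric] sum_distrib_right[symmetric] mult.commute[of G])
    qed
    finally have GZ: "(\<Sum>a\<in>{1..<P}. real_of_int (chi a) * S a) = G * zeta_sum t"
      using has_sum_cmult_right[OF zeta_sum[OF t], of G] by (rule has_sum_unique)
    have "(\<Sum>a\<in>{1..<P}. real_of_int (chi a) * ((pi - \<theta> a) / 2))
        = (\<Sum>a\<in>{1..<P}. real_of_int (chi a) * (pi / 2) - (pi / real p) * real_of_int (a * chi a))"
      by (rule sum.cong) (auto simp: \<theta>_def field_simps)
    also have "\<dots> = real_of_int (\<Sum>a\<in>{1..<P}. chi a) * (pi / 2) - (pi / real p) * of_int chi_moment"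
      by (simp only: sum_subtractf sum_distrib_left[symmetric] sum_distrib_right[symmetric] of_int_sum chi_moment_def)
    finally have main: "(\<Sum>a\<in>{1..<P}. real_of_int (chi a) * ((pi - \<theta> a) / 2)) = - (pi * of_int chi_moment / real p)"
      unfolding sum_chi(1) by simp
    have "\<bar>t * (G * zeta_sum t) - - (pi * of_int chi_moment / real p)\<bar>
        = \<bar>\<Sum>a\<in>{1..<P}. real_of_int (chi a) * (t * S a - (pi - \<theta> a) / 2)\<bar>"
      unfolding main[symmetric] GZ[symmetric] by (simp add: sum_distrib_left sum_subtractf right_diff_distrib mult_ac)
    also have "\<dots> \<le> (\<Sum>a\<in>{1..<P}. \<bar>real_of_int (chi a) * (t * S a - (pi - \<theta> a) / 2)\<bar>)" by (rule sum_abs)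
    also have "\<dots> \<le> (\<Sum>a\<in>{1..<P}. C a * t)"
    proof (rule sum_mono)
      fix a assume a: "a \<in> {1..<P}"
      have "\<bar>real_of_int (chi a)\<bar> \<le> 1" using chi_values[of a] by auto
      then have "\<bar>real_of_int (chi a) * (t * S a - (pi - \<theta> a) / 2)\<bar> \<le> 1 * \<bar>t * S a - (pi - \<theta> a) / 2\<bar>"
        unfolding abs_mult by (intro mult_right_mono) auto
      then show "\<bar>real_of_int (chi a) * (t * S a - (pi - \<theta> a) / 2)\<bar> \<le> C a * t" using S(2)[OF a] by simp
    qed
    finally show ?thesis by (simp add: sum_distrib_right)
  qed
  then show ?thesis by blast
qed

text \<open>Dirichlet's closed form of L(1, chi), the residue at 1 of the Dedekind zeta
  function.\<close>

definition residue :: real where "residue = - (pi * of_int chi_moment / real p) / G"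

lemma zeta_sum_tendsto: "((\<lambda>t. t * zeta_sum t) \<longlongrightarrow> residue) (at_right 0)"
proof -
  obtain C where C: "\<And>t. t > 0 \<Longrightarrow> \<bar>t * (G * zeta_sum t) - - (pi * of_int chi_moment / real p)\<bar> \<le> C * t"
    using zeta_sum_bound by blast
  have "((\<lambda>t. t * (G * zeta_sum t)) \<longlongrightarrow> - (pi * of_int chi_moment / real p)) (at_right 0)"
  proof (rule tendsto_of_sqrt_bound)
    fix t :: real assume t: "0 < t" "t \<le> 1"
    have "C * t \<le> \<bar>C\<bar> * sqrt t"
    proof -
      have "t \<le> sqrt t" using t by (intro real_le_rsqrt) (simp add: power2_eq_square mult_left_le)
      then have "\<bar>C\<bar> * t \<le> \<bar>C\<bar> * sqrt t" by (intro mult_left_mono) auto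
      moreover have "C * t \<le> \<bar>C\<bar> * t" using t by (intro mult_right_mono) auto
      ultimately show ?thesis by simp
    qed
    then show "\<bar>t * (G * zeta_sum t) - - (pi * of_int chi_moment / real p)\<bar> \<le> \<bar>C\<bar> * sqrt t" using C[OF t(1)] by simp
  qed
  then have "((\<lambda>t. t * (G * zeta_sum t) / G) \<longlongrightarrow> residue) (at_right 0)"
    unfolding residue_def by (intro tendsto_divide tendsto_const) (use G_pos in auto)
  then show ?thesis using G_pos by simp
qed

definition ideal_classes :: "complex set set set" where "ideal_classes = nonzero_ideals R // ideal_class_rel R"

text \<open>Formulated for finite sets of classes, since the finiteness of the class group is
  derived from it.\<close>

lemma finite_classes_sum:
  assumes p3: "p > 3" and F: "finite F" "F \<subseteq> ideal_classes"
  obtains Z where "\<And>t. 0 < t \<Longrightarrow> t \<le> 1 \<Longrightarrow> ((\<lambda>I. exp (- t * ideal_norm I)) has_sum Z t) (\<Union>F)"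
    and "((\<lambda>t. t * Z t) \<longlongrightarrow> real (card F) * (pi / sqrt (real p))) (at_right 0)"
proof -
  have "\<exists>B s. \<forall>t. 0 < t \<and> t \<le> 1 \<longrightarrow> ((\<lambda>I. exp (- t * ideal_norm I)) has_sum s t) C \<and>
     \<bar>t * s t - pi / sqrt (real p)\<bar> \<le> B * sqrt t" if "C \<in> F" for C
    using class_sum_quotient[OF p3, folded ideal_classes_def] F(2) that by (meson subsetD)
  then obtain B s where Bs: "\<And>C t. C \<in> F \<Longrightarrow> 0 < t \<Longrightarrow> t \<le> 1 \<Longrightarrow> ((\<lambda>I. exp (- t * ideal_norm I)) has_sum s C t) C"
    "\<And>C t. C \<in> F \<Longrightarrow> 0 < t \<Longrightarrow> t \<le> 1 \<Longrightarrow> \<bar>t * s C t - pi / sqrt (real p)\<bar> \<le> B C * sqrt t"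
    by metis
  define Z where "Z t = (\<Sum>C\<in>F. s C t)" for t
  have "((\<lambda>I. exp (- t * ideal_norm I)) has_sum Z t) (\<Union>F)" if t: "0 < t" "t \<le> 1" for t
  proof -
    have "((\<lambda>I. exp (- t * ideal_norm I)) has_sum (\<Sum>C\<in>F. s C t)) (\<Union>C\<in>F. C)"
    proof (rule sum_has_sum[OF F(1)])
      fix C C' assume "C \<in> F" "C' \<in> F" "C \<noteq> C'"
      then show "C \<inter> C' = {}" using quotient_disj[OF equiv_class_rel, folded ideal_classes_def] F(2) by blast
    qed (use Bs(1) t in blast)
    then show ?thesis by (simp add: Z_def)
  qed
  moreover have "((\<lambda>t. t * Z t) \<longlongrightarrow> real (card F) * (pi / sqrt (real p))) (at_right 0)"
  proof -
    have "((\<lambda>t. \<Sum>C\<in>F. t * s C t) \<longlongrightarrow> (\<Sum>C\<in>F. pi / sqrt (real p))) (at_right 0)"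
      by (intro tendsto_sum tendsto_of_sqrt_bound) (use Bs(2) in blast)
    then show ?thesis by (simp add: Z_def sum_distrib_left)
  qed
  ultimately show ?thesis by (rule that)
qed

text \<open>Any k classes account for k pi / sqrt p of the limit, because all terms are positive;
  this bounds k. With finitely many classes, all of them together account for the whole
  limit.\<close>

lemma classes_finite_card:
  assumes p3: "p > 3"
  shows "finite ideal_classes" "real (card ideal_classes) * (pi / sqrt (real p)) = residue"
proof -
  have ev: "eventually (\<lambda>t::real. 0 < t \<and> t \<le> 1) (at_right 0)"
    by (auto simp: eventually_at_right_field intro!: exI[of _ 1])
  have sub: "\<Union>F \<subseteq> nonzero_ideals R" if "F \<subseteq> ideal_classes" for F
    using that Union_quotient[OF equiv_class_rel, folded ideal_classes_def] by blast
  have le: "real (card F) * (pi / sqrt (real p)) \<le> residue" if F: "finite F" "F \<subseteq> ideal_classes" for F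
  proof -
    obtain Z where Z: "\<And>t. 0 < t \<Longrightarrow> t \<le> 1 \<Longrightarrow> ((\<lambda>I. exp (- t * ideal_norm I)) has_sum Z t) (\<Union>F)"
      "((\<lambda>t. t * Z t) \<longlongrightarrow> real (card F) * (pi / sqrt (real p))) (at_right 0)"
      using finite_classes_sum[OF p3 F] by blast
    show ?thesis
    proof (rule tendsto_le[OF _ zeta_sum_tendsto Z(2)])
      show "\<forall>\<^sub>F t in at_right 0. t * Z t \<le> t * zeta_sum t"
        using ev
      proof eventually_elim
        case (elim t)
        have "Z t \<le> zeta_sum t"
          by (rule has_sum_mono'[OF Z(1) ideals_sum[OF _ zeta_sum] sub[OF F(2)]]) (use elim in auto)
        then show ?case using elim by (intro mult_left_mono) auto
      qed
    qed simp
  qed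
  show fin: "finite ideal_classes"
  proof (rule ccontr)
    assume inf: "infinite ideal_classes"
    obtain k :: nat where k: "residue / (pi / sqrt (real p)) < real k" using reals_Archimedean2 by blast
    obtain F where F: "finite F" "card F = k" "F \<subseteq> ideal_classes" using infinite_arbitrarily_large[OF inf] by blast
    have pos: "pi / sqrt (real p) > 0" using p_gt_2 by simp
    have "residue < real k * (pi / sqrt (real p))" using k pos by (simp only: pos_divide_less_eq)
    then show False using le[OF F(1,3)] unfolding F(2) by linarith
  qed
  obtain Z where Z: "\<And>t. 0 < t \<Longrightarrow> t \<le> 1 \<Longrightarrow> ((\<lambda>I. exp (- t * ideal_norm I)) has_sum Z t) (\<Union>ideal_classes)"
      "((\<lambda>t. t * Z t) \<longlongrightarrow> real (card ideal_classes) * (pi / sqrt (real p))) (at_right 0)"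
    using finite_classes_sum[OF p3 fin order_refl] by blast
  have un: "\<Union>ideal_classes = nonzero_ideals R" by (rule Union_quotient[OF equiv_class_rel, folded ideal_classes_def])
  have "\<forall>\<^sub>F t in at_right 0. t * Z t = t * zeta_sum t"
    using ev
  proof eventually_elim
    case (elim t)
    then show ?case using has_sum_unique[OF Z(1)[unfolded un] ideals_sum[OF _ zeta_sum]] by simp
  qed
  then have "((\<lambda>t. t * zeta_sum t) \<longlongrightarrow> real (card ideal_classes) * (pi / sqrt (real p))) (at_right 0)"
    using Z(2) by (rule Lim_transform_eventually[rotated])
  then show "real (card ideal_classes) * (pi / sqrt (real p)) = residue"
    using zeta_sum_tendsto by (intro tendsto_unique[OF trivial_limit_at_right_real]) auto
qed

theorem class_number_formula:
  assumes "p > 3"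
  shows "P * int (class_number (quadratic_field (- P))) = - chi_moment"
proof -
  have "class_number (quadratic_field (- P)) = card ideal_classes" by (simp add: class_number_def ideal_classes_def R_def K_def)
  moreover have "real (card ideal_classes) * (pi / sqrt (real p)) = - (pi * of_int chi_moment / real p) / sqrt (real p)"
    using classes_finite_card(2)[OF assms] unfolding residue_def G_eq .
  then have "real (card ideal_classes) * pi = - (pi * of_int chi_moment / real p)"
    using p_gt_2 by (simp add: field_simps)
  then have "pi * (real p * real (card ideal_classes)) = pi * - real_of_int chi_moment" using p_gt_2 by (simp add: field_simps)
  then have "real p * real (card ideal_classes) = - real_of_int chi_moment" by (simp only: mult_cancel_left) simp
  then have "real_of_int (P * int (card ideal_classes)) = of_int (- chi_moment)" by simp
  ultimately show ?thesis by (simp only: of_int_eq_iff)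
qed

section \<open>The parity of the class number\<close>

text \<open>The first formula reflects the upper half of the range by a \<mapsto> P - a. For the
  second, the even numbers are written as 2a and the odd ones as P - 2a, both with 1 \<le> a \<le>
  m.\<close>

lemma chi_moment_half:
  "chi_moment = 2 * (\<Sum>a\<in>{1..int m}. a * chi a) - P * (\<Sum>a\<in>{1..int m}. chi a)"
  "chi_moment = chi 2 * (4 * (\<Sum>a\<in>{1..int m}. a * chi a) - P * (\<Sum>a\<in>{1..int m}. chi a))"
proof -
  have lin: "(\<Sum>a\<in>{1..int m}. u * (a * chi a) + v * chi a) = u * (\<Sum>a\<in>{1..int m}. a * chi a) + v * (\<Sum>a\<in>{1..int m}. chi a)" for u v
    by (simp add: sum.distrib sum_distrib_left)
  have "{1..<P} = {1..int m} \<union> {int m + 1..<P}" using p_eq(2) by auto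
  then have "chi_moment = (\<Sum>a\<in>{1..int m}. a * chi a) + (\<Sum>a\<in>{int m + 1..<P}. a * chi a)"
    unfolding chi_moment_def by (simp only:) (rule sum.union_disjoint; auto)
  also have "(\<Sum>a\<in>{int m + 1..<P}. a * chi a) = (\<Sum>a\<in>{1..int m}. (P - a) * chi (P - a))"
    by (rule sum.reindex_bij_witness[of _ "\<lambda>a. P - a" "\<lambda>a. P - a"]) (use p_eq(2)[symmetric] in auto)
  also have "\<dots> = (\<Sum>a\<in>{1..int m}. 1 * (a * chi a) + (- P) * chi a)"
    by (rule sum.cong) (auto simp: algebra_simps)
  finally show "chi_moment = 2 * (\<Sum>a\<in>{1..int m}. a * chi a) - P * (\<Sum>a\<in>{1..int m}. chi a)"
    unfolding lin by simp
  have split: "{1..<P} = {a \<in> {1..<P}. even a} \<union> {a \<in> {1..<P}. odd a}" by auto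
  have "chi_moment = (\<Sum>a\<in>{a \<in> {1..<P}. even a}. a * chi a) + (\<Sum>a\<in>{a \<in> {1..<P}. odd a}. a * chi a)"
    unfolding chi_moment_def by (subst split, rule sum.union_disjoint) (rule finite_subset[of _ "{1..<P}"], auto)+
  also have "(\<Sum>a\<in>{a \<in> {1..<P}. even a}. a * chi a) = (\<Sum>a\<in>{1..int m}. (2 * a) * chi (2 * a))"
    by (rule sum.reindex_bij_witness[of _ "\<lambda>a. 2 * a" "\<lambda>a. a div 2"]) (use p_eq(2) in auto)
  also have "(\<Sum>a\<in>{a \<in> {1..<P}. odd a}. a * chi a) = (\<Sum>a\<in>{1..int m}. (P - 2 * a) * chi (P - 2 * a))"
  proof (rule sum.reindex_bij_witness[of _ "\<lambda>a. P - 2 * a" "\<lambda>a. (P - a) div 2"])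
    fix a assume a: "a \<in> {a \<in> {1..<P}. odd a}"
    then have "even (P - a)" using odd_p by simp
    then have e: "P - 2 * ((P - a) div 2) = a" by simp
    then show "P - 2 * ((P - a) div 2) = a" .
    show "(P - 2 * ((P - a) div 2)) * chi (P - 2 * ((P - a) div 2)) = a * chi a" unfolding e ..
    have "1 \<le> a" "a < P" using a by auto
    then have "1 \<le> (P - a) div 2" "(P - a) div 2 \<le> int m" using e p_eq(2) by linarith+
    then show "(P - a) div 2 \<in> {1..int m}" by simp
  next
    fix a assume "a \<in> {1..int m}"
    then have a: "1 \<le> a" "a \<le> int m" by auto
    then have "1 \<le> P - 2 * a" "P - 2 * a < P" using p_eq(2) by linarith+
    moreover have "odd (P - 2 * a)" using odd_p by simp
    ultimately show "P - 2 * a \<in> {a \<in> {1..<P}. odd a}" by simp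
    show "(P - (P - 2 * a)) div 2 = a" by simp
  qed
  also have "(\<Sum>a\<in>{1..int m}. (2 * a) * chi (2 * a)) + (\<Sum>a\<in>{1..int m}. (P - 2 * a) * chi (P - 2 * a))
      = chi 2 * (\<Sum>a\<in>{1..int m}. 4 * (a * chi a) + (- P) * chi a)"
    unfolding sum.distrib[symmetric] sum_distrib_left
  proof (rule sum.cong)
    fix a
    have "chi (P - 2 * a) = - (chi 2 * chi a)" "chi (2 * a) = chi 2 * chi a" by (simp_all add: chi_mult)
    then show "2 * a * chi (2 * a) + (P - 2 * a) * chi (P - 2 * a) = chi 2 * (4 * (a * chi a) + - P * chi a)"
      by (simp only:) (simp add: algebra_simps)
  qed simp
  finally show "chi_moment = chi 2 * (4 * (\<Sum>a\<in>{1..int m}. a * chi a) - P * (\<Sum>a\<in>{1..int m}. chi a))"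
    unfolding lin by simp
qed

text \<open>Eliminating A from the two formulas for the moment gives 3h = L for p \<equiv> 3 modulo
  8 and h = L for p \<equiv> 7, where L = m - 2 nu is the character sum below p/2. The rest is
  reduction modulo 4.\<close>

theorem class_number_parity:
  assumes "p > 3"
  shows "(-1 :: int) ^ ((class_number (quadratic_field (- P)) + 1) div 2) = (-1) ^ nu"
proof -
  define h where "h = class_number (quadratic_field (- P))"
  define L where "L = (\<Sum>a\<in>{1..int m}. chi a)"
  define A where "A = (\<Sum>a\<in>{1..int m}. a * chi a)"
  have P0: "P \<noteq> 0" using p_gt_2 by simp
  have 1: "chi_moment = 2 * A - P * L" "chi_moment = chi 2 * (4 * A - P * L)"
    unfolding A_def L_def by (rule chi_moment_half)+
  have 2: "P * int h = - chi_moment" unfolding h_def by (rule class_number_formula[OF assms])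
  have "2 * int nu = int (card {1..int m}) - L"
    unfolding nu_alt L_def by (rule card_chi_interval) (use p_eq in auto)
  then have nu: "L = int m - 2 * int nu" by simp
  show ?thesis
  proof (cases rule: mod_8_cases)
    case (three M)
    have "P * (3 * int h) = P * L" using 1 2 unfolding three(4) by (simp add: algebra_simps)
    then have "3 * int h = L" using P0 by simp
    then have "3 * int h = 4 * int M + 1 - 2 * int nu" using nu three(2) by simp
    \<comment> \<open>Modulo 4 the equation reads -h \<equiv> 1 - 2 nu, that is h + 1 \<equiv> 2
      nu.\<close>
    then have "even ((h + 1) div 2) \<longleftrightarrow> even nu" by presburger
    then show ?thesis unfolding h_def by (simp add: minus_one_power_iff)
  next
    case (seven M)
    have "P * int h = P * L" using 1 2 unfolding seven(4) by (simp add: algebra_simps)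
    then have "int h = L" using P0 by simp
    then have "int h = 4 * int M + 3 - 2 * int nu" using nu seven(2) by simp
    then have "even ((h + 1) div 2) \<longleftrightarrow> even nu" by presburger
    then show ?thesis unfolding h_def by (simp add: minus_one_power_iff)
  qed
qed

end

theorem theorem1p3:
  fixes p :: nat
  assumes "prime p" and "[p = 3] (mod 4)"
  shows "(-1 :: int) ^ card {(j :: nat, k :: nat). 1 \<le> j \<and> j < k \<and> k \<le> (p - 1) div 2 \<and>
             (j * (j + 1)) mod p > (k * (k + 1)) mod p}
           = (-1) ^ ((p + 1) div 8)
       \<and>
         (p > 3 \<longrightarrow>
           (-1 :: int) ^ card {(j :: nat, k :: nat). 1 \<le> j \<and> j < k \<and> k \<le> (p - 1) div 2 \<and>
             triangle j mod p > triangle k mod p}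
           = (-1) ^ ((class_number (quadratic_field (- int p)) + 1) div 2 +
               card {k :: nat. 1 \<le> k \<and> k \<le> (p + 1) div 8 \<and> Legendre (int k) (int p) = 1}))"
proof -
  interpret prime_3_mod_4 p
    by standard (use assms in \<open>simp_all add: cong_iff_mod_eq\<close>)
  show ?thesis
    using pronic_inversions triangle_inversions class_number_parity by (simp add: power_add)
qed

end
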